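(* Let $p=2$ and let $(\beta,\zeta,\nu,a,f,u^{\mathrm{ini}})$ be admissible data (defined in the context) with $a(x,s,\xi)=\Lambda(x)\xi$, so that $a(x,\nu(u),\nabla\zeta(u))=\Lambda(x)\nabla\zeta(u)$, where $\Lambda$ is a measurable function from $\Omega$ to the $d\times d$ real matrices for which there exist $\underline\lambda,\overline\lambda>0$ such that, for a.e. $x\in\Omega$, $\Lambda(x)$ is symmetric with eigenvalues in $[\underline\lambda,\overline\lambda]$. Let $u_1$ and $u_2$ be two solutions (in the sense defined in the context) of the problem with these data. Then $\beta(u_1)=\beta(u_2)$ and $\zeta(u_1)=\zeta(u_2)$ (almost everywhere on $\Omega\times(0,T)$).
   Context: Throughout, $T>0$, $\Omega$ is a bounded open subset of $\mathbb R^d$ ($d\in\mathbb N$), $p\in(1,\infty)$ is fixed (here $p=2$), $p'=\frac{p}{p-1}$, and $W^{-1,p'}(\Omega)$ is the dual of $W^{1,p}_0(\Omega)$. **Admissible data.** $(\beta,\zeta,\nu,a,f,u^{\mathrm{ini}})$ is admissible if: - $\beta:\mathbb R\to\mathbb R$ is nondecreasing, Lipschitz continuous with Lipschitz constant $L_\beta>0$, and $\beta(0)=0$; - $\zeta:\mathbb R\to\mathbb R$ is nondecreasing, Lipschitz continuous with Lipschitz constant $L_\zeta>0$, $\zeta(0)=0$, and there are positive constants $M_1,M_2$ with $|\zeta(s)|\ge M_1|s|-M_2$ for every $s\in\mathbb R$; - $\nu(s)=\int_0^s\zeta'(q)\beta'(q)\,dq$ for all $s\in\mathbb R$; - $a:\Omega\times\mathbb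 R\times\mathbb R^d\to\mathbb R^d$ is Carathéodory, and there are constants $\underline a,\mu>0$ and a function $\overline a\in L^{p'}(\Omega)$ such that for a.e. $x\in\Omega$, every $s\in\mathbb R$ and all $\xi,\chi\in\mathbb R^d$: $a(x,s,\xi)\cdot\xi\ge\underline a|\xi|^p$, $|a(x,s,\xi)|\le\overline a(x)+\mu|\xi|^{p-1}$, and $(a(x,s,\xi)-a(x,s,\chi))\cdot(\xi-\chi)\ge0$; - $f\in L^{p'}(0,T;W^{-1,p'}(\Omega))$ and $u^{\mathrm{ini}}\in L^2(\Omega)$. **The function $B$.** Let $R_\beta$ be the range of $\beta$. For $s\in R_\beta$ let $\beta^r(s)=\inf\{t:\beta(t)=s\}$ if $s>0$, $\beta^r(0)=0$, $\beta^r(s)=\sup\{t:\beta(t)=s\}$ if $s<0$; being monotone, $\beta^r$ extends to $\overline{R_\beta}\to[-\infty,\infty]$. Set $B(z)=\int_0^z\zeta(\beta^r(s))\,ds\in[0,\infty]$ for $z\in\overline{R_\beta}$ and $B=+\infty$ on $\mathbb R\setminus\overline{R_\beta}$. **Solution.** A solution is a measurable $u:\Omega\times(0,T)\to\mathbb R$ such that $\zeta(u)\in L^p(0,T;W^{1,p}_0(\Omega))$, $B(\beta(u))\in L^\infty(0,T;L^1(\Omega))$, $\beta(u)\in C([0,T];L^2(\Omega)\text{-w})$, $\partial_t\beta(u)\in L^{p'}(0,T;W^{-1,p'}(\Omega))$, $\beta(u)(\cdot,0)=\beta(u^{\mathrm{ini}})$ in $L^2(\Omega)$, and for all $v\in L^p(0,T;W^{1,p}_0(\Omega))$,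 $$\int_0^T\langle\partial_t\beta(u),v\rangle_{W^{-1,p'},W^{1,p}_0}dt+\int_0^T\!\!\int_\Omega a(x,\nu(u),\nabla\zeta(u))\cdot\nabla v\,dx\,dt=\int_0^T\langle f,v\rangle_{W^{-1,p'},W^{1,p}_0}dt.$$ Here $C([0,T];L^2(\Omega)\text{-w})$ is the space of functions $[0,T]\to L^2(\Omega)$ continuous for the weak topology of $L^2(\Omega)$; $\beta(u)\in C([0,T];L^2(\Omega)\text{-w})$ means that $(x,t)\mapsto\beta(u(x,t))$ is a.e. equal to an element of that space, and $\beta(u)(\cdot,0)$ is the value at $0$ of this representative. *)

theory Defs
  imports "HOL-Analysis.Analysis"
begin

text \<open>
  Throughout, functions on \<open>\<Omega>\<close> are represented by total functions of which only the values on
  \<open>\<Omega>\<close> matter, and elements of Lebesgue and Sobolev spaces by arbitrary representatives of their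
  classes. ``Measurable'' and ``almost everywhere'' refer to the (complete) Lebesgue measure.
\<close>

section \<open>Test functions, Lebesgue and Sobolev spaces\<close>

primrec Ck :: "nat \<Rightarrow> ('a::euclidean_space \<Rightarrow> real) \<Rightarrow> bool" where
  "Ck 0 f \<longleftrightarrow> continuous_on UNIV f"
| "Ck (Suc k) f \<longleftrightarrow> (\<forall>x. f differentiable (at x)) \<and>
     (\<forall>b\<in>Basis. Ck k (\<lambda>x. frechet_derivative f (at x) b))"

definition test_functions :: "'a::euclidean_space set \<Rightarrow> ('a \<Rightarrow> real) set" where
  "test_functions U = {\<phi>. (\<forall>k. Ck k \<phi>) \<and> compact (closure {x. \<phi> x \<noteq> 0}) \<and>
     closure {x. \<phi> x \<noteq> 0} \<subseteq> U}"

definition Lp :: "real \<Rightarrow> 'a::euclidean_space set \<Rightarrow> ('a \<Rightarrow> 'b::euclidean_space) set" where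
  "Lp p U = {g \<in> borel_measurable (lebesgue_on U).
     integrable (lebesgue_on U) (\<lambda>x. norm (g x) powr p)}"

definition loc_integrable :: "'a::euclidean_space set \<Rightarrow> ('a \<Rightarrow> 'b::euclidean_space) \<Rightarrow> bool" where
  "loc_integrable U g \<longleftrightarrow> (\<forall>K. compact K \<and> K \<subseteq> U \<longrightarrow> integrable (lebesgue_on K) g)"

definition has_weak_gradient ::
    "(real^'n) set \<Rightarrow> (real^'n \<Rightarrow> real) \<Rightarrow> (real^'n \<Rightarrow> real^'n) \<Rightarrow> bool" where
  "has_weak_gradient \<Omega> v G \<longleftrightarrow> loc_integrable \<Omega> v \<and> loc_integrable \<Omega> G \<and>
     (\<forall>\<phi>\<in>test_functions \<Omega>. \<forall>i.
        (LINT x|lebesgue_on \<Omega>. v x * frechet_derivative \<phi> (at x) (axis i 1)) =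
        - (LINT x|lebesgue_on \<Omega>. G x $ i * \<phi> x))"

text \<open>The weak gradient is unique up to null sets; a representative is chosen.\<close>

definition weak_grad :: "(real^'n) set \<Rightarrow> (real^'n \<Rightarrow> real) \<Rightarrow> real^'n \<Rightarrow> real^'n" where
  "weak_grad \<Omega> v = (SOME G. has_weak_gradient \<Omega> v G)"

definition W1 :: "real \<Rightarrow> (real^'n) set \<Rightarrow> (real^'n \<Rightarrow> real) set" where
  "W1 p \<Omega> = {v \<in> Lp p \<Omega>. \<exists>G\<in>Lp p \<Omega>. has_weak_gradient \<Omega> v G}"

definition W1_norm :: "real \<Rightarrow> (real^'n) set \<Rightarrow> (real^'n \<Rightarrow> real) \<Rightarrow> real" where
  "W1_norm p \<Omega> v =
     ((LINT x|lebesgue_on \<Omega>. \<bar>v x\<bar> powr p) +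
      (LINT x|lebesgue_on \<Omega>. norm (weak_grad \<Omega> v x) powr p)) powr (1 / p)"

definition W10 :: "real \<Rightarrow> (real^'n) set \<Rightarrow> (real^'n \<Rightarrow> real) set" where
  "W10 p \<Omega> = {v \<in> W1 p \<Omega>. \<exists>\<phi>. (\<forall>k::nat. \<phi> k \<in> test_functions \<Omega>) \<and>
     (\<lambda>k. W1_norm p \<Omega> (\<phi> k - v)) \<longlonglongrightarrow> 0}"

text \<open>
  The dual of \<open>W10 p \<Omega>\<close>, i.e. the space \<open>W\<^sup>-\<^sup>1\<^sup>,\<^sup>p\<^sup>'(\<Omega>)\<close>. Boundedness forces a functional to take
  the same value on functions that agree almost everywhere; values outside \<open>W10 p \<Omega>\<close> are
  irrelevant.
\<close>

definition W10_dual :: "real \<Rightarrow> (real^'n) set \<Rightarrow> ((real^'n \<Rightarrow> real) \<Rightarrow> real) set" where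
  "W10_dual p \<Omega> = {F.
     (\<forall>v\<in>W10 p \<Omega>. \<forall>w\<in>W10 p \<Omega>. F (\<lambda>x. v x + w x) = F v + F w) \<and>
     (\<forall>v\<in>W10 p \<Omega>. \<forall>c. F (\<lambda>x. c * v x) = c * F v) \<and>
     (\<exists>C. \<forall>v\<in>W10 p \<Omega>. \<bar>F v\<bar> \<le> C * W1_norm p \<Omega> v)}"

definition W10_dual_norm :: "real \<Rightarrow> (real^'n) set \<Rightarrow> ((real^'n \<Rightarrow> real) \<Rightarrow> real) \<Rightarrow> real" where
  "W10_dual_norm p \<Omega> F = (SUP v\<in>{v \<in> W10 p \<Omega>. W1_norm p \<Omega> v \<le> 1}. \<bar>F v\<bar>)"

section \<open>Bochner spaces\<close>

text \<open>
  \<open>V\<close> is the carrier of the target space and \<open>N\<close> its norm (a seminorm on representatives).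
  Strong measurability: almost everywhere limit of simple functions.
\<close>

definition strongly_measurable ::
    "real \<Rightarrow> 'b::minus set \<Rightarrow> ('b \<Rightarrow> real) \<Rightarrow> (real \<Rightarrow> 'b) \<Rightarrow> bool" where
  "strongly_measurable T V N v \<longleftrightarrow>
     (AE t in lebesgue_on {0<..<T}. v t \<in> V) \<and>
     (\<exists>s. (\<forall>k::nat. finite (s k ` {0<..<T}) \<and> s k ` {0<..<T} \<subseteq> V \<and>
              (\<forall>y. {t \<in> {0<..<T}. s k t = y} \<in> sets lebesgue)) \<and>
          (AE t in lebesgue_on {0<..<T}. (\<lambda>k. N (s k t - v t)) \<longlonglongrightarrow> 0))"

definition bochner_Lp ::
    "real \<Rightarrow> real \<Rightarrow> 'b::minus set \<Rightarrow> ('b \<Rightarrow> real) \<Rightarrow> (real \<Rightarrow> 'b) set" where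
  "bochner_Lp q T V N = {v. strongly_measurable T V N v \<and>
     integrable (lebesgue_on {0<..<T}) (\<lambda>t. N (v t) powr q)}"

abbreviation LpW10 :: "real \<Rightarrow> real \<Rightarrow> (real^'n) set \<Rightarrow> (real \<Rightarrow> real^'n \<Rightarrow> real) set" where
  "LpW10 p T \<Omega> \<equiv> bochner_Lp p T (W10 p \<Omega>) (W1_norm p \<Omega>)"

abbreviation LpW10_dual ::
    "real \<Rightarrow> real \<Rightarrow> (real^'n) set \<Rightarrow> (real \<Rightarrow> (real^'n \<Rightarrow> real) \<Rightarrow> real) set" where
  "LpW10_dual p T \<Omega> \<equiv> bochner_Lp (p / (p - 1)) T (W10_dual p \<Omega>) (W10_dual_norm p \<Omega>)"

definition weakly_continuous_L2 ::
    "real \<Rightarrow> 'a::euclidean_space set \<Rightarrow> (real \<Rightarrow> 'a \<Rightarrow> real) \<Rightarrow> bool" where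
  "weakly_continuous_L2 T \<Omega> w \<longleftrightarrow> (\<forall>t\<in>{0..T}. w t \<in> Lp 2 \<Omega>) \<and>
     (\<forall>g\<in>Lp 2 \<Omega>. continuous_on {0..T} (\<lambda>t. LINT x|lebesgue_on \<Omega>. w t x * g x))"

text \<open>\<open>w\<close> is the time derivative of \<open>g\<close> in the sense of distributions, tested against
  products \<open>\<psi>(t) \<phi>(x)\<close>.\<close>

definition has_time_derivative ::
    "real \<Rightarrow> 'a::euclidean_space set \<Rightarrow> (real \<Rightarrow> 'a \<Rightarrow> real) \<Rightarrow>
     (real \<Rightarrow> ('a \<Rightarrow> real) \<Rightarrow> real) \<Rightarrow> bool" where
  "has_time_derivative T \<Omega> g w \<longleftrightarrow>
     (\<forall>\<psi>\<in>test_functions {0<..<T}. \<forall>\<phi>\<in>test_functions \<Omega>.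
        (LINT t|lebesgue_on {0<..<T}. \<psi> t * w t \<phi>) =
        - (LINT t|lebesgue_on {0<..<T}. deriv \<psi> t * (LINT x|lebesgue_on \<Omega>. g t x * \<phi> x)))"

section \<open>Data\<close>

definition caratheodory ::
    "(real^'n) set \<Rightarrow> (real^'n \<Rightarrow> real \<Rightarrow> real^'n \<Rightarrow> real^'n) \<Rightarrow> bool" where
  "caratheodory \<Omega> a \<longleftrightarrow>
     (\<forall>s \<xi>. (\<lambda>x. a x s \<xi>) \<in> borel_measurable (lebesgue_on \<Omega>)) \<and>
     (AE x in lebesgue_on \<Omega>. continuous_on UNIV (\<lambda>(s, \<xi>). a x s \<xi>))"

text \<open>The Lipschitz functions \<open>\<beta>\<close>, \<open>\<zeta>\<close> are differentiable almost everywhere, so the value of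
  \<open>deriv\<close> at the exceptional points does not affect \<open>\<nu>\<close>.\<close>

definition admissible ::
    "real \<Rightarrow> real \<Rightarrow> (real^'n) set \<Rightarrow> (real \<Rightarrow> real) \<Rightarrow> (real \<Rightarrow> real) \<Rightarrow> (real \<Rightarrow> real) \<Rightarrow>
     (real^'n \<Rightarrow> real \<Rightarrow> real^'n \<Rightarrow> real^'n) \<Rightarrow> (real \<Rightarrow> (real^'n \<Rightarrow> real) \<Rightarrow> real) \<Rightarrow>
     (real^'n \<Rightarrow> real) \<Rightarrow> bool" where
  "admissible p T \<Omega> \<beta> \<zeta> \<nu> a f uini \<longleftrightarrow>
     (mono \<beta> \<and> (\<exists>L>0. L-lipschitz_on UNIV \<beta>) \<and> \<beta> 0 = 0) \<and>
     (mono \<zeta> \<and> (\<exists>L>0. L-lipschitz_on UNIV \<zeta>) \<and> \<zeta> 0 = 0 \<and>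
       (\<exists>M1>0. \<exists>M2>0. \<forall>s. \<bar>\<zeta> s\<bar> \<ge> M1 * \<bar>s\<bar> - M2)) \<and>
     (\<forall>s. \<nu> s = interval_lebesgue_integral lebesgue 0 (ereal s) (\<lambda>q. deriv \<zeta> q * deriv \<beta> q)) \<and>
     (caratheodory \<Omega> a \<and>
       (\<exists>alow>0. \<exists>\<mu>>0. \<exists>aup\<in>Lp (p / (p - 1)) \<Omega>.
         AE x in lebesgue_on \<Omega>. \<forall>s \<xi> \<eta>.
           a x s \<xi> \<bullet> \<xi> \<ge> alow * norm \<xi> powr p \<and>
           norm (a x s \<xi>) \<le> aup x + \<mu> * norm \<xi> powr (p - 1) \<and>
           (a x s \<xi> - a x s \<eta>) \<bullet> (\<xi> - \<eta>) \<ge> 0)) \<and>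
     f \<in> LpW10_dual p T \<Omega> \<and>
     uini \<in> Lp 2 \<Omega>"

definition beta_r :: "(real \<Rightarrow> real) \<Rightarrow> real \<Rightarrow> real" where
  "beta_r \<beta> s = (if s > 0 then Inf {t. \<beta> t = s} else if s = 0 then 0 else Sup {t. \<beta> t = s})"

text \<open>
  \<open>B(z) = \<integral>\<^sub>0\<^sup>z \<zeta>(\<beta>\<^sup>r(s)) ds\<close>. For \<open>z < 0\<close> the integrand is nonpositive and the orientation of the
  integral makes the value nonnegative. The range of \<open>\<beta>\<close> is an interval containing \<open>0\<close>, hence the
  open interval between \<open>0\<close> and a point \<open>z\<close> of its closure lies in the range, and the possibly
  infinite values of the extension of \<open>\<beta>\<^sup>r\<close> at the end points do not enter.
\<close>

definition B_fun :: "(real \<Rightarrow> real) \<Rightarrow> (real \<Rightarrow> real) \<Rightarrow> real \<Rightarrow> ennreal" where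
  "B_fun \<beta> \<zeta> z =
     (if z \<notin> closure (range \<beta>) then \<infinity>
      else if z \<ge> 0 then (\<integral>\<^sup>+s\<in>{0<..<z}. ennreal (\<zeta> (beta_r \<beta> s)) \<partial>lebesgue)
      else (\<integral>\<^sup>+s\<in>{z<..<0}. ennreal (- \<zeta> (beta_r \<beta> s)) \<partial>lebesgue))"

section \<open>Solutions\<close>

text \<open>
  \<open>bu\<close> is the weakly continuous representative of \<open>\<beta>(u)\<close> and \<open>dbu\<close> the time derivative of
  \<open>\<beta>(u)\<close>; both are unique up to null sets. Since \<open>bu t\<close> is a mere representative of a class for
  each \<open>t\<close>, no joint measurability is available for \<open>bu\<close>, and ``almost everywhere equal'' is
  expressed slice-wise.
\<close>

definition solution ::
    "real \<Rightarrow> real \<Rightarrow> (real^'n) set \<Rightarrow> (real \<Rightarrow> real) \<Rightarrow> (real \<Rightarrow> real) \<Rightarrow> (real \<Rightarrow> real) \<Rightarrow>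
     (real^'n \<Rightarrow> real \<Rightarrow> real^'n \<Rightarrow> real^'n) \<Rightarrow> (real \<Rightarrow> (real^'n \<Rightarrow> real) \<Rightarrow> real) \<Rightarrow>
     (real^'n \<Rightarrow> real) \<Rightarrow> ((real^'n) \<times> real \<Rightarrow> real) \<Rightarrow> bool" where
  "solution p T \<Omega> \<beta> \<zeta> \<nu> a f uini u \<longleftrightarrow>
     u \<in> borel_measurable (lebesgue_on (\<Omega> \<times> {0<..<T})) \<and>
     (\<lambda>t x. \<zeta> (u (x, t))) \<in> LpW10 p T \<Omega> \<and>
     ((\<lambda>z. B_fun \<beta> \<zeta> (\<beta> (u z))) \<in> borel_measurable (lebesgue_on (\<Omega> \<times> {0<..<T})) \<and>
       (\<exists>C::real. AE t in lebesgue_on {0<..<T}.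
          (\<integral>\<^sup>+x. B_fun \<beta> \<zeta> (\<beta> (u (x, t))) \<partial>lebesgue_on \<Omega>) \<le> ennreal C)) \<and>
     (\<exists>bu. weakly_continuous_L2 T \<Omega> bu \<and>
       (AE t in lebesgue_on {0<..<T}. AE x in lebesgue_on \<Omega>. \<beta> (u (x, t)) = bu t x) \<and>
       (AE x in lebesgue_on \<Omega>. bu 0 x = \<beta> (uini x))) \<and>
     (\<exists>dbu\<in>LpW10_dual p T \<Omega>. has_time_derivative T \<Omega> (\<lambda>t x. \<beta> (u (x, t))) dbu \<and>
       (\<forall>v\<in>LpW10 p T \<Omega>.
          (LINT t|lebesgue_on {0<..<T}. dbu t (v t)) +
          (LINT t|lebesgue_on {0<..<T}. LINT x|lebesgue_on \<Omega>.
             a x (\<nu> (u (x, t))) (weak_grad \<Omega> (\<lambda>x. \<zeta> (u (x, t))) x) \<bullet> weak_grad \<Omega> (v t) x) =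
          (LINT t|lebesgue_on {0<..<T}. f t (v t))))"

definition eigenvalue :: "real^'n^'n \<Rightarrow> real \<Rightarrow> bool" where
  "eigenvalue A e \<longleftrightarrow> (\<exists>v. v \<noteq> 0 \<and> A *v v = e *\<^sub>R v)"

end

theory Submission
  imports Defs
begin

text \<open>
  Write \<open>b = \<beta>(u\<^sub>1) - \<beta>(u\<^sub>2)\<close>, \<open>z = \<zeta>(u\<^sub>1) - \<zeta>(u\<^sub>2)\<close> and \<open>a(v, w) = \<integral> \<Lambda> \<nabla>v \<cdot> \<nabla>w\<close>, a symmetric
  nonnegative form on \<open>W10 2 \<Omega>\<close>. Subtracting the two equations removes \<open>f\<close>, and integrating in time from
  \<open>b(0) = 0\<close> gives, for every \<open>\<phi>\<close> in \<open>W10 2 \<Omega>\<close> and every \<open>t\<close>,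
  \<open>\<integral> b(t) \<phi> = - \<integral>\<^sub>0\<^sup>t a(z(s), \<phi>) ds\<close>.
  For almost every \<open>t\<close> one may take \<open>\<phi> = z(t)\<close>. Since \<open>\<beta>\<close> and \<open>\<zeta>\<close> are both nondecreasing, \<open>b z \<ge> 0\<close>, so
  \<open>\<integral>\<^sub>0\<^sup>t a(z(s), z(t)) ds \<le> 0\<close>. Integrated over \<open>t\<close> in \<open>(0, \<tau>)\<close>, the left side is, by symmetry of \<open>a\<close>,
  one half of \<open>E(\<tau>) = \<integral>\<^sub>0\<^sup>\<tau> \<integral>\<^sub>0\<^sup>\<tau> a(z(s), z(t)) ds dt\<close>, that is one half of the energy \<open>a(Z, Z)\<close> of
  \<open>Z = \<integral>\<^sub>0\<^sup>\<tau> z\<close>, which is nonnegative. Hence \<open>E(\<tau>) = 0\<close>, the Cauchy-Schwarz inequality gives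
  \<open>\<integral>\<^sub>0\<^sup>\<tau> a(z(s), \<phi>) ds = 0\<close> for all \<open>\<tau>\<close> and \<open>\<phi>\<close>, and therefore \<open>\<integral> b(\<tau>) \<phi> = 0\<close>, so \<open>b = 0\<close>. Also
  \<open>a(z(s), \<phi>) = 0\<close> for almost every \<open>s\<close>; a countable dense family of \<open>\<phi>\<close> allows \<open>\<phi> = z(s)\<close>, so
  \<open>\<nabla>z(s) = 0\<close> and \<open>z(s) = 0\<close> because \<open>z(s)\<close> has zero boundary values.

  This argument is \<open>energy_argument\<close>. It rests on four ingredients. The fundamental lemma of the calculus
  of variations (\<open>fundamental_lemma_variations\<close>, from explicit smooth bumps) makes weak gradients unique,
  hence \<open>weak_grad\<close> linear up to null sets, and concludes \<open>b = 0\<close>. The du Bois-Reymond lemma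
  (\<open>du_Bois_Reymond\<close>) turns the distributional time derivative into the integrated identity.
  The locale \<open>semidefinite_path\<close> and \<open>symmetric_kernel_half\<close> treat \<open>E(\<tau>)\<close> through the scalar kernel
  \<open>a(z(s), z(t))\<close> alone, so that no vector-valued integral \<open>Z\<close> has to be formed. Finally
  \<open>W10_gradient_zero_imp_zero\<close> replaces the Poincare inequality.
\<close>

section \<open>Smooth functions and test functions\<close>

lemma Ck_SucI:
  assumes "\<And>x. (f has_derivative f' x) (at x)" and "\<And>b. b \<in> Basis \<Longrightarrow> Ck k (\<lambda>x. f' x b)"
  shows "Ck (Suc k) f"
proof -
  have "frechet_derivative f (at x) = f' x" for x
    using frechet_derivative_at[OF assms(1)] by simp
  then show ?thesis using assms by (auto simp: differentiable_def)
qed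

lemma Ck_SucD:
  assumes "Ck (Suc k) f"
  shows "(f has_derivative frechet_derivative f (at x)) (at x)"
    and "b \<in> Basis \<Longrightarrow> Ck k (\<lambda>x. frechet_derivative f (at x) b)"
  using assms by (auto simp: frechet_derivative_works)

lemma Ck_pred: "Ck (Suc k) f \<Longrightarrow> Ck k f"
proof (induction k arbitrary: f)
  case 0
  then show ?case
    by (auto simp: continuous_on_eq_continuous_within intro: differentiable_imp_continuous_within)
next
  case (Suc k)
  from Suc.prems have "\<forall>x. f differentiable (at x)"
    and "\<forall>b\<in>Basis. Ck (Suc k) (\<lambda>x. frechet_derivative f (at x) b)"
    unfolding Ck.simps(2)[of "Suc k"] by blast+
  with Suc.IH show ?case unfolding Ck.simps(2)[of k] by blast
qed

lemma Ck_const: "Ck k (\<lambda>x::'a::euclidean_space. c)"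
proof (induction k arbitrary: c)
  case (Suc k)
  show ?case by (rule Ck_SucI[where f' = "\<lambda>x h. 0"]) (use Suc in auto)
qed simp

lemma Ck_add: "Ck k f \<Longrightarrow> Ck k g \<Longrightarrow> Ck k (\<lambda>x. f x + g x)"
proof (induction k arbitrary: f g)
  case 0
  then show ?case by (auto intro!: continuous_intros)
next
  case (Suc k)
  show ?case
    by (rule Ck_SucI[OF has_derivative_add[OF Ck_SucD(1)[OF Suc.prems(1)] Ck_SucD(1)[OF Suc.prems(2)]]])
       (intro Suc.IH Ck_SucD(2)[OF Suc.prems(1)] Ck_SucD(2)[OF Suc.prems(2)])
qed

lemma Ck_mult: "Ck k f \<Longrightarrow> Ck k g \<Longrightarrow> Ck k (\<lambda>x. f x * g x)"
proof (induction k arbitrary: f g)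
  case 0
  then show ?case by (auto intro!: continuous_intros)
next
  case (Suc k)
  show ?case
    by (rule Ck_SucI[OF has_derivative_mult[OF Ck_SucD(1)[OF Suc.prems(1)] Ck_SucD(1)[OF Suc.prems(2)]]])
       (intro Ck_add Suc.IH Ck_pred[OF Suc.prems(1)] Ck_pred[OF Suc.prems(2)]
          Ck_SucD(2)[OF Suc.prems(1)] Ck_SucD(2)[OF Suc.prems(2)])
qed

lemma Ck_cmult: "Ck k f \<Longrightarrow> Ck k (\<lambda>x. c * f x)"
  by (intro Ck_mult Ck_const)

lemma Ck_diff: "Ck k f \<Longrightarrow> Ck k g \<Longrightarrow> Ck k (\<lambda>x. f x - g x)"
  using Ck_add[of k f "\<lambda>x. (-1) * g x"] Ck_cmult[of k g "-1"] by simp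

lemma Ck_power: "Ck k f \<Longrightarrow> Ck k (\<lambda>x. f x ^ m)"
  by (induction m) (auto intro: Ck_const Ck_mult)

lemma Ck_prod: "(\<And>i. i \<in> I \<Longrightarrow> Ck k (f i)) \<Longrightarrow> Ck k (\<lambda>x. \<Prod>i\<in>I. f i x)"
  by (induction I rule: infinite_finite_induct) (auto intro: Ck_const Ck_mult)

lemma Ck_inner: "Ck k (\<lambda>x::'a::euclidean_space. x \<bullet> v)"
proof (cases k)
  case (Suc k')
  show ?thesis unfolding Suc
    by (rule Ck_SucI[where f' = "\<lambda>x h. h \<bullet> v"]) (auto intro: Ck_const derivative_eq_intros)
qed (auto intro!: continuous_intros)

lemma Ck_compose_affine:
  fixes h :: "real \<Rightarrow> real"
  shows "Ck k h \<Longrightarrow> Ck k (\<lambda>x::'a::euclidean_space. h (c + x \<bullet> v))"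
proof (induction k arbitrary: h)
  case 0
  then have "continuous_on UNIV h" by simp
  then show ?case
    by (auto intro!: continuous_on_compose2[of UNIV h] continuous_intros)
next
  case (Suc k)
  define h' where "h' = (\<lambda>t. frechet_derivative h (at t) 1)"
  have h': "(h has_derivative frechet_derivative h (at t)) (at t)" for t
    by (rule Ck_SucD(1)[OF Suc.prems])
  have lin: "frechet_derivative h (at t) s = s * h' t" for t s
    using linear_cmul[OF has_derivative_linear[OF h'[of t]], of s 1] by (simp add: h'_def)
  have "((\<lambda>x::'a. h (c + x \<bullet> v)) has_derivative (\<lambda>y. (y \<bullet> v) * h' (c + x \<bullet> v))) (at x)" for x
    unfolding lin[symmetric]
    by (rule has_derivative_compose[of "\<lambda>x. c + x \<bullet> v", OF _ h'])
       (auto intro!: derivative_eq_intros)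
  then show ?case
    by (rule Ck_SucI)
       (intro Ck_cmult Suc.IH, use Ck_SucD(2)[OF Suc.prems, of 1] in \<open>simp add: h'_def\<close>)
qed

text \<open>All derivatives of \<open>exp (-1/t)\<close> are linear combinations of the functions \<open>flat n\<close>, which
  makes the family closed under differentiation and smoothness an induction.\<close>

definition flat :: "nat \<Rightarrow> real \<Rightarrow> real" where
  "flat n t = (if t > 0 then exp (- 1 / t) / t ^ n else 0)"

lemma flat_nonneg: "0 \<le> flat n t"
  by (simp add: flat_def)

lemma flat_le_square: "flat n t \<le> fact (n + 2) * t\<^sup>2"
proof (cases "t > 0")
  case True
  have "(1 / t) ^ (n + 2) / fact (n + 2) \<le> exp (1 / t)"
    using exp_ge_zero sum_le_suminf[OF summable_exp_generic[of "1/t"], of "{n+2}"] True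
    by (simp add: exp_def divide_inverse mult.commute)
  then have "1 / exp (1 / t) \<le> 1 / ((1 / t) ^ (n + 2) / fact (n + 2))"
    using True by (intro divide_left_mono) auto
  then have "exp (- 1 / t) \<le> fact (n + 2) * t ^ (n + 2)"
    using True by (simp add: exp_minus inverse_eq_divide power_divide mult_ac del: fact_Suc)
  then have "exp (- 1 / t) \<le> (fact (n + 2) * t\<^sup>2) * t ^ n"
    by (simp only: power_add mult_ac)
  then show ?thesis using True by (simp add: flat_def pos_divide_le_eq del: fact_Suc)
qed (simp add: flat_def)

lemma flat_has_derivative:
  "(flat n has_real_derivative flat (n + 2) t - of_nat n * flat (n + 1) t) (at t)"
proof -
  consider "t > 0" | "t < 0" | "t = 0" by linarith
  then show ?thesis
  proof cases
    case 1
    have "((\<lambda>t. exp (- 1 / t) / t ^ n) has_real_derivative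
        flat (n + 2) t - of_nat n * flat (n + 1) t) (at t)"
    proof (cases n)
      case 0
      then show ?thesis using 1
        by (auto intro!: derivative_eq_intros simp: flat_def field_simps power2_eq_square)
    next
      case (Suc m)
      have "((\<lambda>t. exp (- 1 / t) / t ^ Suc m) has_real_derivative
          ((exp (- 1 / t) * (1 / t\<^sup>2)) * t ^ Suc m - exp (- 1 / t) * (of_nat (Suc m) * t ^ m)) /
            (t ^ Suc m * t ^ Suc m)) (at t)"
        using 1
        by (intro DERIV_divide)
           (auto intro!: derivative_eq_intros DERIV_cong[OF DERIV_pow[of "Suc m"]]
             simp: power2_eq_square simp del: power_Suc)
      moreover have "((exp (- 1 / t) * (1 / t\<^sup>2)) * t ^ Suc m - exp (- 1 / t) * (of_nat (Suc m) * t ^ m)) /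
            (t ^ Suc m * t ^ Suc m) = flat (n + 2) t - of_nat n * flat (n + 1) t"
        using 1 Suc by (simp add: flat_def field_simps power2_eq_square)
      ultimately show ?thesis using Suc by simp
    qed
    then show ?thesis
      by (rule has_field_derivative_transform_within_open[where S = "{0<..}"])
         (use 1 in \<open>auto simp: flat_def\<close>)
  next
    case 2
    have "((\<lambda>t. 0) has_real_derivative flat (n + 2) t - of_nat n * flat (n + 1) t) (at t)"
      using 2 by (simp add: flat_def)
    then show ?thesis
      by (rule has_field_derivative_transform_within_open[where S = "{..<0}"])
         (use 2 in \<open>auto simp: flat_def\<close>)
  next
    case 3
    have "(\<lambda>h. (flat n (0 + h) - flat n 0) / h) \<midarrow>0\<rightarrow> 0"
    proof (rule Lim_null_comparison[where g = "\<lambda>h. fact (n + 2) * \<bar>h\<bar>"])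
      show "\<forall>\<^sub>F h in at 0. norm ((flat n (0 + h) - flat n 0) / h) \<le> fact (n + 2) * \<bar>h\<bar>"
      proof (rule always_eventually, rule allI)
        fix h
        show "norm ((flat n (0 + h) - flat n 0) / h) \<le> fact (n + 2) * \<bar>h\<bar>"
        proof (cases "h > 0")
          case True
          then have "flat n h / h \<le> fact (n + 2) * h\<^sup>2 / h"
            using flat_le_square[of n h] by (intro divide_right_mono) auto
          then show ?thesis
            using True flat_nonneg[of n h] by (simp add: flat_def power2_eq_square del: fact_Suc)
        qed (simp add: flat_def mult_nonneg_nonpos del: fact_Suc)
      qed
    qed (auto intro!: tendsto_eq_intros)
    then show ?thesis using 3 by (simp add: DERIV_def flat_def)
  qed
qed

lemma Ck_flat: "Ck k (flat n)"
proof (induction k arbitrary: n)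
  case 0
  show ?case
    using DERIV_isCont[OF flat_has_derivative] by (simp add: continuous_on_eq_continuous_at)
next
  case (Suc k)
  show ?case
    by (rule Ck_SucI[OF flat_has_derivative[unfolded has_field_derivative_def]])
       (auto intro!: Ck_mult Ck_diff Ck_const Suc.IH)
qed

definition box_bump :: "'a::euclidean_space \<Rightarrow> 'a \<Rightarrow> 'a \<Rightarrow> real" where
  "box_bump a b x = (\<Prod>i\<in>Basis. flat 0 (x \<bullet> i - a \<bullet> i) * flat 0 (b \<bullet> i - x \<bullet> i))"

lemma box_bump_le_1: "0 \<le> box_bump a b x" "box_bump a b x \<le> 1"
  unfolding box_bump_def
  by (auto intro!: prod_nonneg prod_le_1 mult_nonneg_nonneg mult_le_one flat_nonneg simp: flat_def)

lemma box_bump_pos: "x \<in> box a b \<Longrightarrow> 0 < box_bump a b x"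
  unfolding box_bump_def by (auto intro!: prod_pos simp: flat_def mem_box)

lemma box_bump_outside: "x \<notin> box a b \<Longrightarrow> box_bump a b x = 0"
  unfolding box_bump_def by (force simp: flat_def mem_box not_less)

lemma Ck_box_bump: "Ck k (box_bump a b)"
proof -
  have "Ck k (\<lambda>x::'a. flat 0 (- (a \<bullet> i) + x \<bullet> i))" "Ck k (\<lambda>x::'a. flat 0 (b \<bullet> i + x \<bullet> (- i)))" for i
    by (rule Ck_compose_affine[OF Ck_flat])+
  then show ?thesis unfolding box_bump_def[abs_def]
    by (intro Ck_prod Ck_mult) (simp_all add: algebra_simps)
qed

lemma test_functionsI:
  assumes "\<And>k. Ck k \<phi>" "compact K" "K \<subseteq> U" "\<And>x. x \<notin> K \<Longrightarrow> \<phi> x = 0"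
  shows "\<phi> \<in> test_functions U"
proof -
  have "closure {x. \<phi> x \<noteq> 0} \<subseteq> K"
    by (rule closure_minimal) (use assms compact_imp_closed in auto)
  moreover from this have "compact (closure {x. \<phi> x \<noteq> 0})"
    using assms(2) by (metis closed_closure compact_Int_closed inf.absorb2)
  ultimately show ?thesis using assms by (auto simp: test_functions_def)
qed

lemma test_functionsE:
  assumes "\<phi> \<in> test_functions U"
  obtains K where "\<And>k. Ck k \<phi>" "compact K" "K \<subseteq> U" "\<And>x. x \<notin> K \<Longrightarrow> \<phi> x = 0"
  using assms closure_subset[of "{x. \<phi> x \<noteq> 0}"] unfolding test_functions_def by blast

lemma test_function_Ck: "\<phi> \<in> test_functions U \<Longrightarrow> Ck k \<phi>"
  by (simp add: test_functions_def)

lemma test_function_continuous: "\<phi> \<in> test_functions U \<Longrightarrow> continuous_on UNIV \<phi>"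
  using test_function_Ck[of \<phi> U 0] by simp

lemma test_function_has_derivative:
  "\<phi> \<in> test_functions U \<Longrightarrow> (\<phi> has_derivative frechet_derivative \<phi> (at x)) (at x)"
  using Ck_SucD(1)[OF test_function_Ck] .

lemma test_functions_add:
  assumes "\<phi> \<in> test_functions U" "\<psi> \<in> test_functions U"
  shows "(\<lambda>x. \<phi> x + \<psi> x) \<in> test_functions U"
proof -
  obtain K L where "compact K" "K \<subseteq> U" "\<And>x. x \<notin> K \<Longrightarrow> \<phi> x = 0"
    "compact L" "L \<subseteq> U" "\<And>x. x \<notin> L \<Longrightarrow> \<psi> x = 0"
    using assms test_functionsE by metis
  then show ?thesis
    by (intro test_functionsI[where K = "K \<union> L"])
       (auto intro: Ck_add test_function_Ck[OF assms(1)] test_function_Ck[OF assms(2)])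
qed

lemma test_functions_mult:
  assumes "\<phi> \<in> test_functions U" "\<And>k. Ck k g"
  shows "(\<lambda>x. g x * \<phi> x) \<in> test_functions U"
proof -
  obtain K where "compact K" "K \<subseteq> U" "\<And>x. x \<notin> K \<Longrightarrow> \<phi> x = 0"
    using assms test_functionsE by metis
  then show ?thesis
    by (intro test_functionsI[where K = K])
       (auto intro: Ck_mult test_function_Ck[OF assms(1)] assms(2))
qed

lemma test_functions_cmult: "\<phi> \<in> test_functions U \<Longrightarrow> (\<lambda>x. c * \<phi> x) \<in> test_functions U"
  by (rule test_functions_mult) (auto intro: Ck_const)

lemma test_functions_derivative:
  assumes "\<phi> \<in> test_functions U" "b \<in> Basis"
  shows "(\<lambda>x. frechet_derivative \<phi> (at x) b) \<in> test_functions U"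
proof -
  obtain K where K: "compact K" "K \<subseteq> U" "\<And>x. x \<notin> K \<Longrightarrow> \<phi> x = 0"
    using assms test_functionsE by metis
  have "frechet_derivative \<phi> (at x) b = 0" if "x \<notin> K" for x
  proof -
    have "(\<phi> has_derivative (\<lambda>_. 0)) (at x)"
      by (rule has_derivative_transform_within_open[of "\<lambda>_. 0" _ _ _ "- K"])
         (use K that compact_imp_closed in auto)
    then show ?thesis using frechet_derivative_at by metis
  qed
  then show ?thesis using K
    by (intro test_functionsI[where K = K])
       (auto intro: Ck_SucD(2)[OF test_function_Ck[OF assms(1)] assms(2)])
qed

lemma test_function_bounded:
  assumes "\<phi> \<in> test_functions U"
  obtains C where "\<And>x. \<bar>\<phi> x\<bar> \<le> C"
proof -
  obtain K where K: "compact K" "\<And>x. x \<notin> K \<Longrightarrow> \<phi> x = 0"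
    using assms test_functionsE by metis
  have "bounded (\<phi> ` K)"
    using K(1) test_function_continuous[OF assms]
    by (intro compact_imp_bounded compact_continuous_image) (auto intro: continuous_on_subset)
  then obtain C where C: "\<And>x. x \<in> K \<Longrightarrow> \<bar>\<phi> x\<bar> \<le> C" by (auto simp: bounded_iff)
  have "\<bar>\<phi> x\<bar> \<le> max C 0" for x using C[of x] K(2)[of x] by (cases "x \<in> K") auto
  then show ?thesis using that by blast
qed

lemma test_function_measurable:
  "\<phi> \<in> test_functions U \<Longrightarrow> \<phi> \<in> borel_measurable (lebesgue_on S)"
  using borel_measurable_continuous_onI[OF test_function_continuous, of \<phi> U]
  by (intro measurable_restrict_space1) (simp add: measurable_completion)

lemma test_function_0: "(\<lambda>x. 0) \<in> test_functions U"
  by (rule test_functionsI[where K = "{}"]) (auto intro: Ck_const)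

text \<open>The functions \<open>1 - (1 - \<phi>)\<^sup>m\<close>, with \<open>\<phi>\<close> a bump on the box, increase to the indicator of
  the box; only sums and products of smooth functions are involved.\<close>

lemma test_functions_to_box:
  assumes "cbox a b \<subseteq> U"
  obtains \<phi> where "\<And>m::nat. \<phi> m \<in> test_functions U" "\<And>m x. 0 \<le> \<phi> m x" "\<And>m x. \<phi> m x \<le> 1"
    "\<And>m x. x \<notin> box a b \<Longrightarrow> \<phi> m x = 0" "\<And>x. (\<lambda>m. \<phi> m x) \<longlonglongrightarrow> indicator (box a b) x"
proof
  let ?f = "\<lambda>m x. 1 - (1 - box_bump a b x) ^ m"
  show "?f m \<in> test_functions U" for m
  proof (rule test_functionsI[where K = "cbox a b"])
    show "Ck k (?f m)" for k
      by (intro Ck_diff Ck_power Ck_const Ck_box_bump)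
    show "?f m x = 0" if "x \<notin> cbox a b" for x
      using box_bump_outside[of x a b] that box_subset_cbox[of a b]
      by (cases "x \<in> box a b") auto
  qed (use assms in auto)
  show "0 \<le> ?f m x" "?f m x \<le> 1" for m x
    using box_bump_le_1[of a b x] by (auto intro: power_le_one)
  show z: "?f m x = 0" if "x \<notin> box a b" for m x
    using box_bump_outside[OF that] by simp
  show "(\<lambda>m. ?f m x) \<longlonglongrightarrow> indicator (box a b) x" for x
  proof (cases "x \<in> box a b")
    case True
    have "norm (1 - box_bump a b x) < 1"
      using box_bump_pos[OF True] box_bump_le_1(2)[of a b x] by simp
    then have "(\<lambda>m. (1 - box_bump a b x) ^ m) \<longlonglongrightarrow> 0"
      by (rule LIMSEQ_power_zero)
    then have "(\<lambda>m. ?f m x) \<longlonglongrightarrow> 1 - 0" by (intro tendsto_diff tendsto_const)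
    then show ?thesis using True by simp
  qed (simp add: z)
qed

section \<open>The fundamental lemma of the calculus of variations\<close>

lemma integrable_subset_lebesgue_on:
  fixes f :: "'a::euclidean_space \<Rightarrow> 'b::euclidean_space"
  assumes "integrable (lebesgue_on T) f" "S \<subseteq> T" "S \<in> sets lebesgue" "T \<in> sets lebesgue"
  shows "integrable (lebesgue_on S) f"
proof -
  have "integrable lebesgue (\<lambda>x. indicator S x *\<^sub>R (if x \<in> T then f x else 0))"
    using assms by (intro integrable_mult_indicator) (auto simp: Lebesgue_Measure.integrable_restrict_UNIV)
  also have "(\<lambda>x. indicator S x *\<^sub>R (if x \<in> T then f x else 0)) = (\<lambda>x. if x \<in> S then f x else 0)"
    by (rule ext) (use assms(2) in \<open>auto simp: indicator_def\<close>)
  finally show ?thesis using assms(3) by (simp add: Lebesgue_Measure.integrable_restrict_UNIV)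
qed

text \<open>Boxes are stable under intersection and generate the Borel sets, so the vanishing of the
  integral passes from boxes to all Borel sets; the total integral accounts for complements.\<close>

lemma integral_box_zero_imp_AE_zero:
  fixes h :: "'a::euclidean_space \<Rightarrow> real"
  assumes h: "integrable lebesgue h"
    and box: "\<And>c d. (LINT x|lebesgue. indicator (box c d) x * h x) = 0"
    and total: "(LINT x|lebesgue. h x) = 0"
  shows "AE x in lebesgue. h x = 0"
proof -
  obtain h' where h'm: "h' \<in> borel_measurable lborel" and eq: "AE x in lborel. h x = h' x"
    using completion_ex_borel_measurable_real[OF borel_measurable_integrable[OF h]] by blast
  have eq': "AE x in lebesgue. h x = h' x"
    using eq by (rule AE_completion)
  have h'mc: "h' \<in> borel_measurable lebesgue"
    using h'm by (rule measurable_completion)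
  have "integrable lebesgue h'"
    using integrable_cong_AE[of h lebesgue h'] h eq' h'mc by auto
  then have h'i: "integrable lborel h'"
    using integrable_completion[of h' lborel] h'm by simp
  have conv: "(LINT x|lborel. indicator A x * h' x) = (LINT x|lebesgue. indicator A x * h x)"
    if "A \<in> sets borel" for A
  proof -
    have "(LINT x|lborel. indicator A x * h' x) = (LINT x|lebesgue. indicator A x * h' x)"
      using that h'm
      by (intro integral_completion[symmetric] borel_measurable_times borel_measurable_indicator) auto
    also have "\<dots> = (LINT x|lebesgue. indicator A x * h x)"
      using that h'mc h eq'
      by (intro integral_cong_AE) (auto intro!: borel_measurable_times borel_measurable_indicator)
    finally show ?thesis .
  qed
  have int: "integrable lborel (\<lambda>x. indicator A x * h' x)" if "A \<in> sets borel" for A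
    using integrable_mult_indicator[OF _ h'i, of A] that by simp
  have zero: "(LINT x|lborel. indicator A x * h' x) = 0" if A: "A \<in> sets borel" for A
  proof -
    have "Int_stable (range (\<lambda>(a, b). box a b :: 'a set))"
      by (auto simp: Int_stable_def box_Int_box)
    moreover have "range (\<lambda>(a, b). box a b :: 'a set) \<subseteq> Pow UNIV" by auto
    moreover have "A \<in> sigma_sets UNIV (range (\<lambda>(a, b). box a b))"
      using A unfolding borel_eq_box by simp
    ultimately show ?thesis
    proof (induction rule: sigma_sets_induct_disjoint)
      case (basic A) then show ?case using box conv by auto
    next
      case empty then show ?case by simp
    next
      case (compl A)
      then have [measurable]: "A \<in> sets borel" by (simp add: borel_eq_box)
      have "(LINT x|lborel. indicator (UNIV - A) x * h' x) =
          (LINT x|lborel. indicator UNIV x * h' x - indicator A x * h' x)"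
        by (intro Bochner_Integration.integral_cong) (auto simp: indicator_def)
      also have "\<dots> = (LINT x|lborel. indicator UNIV x * h' x) - (LINT x|lborel. indicator A x * h' x)"
        by (intro Bochner_Integration.integral_diff int) auto
      also have "\<dots> = 0" using compl.IH conv[of UNIV] total by simp
      finally show ?case .
    next
      case (union F)
      then have [measurable]: "\<And>i. F i \<in> sets borel"
        by (simp add: borel_eq_box subset_eq)
      have "set_lebesgue_integral lborel (\<Union>i. F i) h' = (\<Sum>i. set_lebesgue_integral lborel (F i) h')"
        using union(1) int[of "\<Union>i. F i"]
        by (intro lebesgue_integral_countable_add)
           (auto simp: disjoint_family_on_def set_integrable_def)
      then show ?case using union.IH by (simp add: set_lebesgue_integral_def)
    qed
  qed
  have h'0: "AE x in lborel. h' x = 0"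
    by (rule sigma_finite_measure.density_zero[OF lborel.sigma_finite_measure_axioms h'i]) (simp add: set_lebesgue_integral_def zero)
  show ?thesis using eq' AE_completion[OF h'0] by eventually_elim simp
qed

lemma test_function_times_integrable:
  fixes g :: "'a::euclidean_space \<Rightarrow> real"
  assumes U: "open U" and g: "loc_integrable U g" and \<phi>: "\<phi> \<in> test_functions U"
  shows "integrable (lebesgue_on U) (\<lambda>x. g x * \<phi> x)"
proof -
  obtain K where K: "compact K" "K \<subseteq> U" "\<And>x. x \<notin> K \<Longrightarrow> \<phi> x = 0"
    using \<phi> test_functionsE by metis
  obtain C where C: "\<And>x. \<bar>\<phi> x\<bar> \<le> C" using test_function_bounded[OF \<phi>] by blast
  have "integrable (lebesgue_on K) (\<lambda>x. \<phi> x * g x)"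
    using g K C unfolding loc_integrable_def
    by (intro Bochner_Integration.integrable_bound[where f = "\<lambda>x. C * g x" and g = "\<lambda>x. \<phi> x * g x"])
       (auto intro!: test_function_measurable[OF \<phi>] borel_measurable_times mult_right_mono
         simp: abs_mult intro: order_trans[OF C abs_ge_self])
  then have "integrable lebesgue (\<lambda>x. if x \<in> K then \<phi> x * g x else 0)"
    using K by (simp add: Lebesgue_Measure.integrable_restrict_UNIV lmeasurable_compact fmeasurableD)
  also have "(\<lambda>x. if x \<in> K then \<phi> x * g x else 0) = (\<lambda>x. if x \<in> U then g x * \<phi> x else 0)"
    by (rule ext) (use K in \<open>auto simp: mult.commute\<close>)
  finally show ?thesis using U by (simp add: Lebesgue_Measure.integrable_restrict_UNIV)
qed

text \<open>On a box whose closure lies in \<open>U\<close> the function is integrable, and the indicator of each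
  subbox is a bounded pointwise limit of test functions. Countably many such boxes cover \<open>U\<close>.\<close>

lemma fundamental_lemma_variations:
  fixes g :: "'a::euclidean_space \<Rightarrow> real"
  assumes U: "open U" and g: "loc_integrable U g"
    and zero: "\<And>\<phi>. \<phi> \<in> test_functions U \<Longrightarrow> (LINT x|lebesgue_on U. g x * \<phi> x) = 0"
  shows "AE x in lebesgue_on U. g x = 0"
proof -
  have UL: "U \<in> sets lebesgue" using U by auto
  have box: "AE x in lebesgue. x \<in> box a b \<longrightarrow> g x = 0" if ab: "cbox a b \<subseteq> U" for a b
  proof -
    let ?h = "\<lambda>x. if x \<in> cbox a b then g x else 0"
    have hi: "integrable lebesgue ?h"
      using g ab by (simp add: loc_integrable_def Lebesgue_Measure.integrable_restrict_UNIV)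
    have sub: "(LINT x|lebesgue. indicator (box c d) x * ?h x) = 0" if cd: "cbox c d \<subseteq> U" "box c d \<subseteq> cbox a b" for c d
    proof -
      obtain \<phi> where \<phi>: "\<And>m::nat. \<phi> m \<in> test_functions U" "\<And>m x. 0 \<le> \<phi> m x" "\<And>m x. \<phi> m x \<le> 1"
        "\<And>m x. x \<notin> box c d \<Longrightarrow> \<phi> m x = 0" "\<And>x. (\<lambda>m. \<phi> m x) \<longlonglongrightarrow> indicator (box c d) x"
        using test_functions_to_box[OF cd(1)] by metis
      have m: "\<phi> m \<in> borel_measurable lebesgue" for m
        using test_function_measurable[OF \<phi>(1), of m UNIV] by (simp add: lebesgue_on_UNIV_eq)
      have "(\<lambda>m. LINT x|lebesgue. \<phi> m x * ?h x) \<longlonglongrightarrow> (LINT x|lebesgue. indicator (box c d) x * ?h x)"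
      proof (rule integral_dominated_convergence[where w = "\<lambda>x. \<bar>?h x\<bar>"])
        show "integrable lebesgue (\<lambda>x. \<bar>?h x\<bar>)" using hi by (rule integrable_abs)
        show "AE x in lebesgue. norm (\<phi> m x * ?h x) \<le> \<bar>?h x\<bar>" for m
          by (rule AE_I2) (auto simp: abs_mult \<phi>(2,3) intro: mult_left_le_one_le)
      qed (use hi m in \<open>auto intro!: borel_measurable_times borel_measurable_indicator
              tendsto_intros \<phi>(5)\<close>)
      moreover have "(LINT x|lebesgue. \<phi> m x * ?h x) = 0" for m
      proof -
        have "(LINT x|lebesgue. \<phi> m x * ?h x) = (LINT x|lebesgue. (if x \<in> U then g x * \<phi> m x else 0))"
          using \<phi>(4)[of _ m] cd ab by (intro Bochner_Integration.integral_cong) auto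
        then show ?thesis using zero[OF \<phi>(1)] UL Lebesgue_Measure.integral_restrict_UNIV[OF UL, of "\<lambda>x. g x * \<phi> m x"]
          by simp
      qed
      ultimately show ?thesis by (simp add: LIMSEQ_const_iff)
    qed
    let ?k = "\<lambda>x. indicator (box a b) x * ?h x"
    have "AE x in lebesgue. ?k x = 0"
    proof (rule integral_box_zero_imp_AE_zero)
      show "integrable lebesgue ?k"
        using integrable_mult_indicator[OF _ hi, of "box a b"] by simp
      show "(LINT x|lebesgue. ?k x) = 0"
        using sub[OF ab box_subset_cbox] .
      fix c d :: 'a
      obtain e f where ef: "box a b \<inter> box c d = box e f" using box_Int_box by blast
      show "(LINT x|lebesgue. indicator (box c d) x * ?k x) = 0"
      proof (cases "box e f = {}")
        case True
        show ?thesis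
          by (rule integral_eq_zero_AE, rule AE_I2) (use ef True in \<open>auto simp: indicator_def\<close>)
      next
        case False
        have "box e f \<subseteq> cbox a b" using ef box_subset_cbox by blast
        moreover from this have "cbox e f \<subseteq> U"
          using False ab by (metis closure_box closure_minimal closed_cbox order_trans)
        moreover have "(\<lambda>x. indicator (box c d) x * ?k x) = (\<lambda>x. indicator (box e f) x * ?h x)"
          unfolding ef[symmetric] by (rule ext) (auto simp: indicator_def)
        ultimately show ?thesis using sub by presburger
      qed
    qed
    then show ?thesis
      by eventually_elim (use box_subset_cbox[of a b] in \<open>auto simp: indicator_def\<close>)
  qed
  let ?F = "{box a b | a b. cbox a b \<subseteq> U}"
  obtain F' where F': "F' \<subseteq> ?F" "countable F'" "\<Union>F' = \<Union>?F"
    using Lindelof[of ?F] by auto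
  have cov: "U \<subseteq> \<Union>F'"
  proof
    fix x assume "x \<in> U"
    obtain a b where "cbox a b \<subseteq> U" "x \<in> box a b" "\<forall>i\<in>Basis. a \<bullet> i < b \<bullet> i"
      by (rule open_contains_cbox[OF U \<open>x \<in> U\<close>])
    then show "x \<in> \<Union>F'" unfolding F'(3) by blast
  qed
  have "AE x in lebesgue. \<forall>B\<in>F'. x \<in> B \<longrightarrow> g x = 0"
    unfolding AE_ball_countable[OF F'(2)] using box F'(1) by blast
  then have "AE x in lebesgue. x \<in> U \<longrightarrow> g x = 0"
    by eventually_elim (use cov in auto)
  then show ?thesis using UL by (simp add: AE_restrict_space_iff)
qed

text \<open>Differentiate the integral of a translate, which does not depend on the translation.\<close>

lemma integral_derivative_eq_0:
  fixes \<phi> :: "'a::euclidean_space \<Rightarrow> real"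
  assumes \<phi>: "\<phi> \<in> test_functions UNIV" and b: "b \<in> Basis"
  shows "(LINT x|lborel. frechet_derivative \<phi> (at x) b) = 0"
proof -
  let ?D = "\<lambda>x. frechet_derivative \<phi> (at x) b"
  have D: "?D \<in> test_functions UNIV" by (rule test_functions_derivative[OF \<phi> b])
  obtain C where C: "\<And>x. \<bar>?D x\<bar> \<le> C" using test_function_bounded[OF D] by blast
  obtain K where K: "compact K" "\<And>x. x \<notin> K \<Longrightarrow> \<phi> x = 0" using test_functionsE[OF \<phi>] by metis
  obtain R where R: "\<And>x. x \<in> K \<Longrightarrow> norm x \<le> R" using compact_imp_bounded[OF K(1)] by (auto simp: bounded_iff)
  have [measurable]: "\<phi> \<in> borel_measurable borel"
    by (rule borel_measurable_continuous_onI[OF test_function_continuous[OF \<phi>]])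
  have [measurable]: "?D \<in> borel_measurable borel"
    by (rule borel_measurable_continuous_onI[OF test_function_continuous[OF D]])
  obtain M where M: "\<And>x. \<bar>\<phi> x\<bar> \<le> M" using test_function_bounded[OF \<phi>] by blast
  have \<phi>i: "integrable lborel \<phi>"
  proof (rule Bochner_Integration.integrable_bound)
    show "integrable lborel (\<lambda>x::'a. M * indicator (cball 0 R) x)"
      by (intro integrable_mult_right integrable_real_indicator emeasure_bounded_finite) auto
    show "AE x in lborel. norm (\<phi> x) \<le> norm (M * indicator (cball 0 R) x)"
      using M K(2) R by (auto simp: indicator_def intro: order_trans[OF M abs_ge_self])
  qed measurable
  let ?q = "\<lambda>(n::nat) x. (\<phi> (x + (1 / Suc n) *\<^sub>R b) - \<phi> x) / (1 / Suc n)"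
  have q0: "(LINT x|lborel. ?q n x) = 0" for n
  proof -
    let ?v = "(1 / Suc n) *\<^sub>R b"
    have tr: "lborel = distr lborel borel (\<lambda>x. ?v + x)" using lborel_distr_plus[of ?v] by simp
    have i: "integrable lborel (\<lambda>x. \<phi> (x + ?v))"
      using \<phi>i by (subst (asm) tr, subst (asm) integrable_distr_eq) (auto simp: add.commute)
    have "(LINT x|lborel. \<phi> x) = (LINT x|lborel. \<phi> (x + ?v))"
      by (subst tr, subst integral_distr) (auto simp: add.commute)
    then show ?thesis using i \<phi>i by simp
  qed
  have "(\<lambda>n. LINT x|lborel. ?q n x) \<longlonglongrightarrow> (LINT x|lborel. ?D x)"
  proof (rule integral_dominated_convergence[where w = "\<lambda>x. C * indicator (cball 0 (R + 1)) x"])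
    show "integrable lborel (\<lambda>x::'a. C * indicator (cball 0 (R + 1)) x)"
      by (intro integrable_mult_right integrable_real_indicator emeasure_bounded_finite) auto
    have d: "((\<lambda>s. \<phi> (x + s *\<^sub>R b)) has_real_derivative ?D (x + s *\<^sub>R b)) (at s)" for x s
    proof -
      let ?F = "frechet_derivative \<phi> (at (x + s *\<^sub>R b))"
      have F: "(\<phi> has_derivative ?F) (at (x + s *\<^sub>R b))"
        by (rule test_function_has_derivative[OF \<phi>])
      have "((\<lambda>s. \<phi> (x + s *\<^sub>R b)) has_derivative (\<lambda>h. ?F (h *\<^sub>R b))) (at s)"
        by (rule has_derivative_compose[of "\<lambda>s. x + s *\<^sub>R b", OF _ F]) (auto intro!: derivative_eq_intros)
      then show ?thesis
        using linear_cmul[OF has_derivative_linear[OF F]]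
        by (simp add: has_field_derivative_def mult_commute_abs)
    qed
    show "AE x in lborel. (\<lambda>n. ?q n x) \<longlonglongrightarrow> ?D x"
    proof (rule AE_I2)
      fix x
      have "(\<lambda>h. (\<phi> (x + h *\<^sub>R b) - \<phi> x) / h) \<midarrow>0\<rightarrow> ?D x"
        using d[of x 0] by (simp add: DERIV_def)
      moreover have "filterlim (\<lambda>n. 1 / real (Suc n)) (at 0) sequentially"
        using LIMSEQ_inverse_real_of_nat by (auto simp: filterlim_at inverse_eq_divide)
      ultimately show "(\<lambda>n. ?q n x) \<longlonglongrightarrow> ?D x" by (rule filterlim_compose)
    qed
    show "AE x in lborel. norm (?q n x) \<le> C * indicator (cball 0 (R + 1)) x" for n
    proof (rule AE_I2)
      fix x
      let ?h = "1 / real (Suc n)"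
      have h: "0 < ?h" "?h \<le> 1" by auto
      show "norm (?q n x) \<le> C * indicator (cball 0 (R + 1)) x"
      proof (cases "norm x \<le> R + 1")
        case True
        obtain z where "\<phi> (x + ?h *\<^sub>R b) - \<phi> (x + 0 *\<^sub>R b) = (?h - 0) * ?D (x + z *\<^sub>R b)"
          using MVT2[OF h(1) d[of x]] by metis
        then show ?thesis using C True h by (simp add: abs_mult)
      next
        case False
        have "norm (?h *\<^sub>R b) \<le> 1" using b h by (simp add: norm_Basis)
        then have "\<not> norm (x + ?h *\<^sub>R b) \<le> R"
          using False norm_triangle_ineq4[of "x + ?h *\<^sub>R b" "?h *\<^sub>R b"]
          by (simp only: add_diff_cancel_right')
        then have "x \<notin> K" "x + ?h *\<^sub>R b \<notin> K"
          using False R[of x] R[of "x + ?h *\<^sub>R b"] by fastforce+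
        then show ?thesis using K(2) False by simp
      qed
    qed
  qed measurable
  then show ?thesis unfolding q0 by (simp add: LIMSEQ_const_iff)
qed

section \<open>Quadratic forms along a measurable path\<close>

lemma discriminant_nonpos:
  fixes A L C :: real
  assumes "\<And>e. 0 \<le> A + 2 * e * L + e\<^sup>2 * C" "0 \<le> C"
  shows "L\<^sup>2 \<le> A * C"
proof (cases "C = 0")
  case True
  have "L = 0"
  proof (rule ccontr)
    assume "L \<noteq> 0"
    then show False using assms(1)[of "- (A + 1) / (2 * L)"] True by (simp add: field_simps)
  qed
  then show ?thesis using True by simp
next
  case False
  then have "C > 0" using assms(2) by simp
  then show ?thesis using assms(1)[of "- L / C"] by (simp add: field_simps power2_eq_square)
qed

lemma integrable_pair_mult:
  fixes f g :: "_ \<Rightarrow> real"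
  assumes "finite_measure M" and f: "integrable M f" and g: "integrable M g"
  shows "integrable (M \<Otimes>\<^sub>M M) (\<lambda>p. f (fst p) * g (snd p))"
proof -
  interpret finite_measure M by fact
  interpret P: pair_sigma_finite M M ..
  have [measurable]: "f \<in> borel_measurable M" "g \<in> borel_measurable M" using f g by auto
  show ?thesis
  proof (rule P.Fubini_integrable)
    have "(\<lambda>x. \<integral>y. norm (f (fst (x, y)) * g (snd (x, y))) \<partial>M) = (\<lambda>x. \<bar>f x\<bar> * (\<integral>y. \<bar>g y\<bar> \<partial>M))"
      by (simp add: abs_mult)
    then show "integrable M (\<lambda>x. \<integral>y. norm (f (fst (x, y)) * g (snd (x, y))) \<partial>M)"
      using f by simp
  qed (use g in auto)
qed

lemma simple_function_integral:
  assumes "finite_measure M" "simple_function M s"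
  shows "integrable M (\<lambda>t. (f (s t) :: real))"
    and "(LINT t|M. f (s t)) = (\<Sum>y\<in>s ` space M. measure M (s -` {y} \<inter> space M) * f y)"
proof -
  interpret finite_measure M by fact
  have fin: "finite (s ` space M)" using assms(2) by (simp add: simple_function_def)
  have sets: "s -` {y} \<inter> space M \<in> sets M" for y
    using simple_functionD(2)[OF assms(2)] .
  have i: "integrable M (\<lambda>t. indicator (s -` {y} \<inter> space M) t * f y)" for y
    using sets[of y] by (intro integrable_mult_left integrable_real_indicator) (auto simp: emeasure_eq_measure)
  have e: "f (s t) = (\<Sum>y\<in>s ` space M. indicator (s -` {y} \<inter> space M) t * f y)" if "t \<in> space M" for t
  proof -
    have "(\<Sum>y\<in>s ` space M. indicator (s -` {y} \<inter> space M) t * f y) = (\<Sum>y\<in>{s t}. f y)"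
      using that fin by (intro sum.mono_neutral_cong_right) (auto simp: indicator_def)
    then show ?thesis by simp
  qed
  have "integrable M (\<lambda>t. f (s t)) \<longleftrightarrow> integrable M (\<lambda>t. \<Sum>y\<in>s ` space M. indicator (s -` {y} \<inter> space M) t * f y)"
    using e by (intro Bochner_Integration.integrable_cong) auto
  then show "integrable M (\<lambda>t. f (s t))" using i by simp
  have "(LINT t|M. f (s t)) = (LINT t|M. (\<Sum>y\<in>s ` space M. indicator (s -` {y} \<inter> space M) t * f y))"
    using e by (intro Bochner_Integration.integral_cong) auto
  also have "\<dots> = (\<Sum>y\<in>s ` space M. measure M (s -` {y} \<inter> space M) * f y)"
    using i sets by (subst Bochner_Integration.integral_sum) (auto simp: Int_absorb1 sets.sets_into_space)
  finally show "(LINT t|M. f (s t)) = (\<Sum>y\<in>s ` space M. measure M (s -` {y} \<inter> space M) * f y)" .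
qed

text \<open>A path \<open>z\<close> in an infinite-dimensional space \<open>V\<close> carrying a positive semidefinite kernel \<open>a\<close>,
  approximated by simple functions. Only the scalar functions \<open>a (z t) \<phi>\<close> and \<open>a (z t) (z r)\<close>
  are ever integrated, which stands in for the square of the vector-valued integral of \<open>z\<close>.\<close>

locale semidefinite_path = finite_measure M
  for M :: "'t measure" +
  fixes V :: "'v set" and a :: "'v \<Rightarrow> 'v \<Rightarrow> real" and n :: "'v \<Rightarrow> real" and K :: real
    and null :: 'v and z :: "'t \<Rightarrow> 'v" and s :: "nat \<Rightarrow> 't \<Rightarrow> 'v"
  assumes psd: "\<And>F c. finite F \<Longrightarrow> F \<subseteq> V \<Longrightarrow> 0 \<le> (\<Sum>v\<in>F. \<Sum>w\<in>F. c v * c w * a v w)"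
    and sym: "\<And>v w. v \<in> V \<Longrightarrow> w \<in> V \<Longrightarrow> a v w = a w v"
    and n_nonneg: "\<And>v. 0 \<le> n v"
    and K_nonneg: "0 \<le> K"
    and a_le: "\<And>v w. v \<in> V \<Longrightarrow> w \<in> V \<Longrightarrow> \<bar>a v w\<bar> \<le> K * n v * n w"
    and null: "null \<in> V" "n null = 0"
    and z_V: "\<And>t. t \<in> space M \<Longrightarrow> z t \<in> V"
    and s_V: "\<And>k t. t \<in> space M \<Longrightarrow> s k t \<in> V"
    and s_simple: "\<And>k. simple_function M (s k)"
    and s_a: "\<And>t \<phi>. t \<in> space M \<Longrightarrow> \<phi> \<in> V \<Longrightarrow> (\<lambda>k. a (s k t) \<phi>) \<longlonglongrightarrow> a (z t) \<phi>"
    and s_aa: "\<And>t r. t \<in> space M \<Longrightarrow> r \<in> space M \<Longrightarrow>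
       (\<lambda>k. a (s k t) (s k r)) \<longlonglongrightarrow> a (z t) (z r)"
    and s_n: "\<And>t. t \<in> space M \<Longrightarrow> (\<lambda>k. n (s k t)) \<longlonglongrightarrow> n (z t)"
    and n_int: "integrable M (\<lambda>t. (n (z t))\<^sup>2)"
begin

sublocale P: pair_sigma_finite M M ..

lemma n_measurable[measurable]: "(\<lambda>t. n (z t)) \<in> borel_measurable M"
  by (rule borel_measurable_LIMSEQ_real[OF s_n])
     (auto intro!: borel_measurable_simple_function simple_function_compose1[OF s_simple])

lemma n_integrable: "integrable M (\<lambda>t. n (z t))"
proof (rule Bochner_Integration.integrable_bound[where f = "\<lambda>t. 1 + (n (z t))\<^sup>2"])
  show "AE t in M. norm (n (z t)) \<le> norm (1 + (n (z t))\<^sup>2)"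
  proof (rule AE_I2)
    fix t
    have "n (z t) \<le> 1 + (n (z t))\<^sup>2"
      using zero_le_power2[of "n (z t) - 1"] n_nonneg[of "z t"] by (simp add: power2_eq_square algebra_simps)
    then show "norm (n (z t)) \<le> norm (1 + (n (z t))\<^sup>2)" using n_nonneg[of "z t"] by simp
  qed
qed (use n_int in auto)

lemma a_measurable: "\<phi> \<in> V \<Longrightarrow> (\<lambda>t. a (z t) \<phi>) \<in> borel_measurable M"
  by (rule borel_measurable_LIMSEQ_real[OF s_a])
     (auto intro!: borel_measurable_simple_function simple_function_compose1[OF s_simple])

lemma a_integrable:
  assumes "\<phi> \<in> V"
  shows "integrable M (\<lambda>t. a (z t) \<phi>)"
proof (rule Bochner_Integration.integrable_bound[where f = "\<lambda>t. K * n (z t) * n \<phi>"])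
  show "AE t in M. norm (a (z t) \<phi>) \<le> norm (K * n (z t) * n \<phi>)"
    using assms a_le[OF z_V] by (auto intro: order_trans[OF _ abs_ge_self])
qed (use n_integrable assms a_measurable in auto)

lemma simple_pair:
  assumes "simple_function M f"
  shows "(\<lambda>p. a (f (fst p)) (f (snd p))) \<in> borel_measurable (M \<Otimes>\<^sub>M M)"
  by (intro borel_measurable_simple_function
      simple_function_compose2[of _ "\<lambda>p. f (fst p)" "\<lambda>p. f (snd p)" a]
      simple_function_comp[OF measurable_fst assms] simple_function_comp[OF measurable_snd assms])

lemma aa_integrable: "integrable (M \<Otimes>\<^sub>M M) (\<lambda>p. a (z (fst p)) (z (snd p)))"
proof (rule Bochner_Integration.integrable_bound[where f = "\<lambda>p. K * (n (z (fst p)) * n (z (snd p)))"])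
  show "integrable (M \<Otimes>\<^sub>M M) (\<lambda>p. K * (n (z (fst p)) * n (z (snd p))))"
    by (intro integrable_mult_right integrable_pair_mult n_integrable finite_measure_axioms)
  show "(\<lambda>p. a (z (fst p)) (z (snd p))) \<in> borel_measurable (M \<Otimes>\<^sub>M M)"
    by (rule borel_measurable_LIMSEQ_real[where u = "\<lambda>k p. a (s k (fst p)) (s k (snd p))"])
       (auto simp: space_pair_measure intro: s_aa simple_pair[OF s_simple])
  show "AE p in M \<Otimes>\<^sub>M M. norm (a (z (fst p)) (z (snd p))) \<le> norm (K * (n (z (fst p)) * n (z (snd p))))"
  proof (rule AE_I2)
    fix p assume "p \<in> space (M \<Otimes>\<^sub>M M)"
    then have "\<bar>a (z (fst p)) (z (snd p))\<bar> \<le> K * (n (z (fst p)) * n (z (snd p)))"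
      using a_le[OF z_V z_V, of "fst p" "snd p"] by (auto simp: space_pair_measure mult.assoc)
    then show "norm (a (z (fst p)) (z (snd p))) \<le> norm (K * (n (z (fst p)) * n (z (snd p))))"
      by simp
  qed
qed

text \<open>The expansion of \<open>a Z Z\<close> for the vector-valued integral \<open>Z\<close> of \<open>z\<close>.\<close>

definition energy :: real where
  "energy = (LINT t|M. LINT r|M. a (z t) (z r))"

lemma energy_eq: "energy = (LINT p|(M \<Otimes>\<^sub>M M). a (z (fst p)) (z (snd p)))"
  unfolding energy_def using P.integral_fst'[OF aa_integrable] by simp

text \<open>For a simple path the integrals are finite sums over its values, weighted by the measures of the
  level sets, and \<open>e \<phi>\<close> adds \<open>e\<close> to the weight of \<open>\<phi>\<close>: an instance of positive semidefiniteness.\<close>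

lemma simple_energy_nonneg:
  assumes f: "simple_function M f" "\<And>t. t \<in> space M \<Longrightarrow> f t \<in> V" and \<phi>: "\<phi> \<in> V"
  shows "0 \<le> (LINT t|M. LINT r|M. a (f t) (f r)) + 2 * e * (LINT t|M. a (f t) \<phi>) + e\<^sup>2 * a \<phi> \<phi>"
proof -
  define Y where "Y = insert \<phi> (f ` space M)"
  define m where "m y = measure M (f -` {y} \<inter> space M)" for y
  have Y: "finite Y" "Y \<subseteq> V"
    using f \<phi> by (auto simp: Y_def simple_function_def)
  have I: "(LINT t|M. g (f t)) = (\<Sum>y\<in>Y. m y * g y)" for g
  proof -
    have "(\<Sum>y\<in>f ` space M. m y * g y) = (\<Sum>y\<in>Y. m y * g y)"
    proof (rule sum.mono_neutral_left)
      show "\<forall>y\<in>Y - f ` space M. m y * g y = 0"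
      proof
        fix y assume "y \<in> Y - f ` space M"
        then have "f -` {y} \<inter> space M = {}" by auto
        then show "m y * g y = 0" by (simp add: m_def)
      qed
    qed (use Y in \<open>auto simp: Y_def\<close>)
    then show ?thesis
      using simple_function_integral(2)[OF finite_measure_axioms f(1), of g] by (simp add: m_def)
  qed
  define c where "c y = m y + (if y = \<phi> then e else 0)" for y
  have pick: "(\<Sum>w\<in>Y. c w * g w) = (\<Sum>w\<in>Y. m w * g w) + e * g \<phi>" for g
  proof -
    have "(\<Sum>w\<in>Y. c w * g w) = (\<Sum>w\<in>Y. m w * g w + (if w = \<phi> then e * g w else 0))"
      by (intro sum.cong) (auto simp: c_def algebra_simps)
    then show ?thesis using Y by (simp add: sum.distrib sum.delta Y_def)
  qed
  have "0 \<le> (\<Sum>v\<in>Y. \<Sum>w\<in>Y. c v * c w * a v w)" by (rule psd[OF Y])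
  also have "\<dots> = (\<Sum>v\<in>Y. c v * (\<Sum>w\<in>Y. c w * a v w))"
    by (simp add: sum_distrib_left mult.assoc)
  also have "\<dots> = (\<Sum>v\<in>Y. m v * ((\<Sum>w\<in>Y. m w * a v w) + e * a v \<phi>))
      + e * ((\<Sum>w\<in>Y. m w * a \<phi> w) + e * a \<phi> \<phi>)"
    by (simp only: pick)
  also have "(\<Sum>w\<in>Y. m w * a \<phi> w) = (\<Sum>w\<in>Y. m w * a w \<phi>)"
    using sym[OF \<phi>] Y by (intro sum.cong) auto
  also have "(\<Sum>v\<in>Y. m v * ((\<Sum>w\<in>Y. m w * a v w) + e * a v \<phi>)) =
     (\<Sum>v\<in>Y. m v * (\<Sum>w\<in>Y. m w * a v w)) + e * (\<Sum>v\<in>Y. m v * a v \<phi>)"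
    by (simp add: algebra_simps sum.distrib sum_distrib_left)
  also have "(\<Sum>v\<in>Y. m v * (\<Sum>w\<in>Y. m w * a v w)) = (LINT t|M. LINT r|M. a (f t) (f r))"
    using I[of "\<lambda>v. LINT r|M. a v (f r)"] by (simp add: I)
  also have "(\<Sum>v\<in>Y. m v * a v \<phi>) = (LINT t|M. a (f t) \<phi>)"
    using I[of "\<lambda>v. a v \<phi>"] by simp
  finally show ?thesis by (simp add: algebra_simps power2_eq_square)
qed

lemma energy_quadratic_nonneg:
  assumes \<phi>: "\<phi> \<in> V"
  shows "0 \<le> energy + 2 * e * (LINT t|M. a (z t) \<phi>) + e\<^sup>2 * a \<phi> \<phi>"
proof -
  \<comment> \<open>truncation gives the approximation an integrable majorant\<close>
  define f where "f k t = (if n (s k t) \<le> n (z t) + 1 then s k t else null)" for k t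
  have [measurable]: "(\<lambda>t. n (s k t)) \<in> borel_measurable M" for k
    by (intro borel_measurable_simple_function simple_function_compose1[OF s_simple])
  have f_simple: "simple_function M (f k)" for k
    unfolding f_def by (intro simple_function_If s_simple simple_function_const) measurable
  have f_V: "f k t \<in> V" if "t \<in> space M" for k t
    using s_V[OF that] null by (simp add: f_def)
  define D where "D t = n (z t) + 1" for t
  have f_n: "n (f k t) \<le> D t" for k t
    using null n_nonneg[of "z t"] by (simp add: f_def D_def)
  have D: "0 \<le> D t" for t using n_nonneg[of "z t"] by (simp add: D_def)
  have D_int: "integrable M D" unfolding D_def using n_integrable by simp
  have ev: "\<forall>\<^sub>F k in sequentially. f k t = s k t" if "t \<in> space M" for t
    using order_tendstoD(2)[OF s_n[OF that], of "n (z t) + 1"]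
    by (auto simp: f_def elim!: eventually_mono)
  have f_a: "(\<lambda>k. a (f k t) \<phi>) \<longlonglongrightarrow> a (z t) \<phi>" if t: "t \<in> space M" for t
    using s_a[OF t \<phi>] by (rule Lim_transform_eventually) (use ev[OF t] in eventually_elim, simp)
  have f_aa: "(\<lambda>k. a (f k t) (f k r)) \<longlonglongrightarrow> a (z t) (z r)" if t: "t \<in> space M" and r: "r \<in> space M" for t r
    using s_aa[OF t r] by (rule Lim_transform_eventually) (use ev[OF t] ev[OF r] in eventually_elim, simp)
  have "(\<lambda>k. LINT t|M. a (f k t) \<phi>) \<longlonglongrightarrow> (LINT t|M. a (z t) \<phi>)"
  proof (rule integral_dominated_convergence[where w = "\<lambda>t. K * D t * n \<phi>"])
    show "AE t in M. norm (a (f k t) \<phi>) \<le> K * D t * n \<phi>" for k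
    proof (rule AE_I2)
      fix t assume "t \<in> space M"
      then have "\<bar>a (f k t) \<phi>\<bar> \<le> K * n (f k t) * n \<phi>" by (intro a_le f_V \<phi>)
      also have "\<dots> \<le> K * D t * n \<phi>"
        by (intro mult_mono f_n mult_nonneg_nonneg K_nonneg n_nonneg D) auto
      finally show "norm (a (f k t) \<phi>) \<le> K * D t * n \<phi>" by simp
    qed
    show "(\<lambda>t. a (f k t) \<phi>) \<in> borel_measurable M" for k
      by (intro borel_measurable_simple_function simple_function_compose1[OF f_simple])
  qed (use D_int f_a a_measurable[OF \<phi>] in auto)
  moreover have "(\<lambda>k. LINT p|(M \<Otimes>\<^sub>M M). a (f k (fst p)) (f k (snd p))) \<longlonglongrightarrow> energy"
    unfolding energy_eq
  proof (rule integral_dominated_convergence[where w = "\<lambda>p. K * (D (fst p) * D (snd p))"])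
    show "AE p in M \<Otimes>\<^sub>M M. norm (a (f k (fst p)) (f k (snd p))) \<le> K * (D (fst p) * D (snd p))" for k
    proof (rule AE_I2)
      fix p assume "p \<in> space (M \<Otimes>\<^sub>M M)"
      then have "\<bar>a (f k (fst p)) (f k (snd p))\<bar> \<le> K * n (f k (fst p)) * n (f k (snd p))"
        by (intro a_le f_V) (auto simp: space_pair_measure)
      also have "\<dots> \<le> K * D (fst p) * D (snd p)"
        by (intro mult_mono f_n mult_nonneg_nonneg K_nonneg n_nonneg D) auto
      finally show "norm (a (f k (fst p)) (f k (snd p))) \<le> K * (D (fst p) * D (snd p))"
        by (simp add: mult.assoc)
    qed
    show "integrable (M \<Otimes>\<^sub>M M) (\<lambda>p. K * (D (fst p) * D (snd p)))"
      by (intro integrable_mult_right integrable_pair_mult D_int finite_measure_axioms)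
    show "AE p in M \<Otimes>\<^sub>M M. (\<lambda>k. a (f k (fst p)) (f k (snd p))) \<longlonglongrightarrow> a (z (fst p)) (z (snd p))"
      by (rule AE_I2) (auto simp: space_pair_measure intro: f_aa)
  qed (use aa_integrable simple_pair[OF f_simple] in auto)
  moreover have "(LINT p|(M \<Otimes>\<^sub>M M). a (f k (fst p)) (f k (snd p))) = (LINT t|M. LINT r|M. a (f k t) (f k r))" for k
  proof -
    have "integrable (M \<Otimes>\<^sub>M M) (\<lambda>p. a (f k (fst p)) (f k (snd p)))"
    proof -
      have "finite_measure (M \<Otimes>\<^sub>M M)"
        by (rule finite_measure_pair_measure) (rule finite_measure_axioms)+
      moreover have "simple_function (M \<Otimes>\<^sub>M M) (\<lambda>p. (f k (fst p), f k (snd p)))"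
        by (intro simple_function_Pair simple_function_comp[OF measurable_fst f_simple]
            simple_function_comp[OF measurable_snd f_simple])
      ultimately show ?thesis
        using simple_function_integral(1)[where f = "\<lambda>(x, y). a x y"] by fastforce
    qed
    from P.integral_fst'[OF this] show ?thesis by simp
  qed
  ultimately have "(\<lambda>k. (LINT t|M. LINT r|M. a (f k t) (f k r)) + 2 * e * (LINT t|M. a (f k t) \<phi>) + e\<^sup>2 * a \<phi> \<phi>)
      \<longlonglongrightarrow> energy + 2 * e * (LINT t|M. a (z t) \<phi>) + e\<^sup>2 * a \<phi> \<phi>"
    by (intro tendsto_intros) auto
  then show ?thesis
    by (rule LIMSEQ_le_const) (use simple_energy_nonneg[OF f_simple f_V \<phi>] in auto)
qed

lemma energy_nonneg: "0 \<le> energy"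
  using energy_quadratic_nonneg[OF null(1), of 0] by simp

lemma energy_Cauchy_Schwarz:
  assumes "\<phi> \<in> V"
  shows "(LINT t|M. a (z t) \<phi>)\<^sup>2 \<le> energy * a \<phi> \<phi>"
proof (rule discriminant_nonpos)
  show "0 \<le> a \<phi> \<phi>" using psd[of "{\<phi>}" "\<lambda>_. 1"] assms by simp
qed (use energy_quadratic_nonneg[OF assms] in auto)

end

text \<open>The two triangles contribute equally by Fubini's theorem, and the diagonal is a null set. This
  plays the role of the chain rule for \<open>d/dt a(Z(t), Z(t))\<close> with \<open>Z(t) = \<integral>\<^sub>0\<^sup>t z\<close>.\<close>

lemma symmetric_kernel_half:
  fixes H :: "real \<Rightarrow> real \<Rightarrow> real" and \<tau> :: real
  defines "M \<equiv> lebesgue_on {0<..<\<tau>}"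
  assumes H: "integrable (M \<Otimes>\<^sub>M M) (\<lambda>p. H (fst p) (snd p))"
    and sym: "\<And>t r. t \<in> {0<..<\<tau>} \<Longrightarrow> r \<in> {0<..<\<tau>} \<Longrightarrow> H t r = H r t"
  shows "(LINT t|M. LINT r|M. H t r) = 2 * (LINT t|M. LINT r|M. (if r < t then H r t else 0))"
proof -
  interpret finite_measure M
    unfolding M_def by (rule finite_measure_lebesgue_on) auto
  interpret P: pair_sigma_finite M M ..
  have idm[measurable]: "(\<lambda>x. x) \<in> borel_measurable M"
    unfolding M_def using id_borel_measurable_lebesgue_on[of "{0<..<\<tau>}"] by (simp add: id_def)
  have [measurable]: "fst \<in> borel_measurable (M \<Otimes>\<^sub>M M)" "snd \<in> borel_measurable (M \<Otimes>\<^sub>M M)"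
    using measurable_compose[OF measurable_fst idm] measurable_compose[OF measurable_snd idm] by simp_all
  have Hm: "(\<lambda>p. H (fst p) (snd p)) \<in> borel_measurable (M \<Otimes>\<^sub>M M)" using H by simp
  have i1: "integrable (M \<Otimes>\<^sub>M M) (\<lambda>p. if snd p < fst p then H (fst p) (snd p) else 0)"
    by (rule Bochner_Integration.integrable_bound[OF H]) (use Hm in auto)
  have i2: "integrable (M \<Otimes>\<^sub>M M) (\<lambda>p. if fst p < snd p then H (fst p) (snd p) else 0)"
    by (rule Bochner_Integration.integrable_bound[OF H]) (use Hm in auto)
  have sp: "space M = {0<..<\<tau>}" by (simp add: M_def)
  have c1: "(LINT r|M. (if r < t then H r t else 0)) = (LINT r|M. (if r < t then H t r else 0))"
    if "t \<in> {0<..<\<tau>}" for t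
    using that by (intro Bochner_Integration.integral_cong) (auto simp: sp sym)
  have j1: "integrable M (\<lambda>t. LINT r|M. (if r < t then H t r else 0))"
    using P.integrable_fst'[OF i1] by (simp cong: if_cong)
  have j2: "integrable M (\<lambda>t. LINT r|M. (if t < r then H t r else 0))"
    using P.integrable_fst'[OF i2] by (simp cong: if_cong)
  have sw: "(LINT t|M. LINT r|M. (if t < r then H t r else 0)) = (LINT t|M. LINT r|M. (if r < t then H r t else 0))"
  proof -
    have "integrable (M \<Otimes>\<^sub>M M) (case_prod (\<lambda>t r. if t < r then H t r else 0))"
      using i2 by (simp add: case_prod_unfold)
    from P.Fubini_integral[OF this] show ?thesis by simp
  qed
  have "AE t in M. integrable M (\<lambda>r. if r < t then H t r else 0)"
    using P.AE_integrable_fst'[OF i1] by (simp cong: if_cong)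
  moreover have "AE t in M. integrable M (\<lambda>r. if t < r then H t r else 0)"
    using P.AE_integrable_fst'[OF i2] by (simp cong: if_cong)
  ultimately have "AE t in M. (LINT r|M. H t r) =
      (LINT r|M. (if r < t then H t r else 0)) + (LINT r|M. (if t < r then H t r else 0))"
    using P.AE_integrable_fst'[OF H]
  proof eventually_elim
    case (elim t)
    have "(LINT r|M. H t r) = (LINT r|M. (if r < t then H t r else 0) + (if t < r then H t r else 0))"
    proof (rule integral_cong_AE)
      have "{t} \<in> null_sets lebesgue" by (simp flip: negligible_iff_null_sets)
      then have "AE r in lebesgue. r \<noteq> t" using AE_not_in by fastforce
      then have "AE r in M. r \<noteq> t" unfolding M_def by (subst AE_restrict_space_iff) auto
      then show "AE r in M. H t r = (if r < t then H t r else 0) + (if t < r then H t r else 0)"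
        by eventually_elim auto
    qed (use elim in auto)
    then show ?case using elim by simp
  qed
  then have "(LINT t|M. LINT r|M. H t r) = (LINT t|M. (LINT r|M. (if r < t then H t r else 0)) + (LINT r|M. (if t < r then H t r else 0)))"
    using P.integrable_fst'[OF H] j1 j2 by (intro integral_cong_AE) auto
  also have "\<dots> = (LINT t|M. LINT r|M. (if r < t then H t r else 0)) + (LINT t|M. LINT r|M. (if t < r then H t r else 0))"
    by (rule Bochner_Integration.integral_add[OF j1 j2])
  also have "(LINT t|M. LINT r|M. (if r < t then H t r else 0)) = (LINT t|M. LINT r|M. (if r < t then H r t else 0))"
    by (rule Bochner_Integration.integral_cong[OF refl]) (simp add: c1 sp)
  finally show "(LINT t|M. LINT r|M. H t r) = 2 * (LINT t|M. LINT r|M. (if r < t then H r t else 0))"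
    using sw by simp
qed

section \<open>The du Bois-Reymond lemma in time\<close>

lemma test_function_has_real_derivative:
  fixes \<psi> :: "real \<Rightarrow> real"
  assumes "\<psi> \<in> test_functions U"
  shows "(\<psi> has_real_derivative deriv \<psi> t) (at t)"
    and "deriv \<psi> t = frechet_derivative \<psi> (at t) 1"
proof -
  have F: "(\<psi> has_derivative frechet_derivative \<psi> (at t)) (at t)"
    by (rule test_function_has_derivative[OF assms])
  have "frechet_derivative \<psi> (at t) = (*) (frechet_derivative \<psi> (at t) 1)"
  proof
    fix r
    show "frechet_derivative \<psi> (at t) r = frechet_derivative \<psi> (at t) 1 * r"
      using linear_cmul[OF has_derivative_linear[OF F], of r 1] by (simp add: mult.commute)
  qed
  with F have d: "(\<psi> has_real_derivative frechet_derivative \<psi> (at t) 1) (at t)"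
    by (simp add: has_field_derivative_def)
  show e: "deriv \<psi> t = frechet_derivative \<psi> (at t) 1" by (rule DERIV_imp_deriv[OF d])
  show "(\<psi> has_real_derivative deriv \<psi> t) (at t)" unfolding e by (rule d)
qed

lemma test_functions_deriv:
  fixes \<psi> :: "real \<Rightarrow> real"
  assumes "\<psi> \<in> test_functions U"
  shows "deriv \<psi> \<in> test_functions U"
  unfolding test_function_has_real_derivative(2)[OF assms, abs_def]
  by (rule test_functions_derivative[OF assms]) simp

text \<open>The vanishing integral is what makes the primitive compactly supported.\<close>

lemma test_function_antiderivative:
  fixes \<theta> :: "real \<Rightarrow> real"
  assumes T: "0 < T" and \<theta>: "\<theta> \<in> test_functions {0<..<T}" and zero: "integral {0..T} \<theta> = 0"
  obtains \<psi> where "\<psi> \<in> test_functions {0<..<T}" "\<And>t. (\<psi> has_real_derivative \<theta> t) (at t)"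
proof -
  obtain K where K: "compact K" "K \<subseteq> {0<..<T}" "\<And>x. x \<notin> K \<Longrightarrow> \<theta> x = 0"
    using \<theta> test_functionsE by metis
  obtain a b where ab: "0 < a" "a \<le> b" "b < T" "K \<subseteq> {a..b}"
  proof (cases "K = {}")
    case True
    then show ?thesis using that[of "T/2" "T/2"] T by auto
  next
    case False
    then obtain a b where "a \<in> K" "b \<in> K" "\<And>x. x \<in> K \<Longrightarrow> a \<le> x" "\<And>x. x \<in> K \<Longrightarrow> x \<le> b"
      using compact_attains_inf[OF K(1)] compact_attains_sup[OF K(1)] by metis
    moreover from this have "K \<subseteq> {a..b}" "0 < a" "b < T" "a \<le> b" using K(2) by auto
    ultimately show ?thesis using that[of a b] by blast
  qed
  have out: "\<theta> x = 0" if "x \<notin> {a..b}" for x using that ab(4) K(3) by blast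
  have cont: "continuous_on S \<theta>" for S
    using test_function_continuous[OF \<theta>] continuous_on_subset by blast
  define F where "F t = integral {0..t} \<theta>" for t
  define \<psi> where "\<psi> t = (if t \<in> {0<..<T} then F t else 0)" for t
  have left: "\<psi> t = 0" if "t < a" for t
  proof -
    have "integral {0..t} \<theta> = integral {0..t} (\<lambda>_. 0)"
      by (rule Henstock_Kurzweil_Integration.integral_cong) (use that in \<open>auto intro: out\<close>)
    then show ?thesis by (simp add: \<psi>_def F_def)
  qed
  have right: "\<psi> t = 0" if "t > b" for t
  proof (cases "t < T")
    case True
    have "integral {t..T} \<theta> = integral {t..T} (\<lambda>_. 0)"
      by (rule Henstock_Kurzweil_Integration.integral_cong) (use that in \<open>auto intro: out\<close>)
    moreover have "integral {0..t} \<theta> + integral {t..T} \<theta> = integral {0..T} \<theta>"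
      using that ab True by (intro Henstock_Kurzweil_Integration.integral_combine integrable_continuous_real cont) auto
    ultimately show ?thesis using zero by (simp add: \<psi>_def F_def)
  qed (simp add: \<psi>_def)
  have D: "(\<psi> has_real_derivative \<theta> t) (at t)" for t
  proof -
    consider "t < a" | "t > b" | "t \<in> {0<..<T}" using ab by force
    then show ?thesis
    proof cases
      case 1
      then have "((\<lambda>_. 0) has_real_derivative \<theta> t) (at t)" using out by auto
      then show ?thesis
        by (rule has_field_derivative_transform_within_open[where S = "{..<a}"]) (use 1 left in auto)
    next
      case 2
      then have "((\<lambda>_. 0) has_real_derivative \<theta> t) (at t)" using out by auto
      then show ?thesis
        by (rule has_field_derivative_transform_within_open[where S = "{b<..}"]) (use 2 right in auto)
    next
      case 3
      have "(F has_real_derivative \<theta> t) (at t within {0..T})"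
        unfolding F_def using 3 by (intro integral_has_real_derivative cont) auto
      then have "(F has_real_derivative \<theta> t) (at t)"
        using 3 by (simp add: at_within_Icc_at)
      then show ?thesis
        by (rule has_field_derivative_transform_within_open[where S = "{0<..<T}"])
           (use 3 in \<open>auto simp: \<psi>_def\<close>)
    qed
  qed
  have "Ck k \<psi>" for k
  proof (rule Ck_pred, rule Ck_SucI)
    show "(\<psi> has_derivative (\<lambda>h. \<theta> t * h)) (at t)" for t
      using D[of t] by (simp add: has_field_derivative_def)
  qed (use test_function_Ck[OF \<theta>] in auto)
  then have "\<psi> \<in> test_functions {0<..<T}"
    by (rule test_functionsI[where K = "{a..b}"]) (use ab left right in \<open>auto simp: not_le\<close>)
  then show ?thesis using D that by blast
qed

text \<open>With \<open>\<eta>\<close> a test function of integral one, \<open>\<theta> - (\<integral> \<theta>) \<eta>\<close> is the derivative of a test function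
  for every test function \<open>\<theta>\<close>, so \<open>h\<close> is orthogonal to it; this says that \<open>h - \<integral> \<eta> h\<close> is orthogonal
  to \<open>\<theta>\<close>. Continuity upgrades the almost everywhere statement.\<close>

lemma integral_time_test_eq_0_imp_constant:
  fixes h :: "real \<Rightarrow> real"
  assumes T: "0 < T" and h: "continuous_on {0..T} h"
    and zero: "\<And>\<psi>. \<psi> \<in> test_functions {0<..<T} \<Longrightarrow> (LINT t|lebesgue_on {0<..<T}. deriv \<psi> t * h t) = 0"
    and t: "t \<in> {0..T}"
  shows "h t = h 0"
proof -
  let ?J = "{0<..<T}"
  have intg: "integrable (lebesgue_on ?J) f" if "continuous_on {0..T} f" for f :: "real \<Rightarrow> real"
    using continuous_imp_integrable_real[OF that] by (rule integrable_subset_lebesgue_on) auto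
  have int_HK: "(LINT t|lebesgue_on ?J. f t) = integral {0..T} f" if "continuous_on {0..T} f" for f :: "real \<Rightarrow> real"
    using lebesgue_integral_eq_integral[OF intg[OF that]] by (simp add: integral_open_interval_real)
  have cont: "continuous_on S \<theta>" if "\<theta> \<in> test_functions ?J" for S and \<theta> :: "real \<Rightarrow> real"
    using test_function_continuous[OF that] continuous_on_subset by blast
  obtain \<eta> :: "real \<Rightarrow> real" where \<eta>: "\<eta> \<in> test_functions ?J" "integral {0..T} \<eta> = 1"
  proof -
    obtain \<phi> where \<phi>: "\<And>m::nat. \<phi> m \<in> test_functions ?J" "\<And>m x. 0 \<le> \<phi> m x" "\<And>m x. \<phi> m x \<le> 1"
      "\<And>x. (\<lambda>m. \<phi> m x) \<longlonglongrightarrow> indicator (box (T/3) (T/2)) x"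
      by (rule test_functions_to_box[of "T/3" "T/2" ?J]) (use T in auto)
    have "(\<lambda>m. LINT t|lebesgue_on ?J. \<phi> m t) \<longlonglongrightarrow> (LINT t|lebesgue_on ?J. indicator (box (T/3) (T/2)) t)"
    proof (rule integral_dominated_convergence[where w = "\<lambda>_. 1"])
      show "integrable (lebesgue_on ?J) (\<lambda>_. 1::real)" by (rule intg) simp
      show "indicator (box (T/3) (T/2)) \<in> borel_measurable (lebesgue_on ?J)"
        by (intro measurable_restrict_space1 borel_measurable_indicator) simp
    qed (use \<phi> in \<open>auto intro: test_function_measurable\<close>)
    also have "(LINT t|lebesgue_on ?J. indicator (box (T/3) (T/2)) t) = T / 6"
    proof -
      have "{T / 3<..<T / 2} \<subseteq> ?J" using T by auto
      then show ?thesis using T by (simp add: measure_restrict_space Int_absorb2)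
    qed
    finally have "\<forall>\<^sub>F m in sequentially. (LINT t|lebesgue_on ?J. \<phi> m t) > 0"
      by (rule order_tendstoD(1)) (use T in simp)
    then have "\<exists>m. (LINT t|lebesgue_on ?J. \<phi> m t) > 0"
      by (rule eventually_happens'[OF sequentially_bot])
    then obtain m where m: "integral {0..T} (\<phi> m) > 0" using int_HK[OF cont[OF \<phi>(1)]] by auto
    show ?thesis
    proof (rule that)
      show "(\<lambda>t. (1 / integral {0..T} (\<phi> m)) * \<phi> m t) \<in> test_functions ?J"
        by (rule test_functions_cmult[OF \<phi>(1)])
    qed (use m in simp)
  qed
  define k where "k = (LINT t|lebesgue_on ?J. \<eta> t * h t)"
  have "AE t in lebesgue_on ?J. h t - k = 0"
  proof (rule fundamental_lemma_variations)
    show "loc_integrable ?J (\<lambda>t. h t - k)"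
      unfolding loc_integrable_def
    proof (intro allI impI)
      fix K :: "real set" assume K: "compact K \<and> K \<subseteq> ?J"
      have "integrable (lebesgue_on {0..T}) (\<lambda>t. h t - k)"
        by (rule continuous_imp_integrable_real[OF continuous_on_diff[OF h continuous_on_const]])
      then show "integrable (lebesgue_on K) (\<lambda>t. h t - k)"
        by (rule integrable_subset_lebesgue_on) (use K fmeasurableD[OF lmeasurable_compact] in auto)
    qed
    fix \<theta> :: "real \<Rightarrow> real" assume \<theta>: "\<theta> \<in> test_functions ?J"
    let ?m = "integral {0..T} \<theta>"
    let ?\<theta>0 = "\<lambda>t. \<theta> t + (- ?m) * \<eta> t"
    have \<theta>0: "?\<theta>0 \<in> test_functions ?J"
      by (rule test_functions_add[OF \<theta> test_functions_cmult[OF \<eta>(1)]])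
    have "integral {0..T} ?\<theta>0 = ?m + integral {0..T} (\<lambda>t. (- ?m) * \<eta> t)"
      by (rule Henstock_Kurzweil_Integration.integral_add[OF integrable_continuous_real[OF cont[OF \<theta>]]
          integrable_continuous_real[OF cont[OF test_functions_cmult[OF \<eta>(1)]]]])
    also have "\<dots> = 0" using \<eta>(2) by simp
    finally have "integral {0..T} ?\<theta>0 = 0" .
    then obtain \<psi> where \<psi>: "\<psi> \<in> test_functions ?J" "\<And>t. (\<psi> has_real_derivative ?\<theta>0 t) (at t)"
      by (rule test_function_antiderivative[OF T \<theta>0]) (rule that)
    have i\<theta>h: "integrable (lebesgue_on ?J) (\<lambda>t. \<theta> t * h t)"
      by (rule intg[OF continuous_on_mult[OF cont[OF \<theta>] h]])
    have i\<eta>h: "integrable (lebesgue_on ?J) (\<lambda>t. \<eta> t * h t)"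
      by (rule intg[OF continuous_on_mult[OF cont[OF \<eta>(1)] h]])
    have i\<theta>: "integrable (lebesgue_on ?J) \<theta>"
      by (rule intg[OF cont[OF \<theta>]])
    have "(LINT t|lebesgue_on ?J. deriv \<psi> t * h t) = (LINT t|lebesgue_on ?J. \<theta> t * h t - ?m * (\<eta> t * h t))"
      by (rule Bochner_Integration.integral_cong[OF refl])
         (simp add: DERIV_imp_deriv[OF \<psi>(2)] algebra_simps)
    also have "\<dots> = (LINT t|lebesgue_on ?J. \<theta> t * h t) - ?m * k"
      unfolding k_def
      unfolding Bochner_Integration.integral_mult_right_zero[symmetric]
      by (rule Bochner_Integration.integral_diff[OF i\<theta>h integrable_mult_right[OF i\<eta>h]])
    also have "?m * k = (LINT t|lebesgue_on ?J. \<theta> t * k)"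
      unfolding Bochner_Integration.integral_mult_left_zero int_HK[OF cont[OF \<theta>]] ..
    also have "(LINT t|lebesgue_on ?J. \<theta> t * h t) - (LINT t|lebesgue_on ?J. \<theta> t * k) =
        (LINT t|lebesgue_on ?J. \<theta> t * h t - \<theta> t * k)"
      by (rule Bochner_Integration.integral_diff[symmetric, OF i\<theta>h integrable_mult_left[OF i\<theta>]])
    also have "\<dots> = (LINT t|lebesgue_on ?J. (h t - k) * \<theta> t)"
      by (rule Bochner_Integration.integral_cong[OF refl]) (simp add: algebra_simps)
    finally show "(LINT t|lebesgue_on ?J. (h t - k) * \<theta> t) = 0"
      unfolding zero[OF \<psi>(1)] by (rule sym)
  qed auto
  then have ae: "AE t\<in>?J in lebesgue. h t = k" by (simp add: AE_restrict_space_iff)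
  define C where "C = {t \<in> {0..T}. h t = k}"
  have "closed C" unfolding C_def
    by (rule continuous_closed_preimage_constant[OF h closed_atLeastAtMost])
  have aeC: "AE t\<in>?J in lebesgue. t \<in> C"
    using ae by eventually_elim (simp add: C_def)
  have "?J \<subseteq> C"
    by (rule subsetI) (rule mem_closed_if_AE_lebesgue_open[OF open_greaterThanLessThan \<open>closed C\<close> aeC])
  then have "closure ?J \<subseteq> C" using \<open>closed C\<close> by (rule closure_minimal)
  then have "{0..T} \<subseteq> C" using T by simp
  then show ?thesis using t T by (auto simp: C_def subset_iff)
qed

text \<open>Fubini's theorem identifies \<open>g\<close> as the distributional derivative of its indefinite integral
  \<open>G\<close>, so \<open>c + G\<close> has zero derivative.\<close>

lemma du_Bois_Reymond:
  fixes c g :: "real \<Rightarrow> real"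
  assumes T: "0 < T" and c: "continuous_on {0..T} c" and g: "integrable (lebesgue_on {0<..<T}) g"
    and eq: "\<And>\<psi>. \<psi> \<in> test_functions {0<..<T} \<Longrightarrow>
       (LINT t|lebesgue_on {0<..<T}. deriv \<psi> t * c t) = (LINT t|lebesgue_on {0<..<T}. \<psi> t * g t)"
    and t: "t \<in> {0..T}"
  shows "c t = c 0 - (LINT s|lebesgue_on {0<..<t}. g s)"
proof -
  let ?J = "{0<..<T}"
  let ?M = "lebesgue_on ?J"
  interpret finite_measure ?M by (rule finite_measure_lebesgue_on) auto
  interpret P: pair_sigma_finite ?M ?M ..
  have idm[measurable]: "(\<lambda>x. x) \<in> borel_measurable ?M"
    using id_borel_measurable_lebesgue_on[of ?J] by (simp add: id_def)
  have [measurable]: "fst \<in> borel_measurable (?M \<Otimes>\<^sub>M ?M)" "snd \<in> borel_measurable (?M \<Otimes>\<^sub>M ?M)"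
    using measurable_compose[OF measurable_fst idm] measurable_compose[OF measurable_snd idm] by simp_all
  define G where "G t = (LINT s|lebesgue_on {0<..<t}. g s)" for t
  have G: "G t = (LINT s|?M. (if s < t then g s else 0))" if "t \<in> {0..T}" for t
  proof -
    have "(LINT s|?M. (if s < t then g s else 0)) = (LINT s|?M. (if s \<in> {0<..<t} then g s else 0))"
      by (intro Bochner_Integration.integral_cong) auto
    also have "\<dots> = G t"
      unfolding G_def by (rule Lebesgue_Measure.integral_restrict) (use that in auto)
    finally show ?thesis by simp
  qed
  have gHK: "g integrable_on {0..T}"
    using has_integral_integral_lebesgue_on[OF g] by (auto simp: integrable_on_Icc_iff_Ioo)
  have G_HK: "G t = integral {0..t} g" if "t \<in> {0..T}" for t
  proof -
    have "integrable (lebesgue_on {0<..<t}) g"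
      by (rule integrable_subset_lebesgue_on[OF g]) (use that in auto)
    then show ?thesis unfolding G_def
      by (subst lebesgue_integral_eq_integral) (auto simp: integral_open_interval_real)
  qed
  have Gc: "continuous_on {0..T} G"
    using indefinite_integral_continuous_1[OF gHK]
    by (rule continuous_on_cong[THEN iffD1, OF refl, rotated]) (simp add: G_HK)
  have intg: "integrable ?M f" if "continuous_on {0..T} f" for f :: "real \<Rightarrow> real"
    using continuous_imp_integrable_real[OF that] by (rule integrable_subset_lebesgue_on) auto
  have "c t + G t = c 0 + G 0"
  proof (rule integral_time_test_eq_0_imp_constant[where h = "\<lambda>t. c t + G t", OF T _ _ t])
    show "continuous_on {0..T} (\<lambda>t. c t + G t)" by (rule continuous_on_add[OF c Gc])
    fix \<psi> assume \<psi>: "\<psi> \<in> test_functions ?J"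
    note d = test_function_has_real_derivative(1)[OF \<psi>]
    note \<psi>' = test_functions_deriv[OF \<psi>]
    note [measurable] = test_function_measurable[OF \<psi>', of ?J] borel_measurable_integrable[OF g]
    have \<psi>'c: "continuous_on S (deriv \<psi>)" for S
      using test_function_continuous[OF \<psi>'] continuous_on_subset by blast
    have "integrable (?M \<Otimes>\<^sub>M ?M) (\<lambda>p. deriv \<psi> (fst p) * g (snd p))"
      by (intro integrable_pair_mult finite_measure_axioms intg \<psi>'c g)
    then have "integrable (?M \<Otimes>\<^sub>M ?M) (\<lambda>p. if snd p < fst p then deriv \<psi> (fst p) * g (snd p) else 0)"
      by (rule Bochner_Integration.integrable_bound) auto
    then have "integrable (?M \<Otimes>\<^sub>M ?M) (case_prod (\<lambda>t s. if s < t then deriv \<psi> t * g s else 0))"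
      by (simp add: case_prod_unfold)
    from P.Fubini_integral[OF this]
    have fub: "(LINT s|?M. LINT t|?M. (if s < t then deriv \<psi> t * g s else 0)) =
        (LINT t|?M. LINT s|?M. (if s < t then deriv \<psi> t * g s else 0))" .
    have inner1: "(LINT s|?M. (if s < t then deriv \<psi> t * g s else 0)) = deriv \<psi> t * G t" if "t \<in> ?J" for t
    proof -
      have "(LINT s|?M. (if s < t then deriv \<psi> t * g s else 0)) = (LINT s|?M. deriv \<psi> t * (if s < t then g s else 0))"
        by (intro Bochner_Integration.integral_cong) auto
      then show ?thesis using that by (simp add: G)
    qed
    have inner2: "(LINT t|?M. (if s < t then deriv \<psi> t * g s else 0)) = - (\<psi> s * g s)" if s: "s \<in> ?J" for s
    proof -
      have "(LINT t|?M. (if s < t then deriv \<psi> t * g s else 0)) = (LINT t|?M. (if t \<in> {s<..<T} then deriv \<psi> t else 0) * g s)"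
        by (intro Bochner_Integration.integral_cong) auto
      also have "\<dots> = (LINT t|lebesgue_on {s<..<T}. deriv \<psi> t) * g s"
      proof -
        have "(LINT t|?M. (if t \<in> {s<..<T} then deriv \<psi> t else 0)) = (LINT t|lebesgue_on {s<..<T}. deriv \<psi> t)"
          by (rule Lebesgue_Measure.integral_restrict) (use s in auto)
        then show ?thesis unfolding Bochner_Integration.integral_mult_left_zero by (rule arg_cong)
      qed
      also have "(LINT t|lebesgue_on {s<..<T}. deriv \<psi> t) = integral {s..T} (deriv \<psi>)"
      proof -
        have "integrable (lebesgue_on {s<..<T}) (deriv \<psi>)"
          by (rule integrable_subset_lebesgue_on[OF intg[OF \<psi>'c]]) (use s in auto)
        then show ?thesis
          by (subst lebesgue_integral_eq_integral) (simp_all add: integral_open_interval_real)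
      qed
      also have "\<dots> = \<psi> T - \<psi> s"
      proof (rule integral_unique, rule fundamental_theorem_of_calculus)
        fix t
        show "(\<psi> has_vector_derivative deriv \<psi> t) (at t within {s..T})"
          using d[of t] unfolding has_real_derivative_iff_has_vector_derivative
          by (rule has_vector_derivative_at_within)
      qed (use s in simp)
      also have "\<psi> T = 0"
      proof -
        obtain L where "L \<subseteq> ?J" "\<And>x. x \<notin> L \<Longrightarrow> \<psi> x = 0" using test_functionsE[OF \<psi>] by metis
        moreover from this have "T \<notin> L" by auto
        ultimately show ?thesis by blast
      qed
      finally show ?thesis by simp
    qed
    have "(LINT t|?M. deriv \<psi> t * G t) = (LINT t|?M. LINT s|?M. (if s < t then deriv \<psi> t * g s else 0))"
      by (intro Bochner_Integration.integral_cong) (auto simp: inner1)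
    also have "\<dots> = (LINT s|?M. - (\<psi> s * g s))"
      unfolding fub[symmetric] by (intro Bochner_Integration.integral_cong) (auto simp: inner2)
    finally have "(LINT t|?M. deriv \<psi> t * G t) = - (LINT t|?M. \<psi> t * g t)" by simp
    moreover have "(LINT t|?M. deriv \<psi> t * c t + deriv \<psi> t * G t) =
        (LINT t|?M. deriv \<psi> t * c t) + (LINT t|?M. deriv \<psi> t * G t)"
      by (rule Bochner_Integration.integral_add[OF intg[OF continuous_on_mult[OF \<psi>'c c]]
            intg[OF continuous_on_mult[OF \<psi>'c Gc]]])
    ultimately show "(LINT t|?M. deriv \<psi> t * (c t + G t)) = 0"
      by (simp add: distrib_left eq[OF \<psi>])
  qed
  moreover have "G 0 = 0" by (simp add: G_def)
  ultimately show ?thesis by (simp add: G_def)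
qed

section \<open>Square integrable functions\<close>

lemma borel_measurable_lebesgue_on_AE:
  fixes f g :: "'a::euclidean_space \<Rightarrow> 'b::euclidean_space"
  assumes S: "S \<in> sets lebesgue" and f: "f \<in> borel_measurable (lebesgue_on S)"
    and eq: "AE x in lebesgue_on S. f x = g x"
  shows "g \<in> borel_measurable (lebesgue_on S)"
proof (rule borel_measurable_if_D, rule borel_measurable_AE)
  show "(\<lambda>x. if x \<in> S then f x else 0) \<in> borel_measurable lebesgue"
    using f S by (rule borel_measurable_if_I)
  show "AE x in lebesgue. (if x \<in> S then f x else 0) = (if x \<in> S then g x else 0)"
    using eq S by (simp add: AE_restrict_space_iff)
qed

text \<open>Lebesgue measure is complete, so either both functions are measurable or neither is, and in the
  latter case both integrals are zero by convention.\<close>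

lemma integral_cong_AE_lebesgue_on:
  fixes f g :: "'a::euclidean_space \<Rightarrow> real"
  assumes "S \<in> sets lebesgue" "AE x in lebesgue_on S. f x = g x"
  shows "(LINT x|lebesgue_on S. f x) = (LINT x|lebesgue_on S. g x)"
proof (cases "f \<in> borel_measurable (lebesgue_on S)")
  case True
  then show ?thesis
    using borel_measurable_lebesgue_on_AE[OF assms(1) True assms(2)] assms(2) by (intro integral_cong_AE)
next
  case False
  have "g \<notin> borel_measurable (lebesgue_on S)"
    using borel_measurable_lebesgue_on_AE[OF assms(1), of g f] False assms(2) by (auto simp: eq_commute)
  then have "\<not> integrable (lebesgue_on S) g" "\<not> integrable (lebesgue_on S) f"
    using False by (auto dest: borel_measurable_integrable)
  then show ?thesis by (simp add: not_integrable_integral_eq)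
qed

lemma integrable_cong_AE_lebesgue_on:
  fixes f g :: "'a::euclidean_space \<Rightarrow> real"
  assumes "S \<in> sets lebesgue" "integrable (lebesgue_on S) f" "AE x in lebesgue_on S. f x = g x"
  shows "integrable (lebesgue_on S) g"
  using integrable_cong_AE_imp[OF assms(2) borel_measurable_lebesgue_on_AE[OF assms(1) _ assms(3)]]
    assms by (auto simp: eq_commute)

lemma powr_2_norm: "norm (x::'b::real_normed_vector) powr 2 = (norm x)\<^sup>2"
  by (cases "norm x = 0") (auto simp: powr_numeral)

lemma Lp_2_iff: "g \<in> Lp 2 U \<longleftrightarrow>
    g \<in> borel_measurable (lebesgue_on U) \<and> integrable (lebesgue_on U) (\<lambda>x. (norm (g x))\<^sup>2)"
  by (simp add: Lp_def powr_2_norm)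

lemma Lp_2_norm_mult_integrable:
  fixes f :: "'a::euclidean_space \<Rightarrow> 'b::euclidean_space" and g :: "'a \<Rightarrow> 'c::euclidean_space"
  assumes f: "f \<in> Lp 2 U" and g: "g \<in> Lp 2 U"
  shows "integrable (lebesgue_on U) (\<lambda>x. norm (f x) * norm (g x))"
proof (rule Bochner_Integration.integrable_bound[where f = "\<lambda>x. (norm (f x))\<^sup>2 + (norm (g x))\<^sup>2"])
  have "norm (f x) * norm (g x) \<le> (norm (f x))\<^sup>2 + (norm (g x))\<^sup>2" for x
    using sum_squares_bound[of "norm (f x)" "norm (g x)"] mult_nonneg_nonneg[of "norm (f x)" "norm (g x)"]
      norm_ge_zero[of "f x"] norm_ge_zero[of "g x"] by linarith
  then show "AE x in lebesgue_on U. norm (norm (f x) * norm (g x)) \<le> norm ((norm (f x))\<^sup>2 + (norm (g x))\<^sup>2)"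
    by (intro AE_I2) (simp add: abs_mult)
qed (use f g in \<open>auto simp: Lp_2_iff\<close>)

lemma Lp_2_inner_integrable:
  assumes f: "f \<in> Lp 2 U" and g: "g \<in> Lp 2 U"
  shows "integrable (lebesgue_on U) (\<lambda>x. f x \<bullet> g x)"
  by (rule Bochner_Integration.integrable_bound[OF Lp_2_norm_mult_integrable[OF f g]])
     (use f g in \<open>auto simp: Lp_2_iff abs_mult Cauchy_Schwarz_ineq2\<close>)

lemma Lp_2_mult_integrable:
  fixes f g :: "'a::euclidean_space \<Rightarrow> real"
  shows "f \<in> Lp 2 U \<Longrightarrow> g \<in> Lp 2 U \<Longrightarrow> integrable (lebesgue_on U) (\<lambda>x. f x * g x)"
  using Lp_2_inner_integrable[of f U g] by simp

lemma Lp_2_Cauchy_Schwarz: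
  fixes f :: "'a::euclidean_space \<Rightarrow> 'b::euclidean_space" and g :: "'a \<Rightarrow> 'c::euclidean_space"
  assumes f: "f \<in> Lp 2 U" and g: "g \<in> Lp 2 U"
  shows "(LINT x|lebesgue_on U. norm (f x) * norm (g x)) \<le>
    sqrt (LINT x|lebesgue_on U. (norm (f x))\<^sup>2) * sqrt (LINT x|lebesgue_on U. (norm (g x))\<^sup>2)"
proof -
  let ?I = "\<lambda>h. LINT x|lebesgue_on U. h x"
  let ?f = "\<lambda>x. norm (f x)" and ?g = "\<lambda>x. norm (g x)"
  have fi: "integrable (lebesgue_on U) (\<lambda>x. (?f x)\<^sup>2)" and gi: "integrable (lebesgue_on U) (\<lambda>x. (?g x)\<^sup>2)"
    using f g by (auto simp: Lp_2_iff)
  note fg = Lp_2_norm_mult_integrable[OF f g]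
  have "0 \<le> ?I (\<lambda>x. (?f x)\<^sup>2) + 2 * e * ?I (\<lambda>x. ?f x * ?g x) + e\<^sup>2 * ?I (\<lambda>x. (?g x)\<^sup>2)" for e
  proof -
    have "0 \<le> ?I (\<lambda>x. (?f x + e * ?g x)\<^sup>2)" by (intro integral_nonneg_AE AE_I2) simp
    also have "\<dots> = ?I (\<lambda>x. ((?f x)\<^sup>2 + 2 * e * (?f x * ?g x)) + e\<^sup>2 * (?g x)\<^sup>2)"
      by (rule Bochner_Integration.integral_cong[OF refl]) (simp add: power2_eq_square algebra_simps)
    also have "\<dots> = ?I (\<lambda>x. (?f x)\<^sup>2) + 2 * e * ?I (\<lambda>x. ?f x * ?g x) + e\<^sup>2 * ?I (\<lambda>x. (?g x)\<^sup>2)"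
      using fi gi fg by simp
    finally show ?thesis .
  qed
  then have "(?I (\<lambda>x. ?f x * ?g x))\<^sup>2 \<le> ?I (\<lambda>x. (?f x)\<^sup>2) * ?I (\<lambda>x. (?g x)\<^sup>2)"
    by (rule discriminant_nonpos) (auto intro: integral_nonneg_AE)
  then show ?thesis by (simp flip: real_sqrt_mult add: real_le_rsqrt)
qed

lemma Lp_2_lincomb:
  fixes f g :: "'a::euclidean_space \<Rightarrow> 'b::euclidean_space"
  assumes f: "f \<in> Lp 2 U" and g: "g \<in> Lp 2 U"
  shows "(\<lambda>x. c *\<^sub>R f x + d *\<^sub>R g x) \<in> Lp 2 U"
  unfolding Lp_2_iff
proof
  show m: "(\<lambda>x. c *\<^sub>R f x + d *\<^sub>R g x) \<in> borel_measurable (lebesgue_on U)"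
    using f g by (auto simp: Lp_2_iff)
  have "integrable (lebesgue_on U) (\<lambda>x. c\<^sup>2 * (norm (f x))\<^sup>2 + 2 * c * d * (f x \<bullet> g x) + d\<^sup>2 * (norm (g x))\<^sup>2)"
    using f g Lp_2_inner_integrable[OF f g] by (auto simp: Lp_2_iff)
  moreover have "(norm (c *\<^sub>R f x + d *\<^sub>R g x))\<^sup>2 =
      c\<^sup>2 * (norm (f x))\<^sup>2 + 2 * c * d * (f x \<bullet> g x) + d\<^sup>2 * (norm (g x))\<^sup>2" for x
    unfolding power2_norm_eq_inner
    by (simp add: inner_add_left inner_add_right inner_commute power2_eq_square algebra_simps)
  ultimately show "integrable (lebesgue_on U) (\<lambda>x. (norm (c *\<^sub>R f x + d *\<^sub>R g x))\<^sup>2)"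
    by simp
qed

lemma Lp_2_AE:
  fixes f g :: "'a::euclidean_space \<Rightarrow> 'b::euclidean_space"
  assumes "U \<in> sets lebesgue" "f \<in> Lp 2 U" "AE x in lebesgue_on U. f x = g x"
  shows "g \<in> Lp 2 U"
  unfolding Lp_2_iff
proof
  show "g \<in> borel_measurable (lebesgue_on U)"
    using borel_measurable_lebesgue_on_AE assms by (auto simp: Lp_2_iff)
  show "integrable (lebesgue_on U) (\<lambda>x. (norm (g x))\<^sup>2)"
    by (rule integrable_cong_AE_lebesgue_on[of _ "\<lambda>x. (norm (f x))\<^sup>2"])
       (use assms in \<open>auto simp: Lp_2_iff elim: eventually_mono\<close>)
qed

section \<open>Weak gradients\<close>

definition gradient :: "(real^'n \<Rightarrow> real) \<Rightarrow> real^'n \<Rightarrow> real^'n" where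
  "gradient \<phi> x = (\<chi> i. frechet_derivative \<phi> (at x) (axis i 1))"

locale bounded_domain =
  fixes \<Omega> :: "(real^'n) set"
  assumes open_domain: "open \<Omega>" and bounded_domain: "bounded \<Omega>"
begin

abbreviation "M \<equiv> lebesgue_on \<Omega>"
abbreviation "N \<equiv> W1_norm 2 \<Omega>"
abbreviation "D \<equiv> weak_grad \<Omega>"

lemma sets_domain[simp]: "\<Omega> \<in> sets lebesgue"
  using open_domain by auto

sublocale finite_measure M
  using open_domain bounded_domain
  by (intro finite_measure_lebesgue_on) (auto simp: bounded_set_imp_lmeasurable)

lemma Lp_2_integrable:
  fixes f :: "real^'n \<Rightarrow> 'b::euclidean_space"
  assumes f: "f \<in> Lp 2 \<Omega>"
  shows "integrable M f"
proof (rule Bochner_Integration.integrable_bound[where f = "\<lambda>x. 1 + (norm (f x))\<^sup>2"])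
  have "norm (f x) \<le> 1 + (norm (f x))\<^sup>2" for x
    using sum_squares_bound[of 1 "norm (f x)"] norm_ge_zero[of "f x"]
    by (simp only: power_one mult_1_right)
  then show "AE x in M. norm (f x) \<le> norm (1 + (norm (f x))\<^sup>2)" by auto
qed (use f in \<open>auto simp: Lp_2_iff\<close>)

lemma integrable_imp_loc_integrable: "integrable M f \<Longrightarrow> loc_integrable \<Omega> f"
  unfolding loc_integrable_def
  by (auto intro: integrable_subset_lebesgue_on[where T = \<Omega>] fmeasurableD[OF lmeasurable_compact])

lemma test_function_Lp_2:
  assumes "\<phi> \<in> test_functions U"
  shows "\<phi> \<in> Lp 2 \<Omega>"
  unfolding Lp_2_iff
proof
  show m: "\<phi> \<in> borel_measurable M" by (rule test_function_measurable[OF assms])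
  obtain C where C: "\<And>x. \<bar>\<phi> x\<bar> \<le> C" using test_function_bounded[OF assms] by blast
  have "(\<phi> x)\<^sup>2 \<le> C\<^sup>2" for x
    using C[of x] by (intro power2_le_iff_abs_le[THEN iffD2]) auto
  then have "AE x in M. norm ((norm (\<phi> x))\<^sup>2) \<le> C\<^sup>2" by (intro AE_I2) simp
  moreover have "(\<lambda>x. (norm (\<phi> x))\<^sup>2) \<in> borel_measurable M" using m by measurable
  ultimately show "integrable M (\<lambda>x. (norm (\<phi> x))\<^sup>2)"
    by (rule integrable_const_bound)
qed

lemma loc_integrable_component:
  fixes G :: "real^'n \<Rightarrow> real^'n"
  assumes "loc_integrable \<Omega> G"
  shows "loc_integrable \<Omega> (\<lambda>x. G x $ i)"
proof -
  have "(\<lambda>x. G x $ i) = (\<lambda>x. G x \<bullet> axis i 1)" by (simp add: inner_axis)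
  then show ?thesis using assms unfolding loc_integrable_def by (metis integrable_inner_left)
qed

lemma loc_integrable_lincomb:
  fixes f g :: "real^'n \<Rightarrow> 'b::euclidean_space"
  shows "loc_integrable \<Omega> f \<Longrightarrow> loc_integrable \<Omega> g \<Longrightarrow> loc_integrable \<Omega> (\<lambda>x. c *\<^sub>R f x + d *\<^sub>R g x)"
  by (auto simp: loc_integrable_def)

lemma has_weak_gradient_unique:
  assumes G: "has_weak_gradient \<Omega> v G" and H: "has_weak_gradient \<Omega> v H"
  shows "AE x in M. G x = H x"
proof -
  have "AE x in M. G x $ i - H x $ i = 0" for i
  proof (rule fundamental_lemma_variations[OF open_domain])
    have l: "loc_integrable \<Omega> (\<lambda>x. G x $ i)" "loc_integrable \<Omega> (\<lambda>x. H x $ i)"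
      using G H by (auto simp: has_weak_gradient_def intro: loc_integrable_component)
    then show "loc_integrable \<Omega> (\<lambda>x. G x $ i - H x $ i)"
      using loc_integrable_lincomb[of "\<lambda>x. G x $ i" "\<lambda>x. H x $ i" 1 "-1"] by simp
    fix \<phi> :: "real^'n \<Rightarrow> real" assume \<phi>: "\<phi> \<in> test_functions \<Omega>"
    have "(LINT x|M. G x $ i * \<phi> x) = (LINT x|M. H x $ i * \<phi> x)"
    proof -
      let ?I = "LINT x|M. v x * frechet_derivative \<phi> (at x) (axis i 1)"
      have "?I = - (LINT x|M. G x $ i * \<phi> x)" "?I = - (LINT x|M. H x $ i * \<phi> x)"
        using G H \<phi> unfolding has_weak_gradient_def by blast+
      then show ?thesis by linarith
    qed
    then show "(LINT x|M. (G x $ i - H x $ i) * \<phi> x) = 0"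
      using Bochner_Integration.integral_diff[OF test_function_times_integrable[OF open_domain l(1) \<phi>]
          test_function_times_integrable[OF open_domain l(2) \<phi>]]
      by (simp add: left_diff_distrib)
  qed
  then have "AE x in M. \<forall>i. G x $ i - H x $ i = 0" by (simp add: AE_all_countable)
  then show ?thesis by eventually_elim (simp add: vec_eq_iff)
qed

lemma has_weak_gradient_lincomb:
  assumes v: "has_weak_gradient \<Omega> v G" and w: "has_weak_gradient \<Omega> w H"
  shows "has_weak_gradient \<Omega> (\<lambda>x. c * v x + d * w x) (\<lambda>x. c *\<^sub>R G x + d *\<^sub>R H x)"
  unfolding has_weak_gradient_def
proof (intro conjI ballI allI)
  show "loc_integrable \<Omega> (\<lambda>x. c * v x + d * w x)" "loc_integrable \<Omega> (\<lambda>x. c *\<^sub>R G x + d *\<^sub>R H x)"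
    using v w loc_integrable_lincomb[of v w c d] loc_integrable_lincomb[of G H c d]
    by (auto simp: has_weak_gradient_def)
  fix \<phi> :: "real^'n \<Rightarrow> real" and i assume \<phi>: "\<phi> \<in> test_functions \<Omega>"
  let ?D = "\<lambda>x. frechet_derivative \<phi> (at x) (axis i 1)"
  have D: "?D \<in> test_functions \<Omega>" by (rule test_functions_derivative[OF \<phi>]) (simp add: axis_in_Basis_iff)
  note t = test_function_times_integrable[OF open_domain]
  have 1: "integrable M (\<lambda>x. v x * ?D x)" "integrable M (\<lambda>x. w x * ?D x)"
    using v w by (auto simp: has_weak_gradient_def intro!: t D)
  have 2: "integrable M (\<lambda>x. G x $ i * \<phi> x)" "integrable M (\<lambda>x. H x $ i * \<phi> x)"
    using v w by (auto simp: has_weak_gradient_def intro!: t \<phi> loc_integrable_component)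
  have "(LINT x|M. (c * v x + d * w x) * ?D x) = (LINT x|M. c * (v x * ?D x) + d * (w x * ?D x))"
    by (rule Bochner_Integration.integral_cong[OF refl]) (simp add: algebra_simps)
  also have "\<dots> = c * (LINT x|M. v x * ?D x) + d * (LINT x|M. w x * ?D x)"
    using 1 by simp
  also have "\<dots> = - (c * (LINT x|M. G x $ i * \<phi> x) + d * (LINT x|M. H x $ i * \<phi> x))"
    using v w \<phi> by (simp add: has_weak_gradient_def)
  also have "c * (LINT x|M. G x $ i * \<phi> x) + d * (LINT x|M. H x $ i * \<phi> x) =
      (LINT x|M. c * (G x $ i * \<phi> x) + d * (H x $ i * \<phi> x))"
    using 2 by simp
  also have "\<dots> = (LINT x|M. (c *\<^sub>R G x + d *\<^sub>R H x) $ i * \<phi> x)"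
    by (rule Bochner_Integration.integral_cong[OF refl]) (simp add: algebra_simps)
  finally show "(LINT x|M. (c * v x + d * w x) * ?D x) = - (LINT x|M. (c *\<^sub>R G x + d *\<^sub>R H x) $ i * \<phi> x)" .
qed

lemma test_function_integral_domain:
  assumes "\<phi> \<in> test_functions \<Omega>"
  shows "(LINT x|M. \<phi> x) = (LINT x|lborel. \<phi> x)"
proof -
  obtain K where K: "K \<subseteq> \<Omega>" "\<And>x. x \<notin> K \<Longrightarrow> \<phi> x = 0" using test_functionsE[OF assms] by metis
  have m: "\<phi> \<in> borel_measurable lborel"
    using borel_measurable_continuous_onI[OF test_function_continuous[OF assms]] by simp
  have "(LINT x|M. \<phi> x) = (LINT x|lebesgue. (if x \<in> \<Omega> then \<phi> x else 0))"
    by (rule Lebesgue_Measure.integral_restrict_UNIV[symmetric]) simp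
  also have "(\<lambda>x. if x \<in> \<Omega> then \<phi> x else 0) = \<phi>"
    by (rule ext) (use K in auto)
  also have "(LINT x|lebesgue. \<phi> x) = (LINT x|lborel. \<phi> x)"
    by (rule integral_completion[OF m])
  finally show ?thesis .
qed

lemma gradient_component_test:
  "\<phi> \<in> test_functions U \<Longrightarrow> (\<lambda>x. gradient \<phi> x $ i) \<in> test_functions U"
  unfolding gradient_def by (simp add: test_functions_derivative axis_in_Basis_iff)

lemma gradient_Lp_2:
  assumes "\<phi> \<in> test_functions U"
  shows "gradient \<phi> \<in> Lp 2 \<Omega>"
proof -
  have c: "(\<lambda>x. gradient \<phi> x $ i) \<in> Lp 2 \<Omega>" for i
    by (rule test_function_Lp_2[OF gradient_component_test[OF assms]])
  then have [measurable]: "(\<lambda>x. gradient \<phi> x $ i) \<in> borel_measurable M" for i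
    by (simp add: Lp_2_iff)
  have "gradient \<phi> = (\<lambda>x. \<Sum>i\<in>UNIV. gradient \<phi> x $ i *\<^sub>R axis i 1)"
    by (simp add: fun_eq_iff vec_eq_iff axis_def if_distrib sum.If_cases cong: if_cong)
  moreover have "(\<lambda>x. \<Sum>i\<in>UNIV. gradient \<phi> x $ i *\<^sub>R axis i 1 :: real^'n) \<in> borel_measurable M"
    by measurable
  ultimately have "gradient \<phi> \<in> borel_measurable M" by simp
  moreover have "(norm (gradient \<phi> x))\<^sup>2 = (\<Sum>i\<in>UNIV. (norm (gradient \<phi> x $ i))\<^sup>2)" for x
    unfolding power2_norm_eq_inner inner_vec_def ..
  ultimately show ?thesis using c by (auto simp: Lp_2_iff)
qed

text \<open>Integration by parts: the integral of \<open>\<partial>\<^sub>i (\<phi> \<psi>)\<close> vanishes.\<close>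

lemma test_function_has_weak_gradient:
  assumes \<phi>: "\<phi> \<in> test_functions \<Omega>"
  shows "has_weak_gradient \<Omega> \<phi> (gradient \<phi>)"
  unfolding has_weak_gradient_def
proof (intro conjI ballI allI)
  show "loc_integrable \<Omega> \<phi>" "loc_integrable \<Omega> (gradient \<phi>)"
    using test_function_Lp_2[OF \<phi>] gradient_Lp_2[OF \<phi>]
    by (auto intro!: integrable_imp_loc_integrable Lp_2_integrable)
  fix \<psi> :: "real^'n \<Rightarrow> real" and i assume \<psi>: "\<psi> \<in> test_functions \<Omega>"
  let ?e = "axis i 1 :: real^'n"
  let ?D = "\<lambda>f x. frechet_derivative f (at x) ?e"
  have e: "?e \<in> Basis" by (simp add: axis_in_Basis_iff)
  have prod: "(\<lambda>x. \<phi> x * \<psi> x) \<in> test_functions \<Omega>"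
    by (rule test_functions_mult[OF \<psi> test_function_Ck[OF \<phi>]])
  have "frechet_derivative (\<lambda>x. \<phi> x * \<psi> x) (at x) = (\<lambda>h. \<phi> x * frechet_derivative \<psi> (at x) h + frechet_derivative \<phi> (at x) h * \<psi> x)" for x
    by (rule frechet_derivative_at[symmetric], rule has_derivative_mult)
       (rule test_function_has_derivative[OF \<phi>] test_function_has_derivative[OF \<psi>])+
  then have D: "?D (\<lambda>x. \<phi> x * \<psi> x) x = \<phi> x * ?D \<psi> x + ?D \<phi> x * \<psi> x" for x
    by simp
  have "test_functions \<Omega> \<subseteq> test_functions UNIV" by (auto simp: test_functions_def)
  then have "(LINT x|lborel. ?D (\<lambda>x. \<phi> x * \<psi> x) x) = 0"
    using integral_derivative_eq_0[OF _ e] prod by blast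
  then have "0 = (LINT x|M. ?D (\<lambda>x. \<phi> x * \<psi> x) x)"
    using test_function_integral_domain[OF test_functions_derivative[OF prod e]] by simp
  also have "\<dots> = (LINT x|M. \<phi> x * ?D \<psi> x) + (LINT x|M. ?D \<phi> x * \<psi> x)"
    unfolding D
    using test_function_Lp_2[OF \<phi>] test_function_Lp_2[OF \<psi>]
      test_function_Lp_2[OF test_functions_derivative[OF \<phi> e]] test_function_Lp_2[OF test_functions_derivative[OF \<psi> e]]
    by (intro Bochner_Integration.integral_add Lp_2_mult_integrable)
  finally show "(LINT x|M. \<phi> x * ?D \<psi> x) = - (LINT x|M. gradient \<phi> x $ i * \<psi> x)"
    by (simp add: gradient_def)
qed

lemma W1_weak_grad:
  assumes "v \<in> W1 2 \<Omega>"
  shows "has_weak_gradient \<Omega> v (D v)" "D v \<in> Lp 2 \<Omega>" "v \<in> Lp 2 \<Omega>"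
proof -
  obtain G where G: "G \<in> Lp 2 \<Omega>" "has_weak_gradient \<Omega> v G" using assms by (auto simp: W1_def)
  show h: "has_weak_gradient \<Omega> v (D v)"
    unfolding weak_grad_def using G(2) by (rule someI[where P = "has_weak_gradient \<Omega> v"])
  show "D v \<in> Lp 2 \<Omega>"
    by (rule Lp_2_AE[OF _ G(1) has_weak_gradient_unique[OF G(2) h]]) simp
  show "v \<in> Lp 2 \<Omega>" using assms by (simp add: W1_def)
qed

lemma weak_grad_AE:
  assumes "has_weak_gradient \<Omega> v G"
  shows "AE x in M. D v x = G x"
  using has_weak_gradient_unique[OF someI[of "has_weak_gradient \<Omega> v", OF assms] assms]
  by (simp add: weak_grad_def)

lemma test_function_W1: "\<phi> \<in> test_functions \<Omega> \<Longrightarrow> \<phi> \<in> W1 2 \<Omega>"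
  unfolding W1_def using test_function_Lp_2 gradient_Lp_2 test_function_has_weak_gradient by blast

lemma W1_lincomb:
  assumes v: "v \<in> W1 2 \<Omega>" and w: "w \<in> W1 2 \<Omega>"
  shows "(\<lambda>x. c * v x + d * w x) \<in> W1 2 \<Omega>"
    and "AE x in M. D (\<lambda>x. c * v x + d * w x) x = c *\<^sub>R D v x + d *\<^sub>R D w x"
proof -
  note h = has_weak_gradient_lincomb[OF W1_weak_grad(1)[OF v] W1_weak_grad(1)[OF w], of c d]
  show "AE x in M. D (\<lambda>x. c * v x + d * w x) x = c *\<^sub>R D v x + d *\<^sub>R D w x"
    by (rule weak_grad_AE[OF h])
  have "(\<lambda>x. c *\<^sub>R v x + d *\<^sub>R w x) \<in> Lp 2 \<Omega>" "(\<lambda>x. c *\<^sub>R D v x + d *\<^sub>R D w x) \<in> Lp 2 \<Omega>"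
    by (intro Lp_2_lincomb W1_weak_grad v w)+
  with h show "(\<lambda>x. c * v x + d * w x) \<in> W1 2 \<Omega>" by (auto simp: W1_def)
qed

text \<open>The inner product belonging to the norm \<open>N\<close>; it is introduced for the triangle inequality.\<close>

definition W1_inner :: "(real^'n \<Rightarrow> real) \<Rightarrow> (real^'n \<Rightarrow> real) \<Rightarrow> real" where
  "W1_inner v w = (LINT x|M. v x * w x) + (LINT x|M. D v x \<bullet> D w x)"

lemma W1_inner_commute: "W1_inner v w = W1_inner w v"
  by (simp add: W1_inner_def mult.commute inner_commute)

lemma W1_inner_lincomb:
  assumes v: "v \<in> W1 2 \<Omega>" and w: "w \<in> W1 2 \<Omega>" and u: "u \<in> W1 2 \<Omega>"
  shows "W1_inner (\<lambda>x. c * v x + d * w x) u = c * W1_inner v u + d * W1_inner w u"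
proof -
  note V = W1_weak_grad[OF v] and W = W1_weak_grad[OF w] and U = W1_weak_grad[OF u]
  have "(LINT x|M. (c * v x + d * w x) * u x) = (LINT x|M. c * (v x * u x) + d * (w x * u x))"
    by (rule Bochner_Integration.integral_cong[OF refl]) (simp add: algebra_simps)
  also have "\<dots> = c * (LINT x|M. v x * u x) + d * (LINT x|M. w x * u x)"
    using Lp_2_mult_integrable[OF V(3) U(3)] Lp_2_mult_integrable[OF W(3) U(3)] by simp
  finally have 1: "(LINT x|M. (c * v x + d * w x) * u x) = \<dots>" .
  have "(LINT x|M. D (\<lambda>x. c * v x + d * w x) x \<bullet> D u x) = (LINT x|M. c * (D v x \<bullet> D u x) + d * (D w x \<bullet> D u x))"
    by (rule integral_cong_AE_lebesgue_on)
       (use W1_lincomb(2)[OF v w, of c d] in \<open>auto simp: inner_add_left elim: eventually_mono\<close>)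
  also have "\<dots> = c * (LINT x|M. D v x \<bullet> D u x) + d * (LINT x|M. D w x \<bullet> D u x)"
    using Lp_2_inner_integrable[OF V(2) U(2)] Lp_2_inner_integrable[OF W(2) U(2)] by simp
  finally show ?thesis using 1 by (simp add: W1_inner_def algebra_simps)
qed

lemma W1_inner_self_nonneg: "0 \<le> W1_inner v v"
  unfolding W1_inner_def by (intro add_nonneg_nonneg integral_nonneg_AE) auto

lemma N_eq_W1_inner: "N v = sqrt (W1_inner v v)"
proof -
  have "(LINT x|M. \<bar>v x\<bar> powr 2) + (LINT x|M. norm (D v x) powr 2) = W1_inner v v"
  proof -
    have "\<bar>v x\<bar> powr 2 = v x * v x" "norm (D v x) powr 2 = D v x \<bullet> D v x" for x
      using powr_2_norm[of "v x"] powr_2_norm[of "D v x"]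
      by (simp_all only: real_norm_def power2_abs power2_norm_eq_inner) (simp add: power2_eq_square)
    then show ?thesis by (simp add: W1_inner_def)
  qed
  then show ?thesis using W1_inner_self_nonneg[of v] by (simp add: W1_norm_def powr_half_sqrt)
qed

lemma N_nonneg: "0 \<le> N v"
  by (simp add: N_eq_W1_inner W1_inner_self_nonneg)

lemma N_power2: "(N v)\<^sup>2 = W1_inner v v"
  by (simp add: N_eq_W1_inner W1_inner_self_nonneg)

lemma L2_le_N: "sqrt (LINT x|M. (norm (v x))\<^sup>2) \<le> N v" "sqrt (LINT x|M. (norm (D v x))\<^sup>2) \<le> N v"
proof -
  have "(LINT x|M. (norm (v x))\<^sup>2) = (LINT x|M. v x * v x)" by (simp add: power2_eq_square)
  moreover have "(LINT x|M. (norm (D v x))\<^sup>2) = (LINT x|M. D v x \<bullet> D v x)"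
    by (simp add: power2_norm_eq_inner)
  moreover have "0 \<le> (LINT x|M. v x * v x)" "0 \<le> (LINT x|M. D v x \<bullet> D v x)"
    by (intro integral_nonneg_AE; simp)+
  ultimately show "sqrt (LINT x|M. (norm (v x))\<^sup>2) \<le> N v" "sqrt (LINT x|M. (norm (D v x))\<^sup>2) \<le> N v"
    by (auto simp: N_eq_W1_inner W1_inner_def)
qed

lemma W1_inner_expand:
  assumes v: "v \<in> W1 2 \<Omega>" and w: "w \<in> W1 2 \<Omega>"
  shows "W1_inner (\<lambda>x. c * v x + d * w x) (\<lambda>x. c * v x + d * w x) = c\<^sup>2 * W1_inner v v + 2 * c * d * W1_inner v w + d\<^sup>2 * W1_inner w w"
proof -
  note l = W1_lincomb(1)[OF v w, of c d]
  have "W1_inner (\<lambda>x. c * v x + d * w x) (\<lambda>x. c * v x + d * w x) =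
      c * W1_inner (\<lambda>x. c * v x + d * w x) v + d * W1_inner (\<lambda>x. c * v x + d * w x) w"
    using W1_inner_lincomb[OF v w l] W1_inner_commute by metis
  then show ?thesis
    by (simp add: W1_inner_lincomb[OF v w v] W1_inner_lincomb[OF v w w] W1_inner_commute[of w v] power2_eq_square algebra_simps)
qed

lemma W1_inner_Cauchy_Schwarz:
  assumes v: "v \<in> W1 2 \<Omega>" and w: "w \<in> W1 2 \<Omega>"
  shows "\<bar>W1_inner v w\<bar> \<le> N v * N w"
proof -
  have "(W1_inner v w)\<^sup>2 \<le> W1_inner v v * W1_inner w w"
  proof (rule discriminant_nonpos)
    fix e
    show "0 \<le> W1_inner v v + 2 * e * W1_inner v w + e\<^sup>2 * W1_inner w w"
      using W1_inner_expand[OF v w, of 1 e] W1_inner_self_nonneg[of "\<lambda>x. 1 * v x + e * w x"] by simp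
  qed (rule W1_inner_self_nonneg)
  then have "(W1_inner v w)\<^sup>2 \<le> (N v * N w)\<^sup>2" by (simp add: power_mult_distrib N_power2)
  then have "\<bar>W1_inner v w\<bar> \<le> \<bar>N v * N w\<bar>" by (rule abs_le_square_iff[THEN iffD2])
  then show ?thesis by (simp add: abs_mult N_nonneg)
qed

lemma N_lincomb_le:
  assumes v: "v \<in> W1 2 \<Omega>" and w: "w \<in> W1 2 \<Omega>"
  shows "N (\<lambda>x. c * v x + d * w x) \<le> \<bar>c\<bar> * N v + \<bar>d\<bar> * N w"
proof (rule power2_le_imp_le)
  have "c * d * W1_inner v w \<le> \<bar>c * d\<bar> * (N v * N w)"
  proof -
    have "c * d * W1_inner v w \<le> \<bar>c * d\<bar> * \<bar>W1_inner v w\<bar>" by (simp only: abs_mult[symmetric] abs_ge_self)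
    also have "\<dots> \<le> \<bar>c * d\<bar> * (N v * N w)"
      by (rule mult_left_mono[OF W1_inner_Cauchy_Schwarz[OF v w] abs_ge_zero])
    finally show ?thesis .
  qed
  moreover have "(N (\<lambda>x. c * v x + d * w x))\<^sup>2 = c\<^sup>2 * (N v)\<^sup>2 + 2 * (c * d * W1_inner v w) + d\<^sup>2 * (N w)\<^sup>2"
    unfolding N_power2 W1_inner_expand[OF v w] by simp
  ultimately show "(N (\<lambda>x. c * v x + d * w x))\<^sup>2 \<le> (\<bar>c\<bar> * N v + \<bar>d\<bar> * N w)\<^sup>2"
    by (simp add: power2_sum power_mult_distrib abs_mult mult_ac)
  show "0 \<le> \<bar>c\<bar> * N v + \<bar>d\<bar> * N w" by (simp add: N_nonneg)
qed

lemma W10_W1: "v \<in> W10 2 \<Omega> \<Longrightarrow> v \<in> W1 2 \<Omega>"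
  by (simp add: W10_def)

lemma test_function_W10:
  assumes \<phi>: "\<phi> \<in> test_functions \<Omega>"
  shows "\<phi> \<in> W10 2 \<Omega>"
proof -
  have "N (\<phi> - \<phi>) \<le> 0"
    using N_lincomb_le[OF test_function_W1[OF \<phi>] test_function_W1[OF \<phi>], of 0 0]
    by (simp add: fun_diff_def)
  then have "N (\<phi> - \<phi>) = 0" using N_nonneg[of "\<phi> - \<phi>"] by linarith
  then show ?thesis
    unfolding W10_def using test_function_W1[OF \<phi>] \<phi> by (auto intro!: exI[of _ "\<lambda>_. \<phi>"])
qed

lemma zero_W10: "(\<lambda>x. 0) \<in> W10 2 \<Omega>" "N (\<lambda>x. 0) = 0"
proof -
  show z: "(\<lambda>x. 0) \<in> W10 2 \<Omega>" by (rule test_function_W10[OF test_function_0])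
  have "N (\<lambda>x. 0) \<le> 0"
    using N_lincomb_le[OF W10_W1[OF z] W10_W1[OF z], of 0 0] by simp
  then show "N (\<lambda>x. 0) = 0" using N_nonneg[of "\<lambda>x. 0"] by linarith
qed

lemma W10_lincomb:
  assumes v: "v \<in> W10 2 \<Omega>" and w: "w \<in> W10 2 \<Omega>"
  shows "(\<lambda>x. c * v x + d * w x) \<in> W10 2 \<Omega>"
proof -
  obtain \<phi> where \<phi>: "\<And>k::nat. \<phi> k \<in> test_functions \<Omega>" "(\<lambda>k. N (\<phi> k - v)) \<longlonglongrightarrow> 0"
    using v by (auto simp: W10_def)
  obtain \<psi> where \<psi>: "\<And>k::nat. \<psi> k \<in> test_functions \<Omega>" "(\<lambda>k. N (\<psi> k - w)) \<longlonglongrightarrow> 0"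
    using w by (auto simp: W10_def)
  let ?\<theta> = "\<lambda>k x. c * \<phi> k x + d * \<psi> k x"
  note W1 = W10_W1[OF v] W10_W1[OF w] test_function_W1[OF \<phi>(1)] test_function_W1[OF \<psi>(1)]
  have d: "\<phi> k - v \<in> W1 2 \<Omega>" "\<psi> k - w \<in> W1 2 \<Omega>" for k
    using W1_lincomb(1)[OF W1(3) W1(1), of 1 k "-1"] W1_lincomb(1)[OF W1(4) W1(2), of 1 k "-1"]
    by (simp_all add: fun_diff_def)
  have "(\<lambda>k. N (?\<theta> k - (\<lambda>x. c * v x + d * w x))) \<longlonglongrightarrow> 0"
  proof (rule Lim_null_comparison)
    show "\<forall>\<^sub>F k in sequentially. norm (N (?\<theta> k - (\<lambda>x. c * v x + d * w x))) \<le> \<bar>c\<bar> * N (\<phi> k - v) + \<bar>d\<bar> * N (\<psi> k - w)"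
    proof (rule always_eventually, rule allI)
      fix k
      have "?\<theta> k - (\<lambda>x. c * v x + d * w x) = (\<lambda>x. c * (\<phi> k - v) x + d * (\<psi> k - w) x)"
        by (simp add: fun_eq_iff algebra_simps)
      then show "norm (N (?\<theta> k - (\<lambda>x. c * v x + d * w x))) \<le> \<bar>c\<bar> * N (\<phi> k - v) + \<bar>d\<bar> * N (\<psi> k - w)"
        using N_lincomb_le[OF d, of c k d k] N_nonneg by simp
    qed
    show "(\<lambda>k. \<bar>c\<bar> * N (\<phi> k - v) + \<bar>d\<bar> * N (\<psi> k - w)) \<longlonglongrightarrow> 0"
      using tendsto_add[OF tendsto_mult_right_zero[OF \<phi>(2), of "\<bar>c\<bar>"] tendsto_mult_right_zero[OF \<psi>(2), of "\<bar>d\<bar>"]] by simp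
  qed
  moreover have "?\<theta> k \<in> test_functions \<Omega>" for k
    by (intro test_functions_add test_functions_cmult \<phi> \<psi>)
  ultimately show ?thesis
    unfolding W10_def using W1_lincomb(1)[OF W1(1,2)] by (auto intro!: exI[of _ ?\<theta>])
qed

lemma W10_diff: "v \<in> W10 2 \<Omega> \<Longrightarrow> w \<in> W10 2 \<Omega> \<Longrightarrow> v - w \<in> W10 2 \<Omega>"
  using W10_lincomb[of v w 1 "-1"] by (simp add: fun_diff_def)

lemma W10_cmult: "v \<in> W10 2 \<Omega> \<Longrightarrow> (\<lambda>x. c * v x) \<in> W10 2 \<Omega>"
  using W10_lincomb[of v v c 0] by simp

lemma N_diff_le:
  assumes "v \<in> W1 2 \<Omega>" "w \<in> W1 2 \<Omega>"
  shows "N (v - w) \<le> N v + N w"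
  using N_lincomb_le[OF assms, of 1 "-1"] by (simp add: fun_diff_def)

lemma N_cmult:
  assumes "v \<in> W1 2 \<Omega>"
  shows "N (\<lambda>x. c * v x) = \<bar>c\<bar> * N v"
proof -
  have "(N (\<lambda>x. c * v x))\<^sup>2 = (\<bar>c\<bar> * N v)\<^sup>2"
    using W1_inner_expand[OF assms assms, of c 0] by (simp add: N_power2 power_mult_distrib)
  then show ?thesis by (simp add: N_nonneg)
qed

text \<open>Test the weak derivative of \<open>v\<close> with \<open>x\<^sub>i \<phi>\<close>, where \<open>\<phi>\<close> is close to \<open>v\<close>: since
  \<open>\<partial>\<^sub>i (x\<^sub>i \<phi>) = \<phi> + x\<^sub>i \<partial>\<^sub>i \<phi>\<close> and \<open>\<partial>\<^sub>i \<phi>\<close> is close to zero, \<open>\<integral> v \<phi>\<close> is close to zero.\<close>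

lemma W10_gradient_zero_imp_zero:
  assumes v: "v \<in> W10 2 \<Omega>" and zero: "AE x in M. D v x = 0"
  shows "AE x in M. v x = 0"
proof -
  obtain \<phi> where \<phi>: "\<And>k::nat. \<phi> k \<in> test_functions \<Omega>" "(\<lambda>k. N (\<phi> k - v)) \<longlonglongrightarrow> 0"
    using v by (auto simp: W10_def)
  note vW = W1_weak_grad[OF W10_W1[OF v]]
  obtain R where R: "\<And>x. x \<in> \<Omega> \<Longrightarrow> norm x \<le> R" "0 < R" using bounded_domain by (auto simp: bounded_pos)
  \<comment> \<open>one coordinate direction is enough, and any will do\<close>
  define i where "i = (undefined :: 'n)"
  let ?e = "axis i 1 :: real^'n"
  have e: "?e \<in> Basis" by (simp add: axis_in_Basis_iff)
  let ?L = "sqrt (LINT x|M. (norm (v x))\<^sup>2)"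
  have L0: "0 \<le> ?L" by (simp add: integral_nonneg_AE)
  have est: "\<bar>LINT x|M. v x * v x\<bar> \<le> (?L + R * ?L) * N (\<phi> k - v)" for k
  proof -
    let ?f = "\<phi> k"
    have dW: "?f - v \<in> W1 2 \<Omega>"
      using W1_lincomb(1)[OF test_function_W1[OF \<phi>(1)] W10_W1[OF v], of 1 k "-1"] by (simp add: fun_diff_def)
    note d = W1_weak_grad[OF dW]
    have f2: "?f \<in> Lp 2 \<Omega>" "gradient ?f \<in> Lp 2 \<Omega>" by (rule test_function_Lp_2[OF \<phi>(1)] gradient_Lp_2[OF \<phi>(1)])+
    have gr: "AE x in M. gradient ?f x = D (?f - v) x"
      using weak_grad_AE[OF test_function_has_weak_gradient[OF \<phi>(1), of k]]
        W1_lincomb(2)[OF test_function_W1[OF \<phi>(1), of k] W10_W1[OF v], of 1 "-1"] zero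
      by eventually_elim (simp add: fun_diff_def)
    let ?\<psi> = "\<lambda>x. (x \<bullet> ?e) * ?f x"
    have \<psi>: "?\<psi> \<in> test_functions \<Omega>" by (rule test_functions_mult[OF \<phi>(1) Ck_inner])
    have der: "frechet_derivative ?\<psi> (at x) ?e = ?f x + (x \<bullet> ?e) * gradient ?f x $ i" for x
    proof -
      have "(?\<psi> has_derivative (\<lambda>h. (x \<bullet> ?e) * frechet_derivative ?f (at x) h + (h \<bullet> ?e) * ?f x)) (at x)"
        by (rule has_derivative_mult[OF _ test_function_has_derivative[OF \<phi>(1)]]) (auto intro!: derivative_eq_intros)
      from frechet_derivative_at[OF this, symmetric] show ?thesis
        by (simp add: gradient_def inner_axis_axis)
    qed
    have vf: "integrable M (\<lambda>x. v x * ?f x)" by (rule Lp_2_mult_integrable[OF vW(3) f2(1)])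
    have "(LINT x|M. v x * frechet_derivative ?\<psi> (at x) ?e) = - (LINT x|M. D v x $ i * ?\<psi> x)"
      using vW(1) \<psi> by (simp add: has_weak_gradient_def)
    also have "(LINT x|M. D v x $ i * ?\<psi> x) = 0"
      by (rule integral_eq_zero_AE) (use zero in eventually_elim, simp)
    finally have "0 = (LINT x|M. v x * ?f x + v x * ((x \<bullet> ?e) * gradient ?f x $ i))"
      by (simp add: der distrib_left)
    also have gi: "integrable M (\<lambda>x. v x * ((x \<bullet> ?e) * gradient ?f x $ i))"
    proof -
      have "(\<lambda>x. (x \<bullet> ?e) * gradient ?f x $ i) \<in> test_functions \<Omega>"
        by (rule test_functions_mult[OF gradient_component_test[OF \<phi>(1)] Ck_inner])
      then show ?thesis by (rule Lp_2_mult_integrable[OF vW(3) test_function_Lp_2])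
    qed
    have "(LINT x|M. v x * ?f x + v x * ((x \<bullet> ?e) * gradient ?f x $ i)) =
        (LINT x|M. v x * ?f x) + (LINT x|M. v x * ((x \<bullet> ?e) * gradient ?f x $ i))"
      by (rule Bochner_Integration.integral_add[OF vf gi])
    finally have eq: "(LINT x|M. v x * ?f x) = - (LINT x|M. v x * ((x \<bullet> ?e) * gradient ?f x $ i))" by simp
    have "\<bar>LINT x|M. v x * ((x \<bullet> ?e) * gradient ?f x $ i)\<bar> \<le> (LINT x|M. \<bar>v x * ((x \<bullet> ?e) * gradient ?f x $ i)\<bar>)"
      by (rule integral_abs_bound)
    also have "\<dots> \<le> (LINT x|M. R * (norm (v x) * norm (D (?f - v) x)))"
    proof (rule integral_mono_AE)
      show "integrable M (\<lambda>x. R * (norm (v x) * norm (D (?f - v) x)))"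
        by (intro integrable_mult_right Lp_2_norm_mult_integrable vW d)
      show "AE x in M. \<bar>v x * ((x \<bullet> ?e) * gradient ?f x $ i)\<bar> \<le> R * (norm (v x) * norm (D (?f - v) x))"
        using gr AE_space
      proof eventually_elim
        case (elim x)
        have "\<bar>x \<bullet> ?e\<bar> \<le> R" using Basis_le_norm[OF e, of x] R(1)[of x] elim by simp
        moreover have "\<bar>gradient ?f x $ i\<bar> \<le> norm (D (?f - v) x)"
          using elim component_le_norm_cart[of "gradient ?f x" i] by simp
        ultimately have "\<bar>x \<bullet> ?e\<bar> * \<bar>gradient ?f x $ i\<bar> \<le> R * norm (D (?f - v) x)"
          using R(2) by (intro mult_mono) auto
        then have "\<bar>v x\<bar> * (\<bar>x \<bullet> ?e\<bar> * \<bar>gradient ?f x $ i\<bar>) \<le> \<bar>v x\<bar> * (R * norm (D (?f - v) x))"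
          by (rule mult_left_mono) simp
        then show ?case by (simp add: abs_mult mult_ac)
      qed
    qed (use gi in \<open>rule integrable_abs\<close>)
    also have "\<dots> \<le> R * (?L * N (?f - v))"
    proof -
      have "(LINT x|M. norm (v x) * norm (D (?f - v) x)) \<le> ?L * sqrt (LINT x|M. (norm (D (?f - v) x))\<^sup>2)"
        by (rule Lp_2_Cauchy_Schwarz[OF vW(3) d(2)])
      also have "\<dots> \<le> ?L * N (?f - v)" by (rule mult_left_mono[OF L2_le_N(2) L0])
      finally show ?thesis using R(2) by simp
    qed
    finally have 1: "\<bar>LINT x|M. v x * ?f x\<bar> \<le> R * (?L * N (?f - v))" using eq by simp
    have "\<bar>LINT x|M. v x * (?f - v) x\<bar> \<le> (LINT x|M. \<bar>v x * (?f - v) x\<bar>)"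
      by (rule integral_abs_bound)
    also have "\<dots> = (LINT x|M. norm (v x) * norm ((?f - v) x))" by (simp add: abs_mult)
    also have "\<dots> \<le> ?L * sqrt (LINT x|M. (norm ((?f - v) x))\<^sup>2)"
      by (rule Lp_2_Cauchy_Schwarz[OF vW(3) d(3)])
    also have "\<dots> \<le> ?L * N (?f - v)" by (rule mult_left_mono[OF L2_le_N(1) L0])
    finally have 2: "\<bar>LINT x|M. v x * (?f - v) x\<bar> \<le> ?L * N (?f - v)" .
    have "(LINT x|M. v x * (?f - v) x) = (LINT x|M. v x * ?f x) - (LINT x|M. v x * v x)"
      using Bochner_Integration.integral_diff[OF vf Lp_2_mult_integrable[OF vW(3) vW(3)]] by (simp add: algebra_simps)
    then show ?thesis using 1 2 by (simp add: algebra_simps)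
  qed
  have "\<bar>LINT x|M. v x * v x\<bar> \<le> (?L + R * ?L) * 0"
    by (rule LIMSEQ_le_const[OF tendsto_mult_left[OF \<phi>(2)]]) (use est in blast)
  then have "(LINT x|M. v x * v x) = 0" by (simp only: mult_zero_right abs_le_zero_iff)
  then have "AE x in M. v x * v x = 0"
    using integral_nonneg_eq_0_iff_AE[OF Lp_2_mult_integrable[OF vW(3) vW(3)]] by simp
  then show ?thesis by eventually_elim simp
qed

end

section \<open>The energy form and Bochner functions\<close>

locale diffusion = bounded_domain \<Omega> for \<Omega> :: "(real^'n) set" +
  fixes \<Lambda> :: "real^'n \<Rightarrow> real^'n^'n" and \<alpha> \<mu> :: real
  assumes \<Lambda>_measurable: "\<Lambda> \<in> borel_measurable M"
    and \<alpha>: "0 < \<alpha>" and \<mu>: "0 \<le> \<mu>"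
    and \<Lambda>_bounded: "AE x in M. \<forall>\<xi>. norm (\<Lambda> x *v \<xi>) \<le> \<mu> * norm \<xi>"
    and \<Lambda>_coercive: "AE x in M. \<forall>\<xi>. \<alpha> * (norm \<xi>)\<^sup>2 \<le> (\<Lambda> x *v \<xi>) \<bullet> \<xi>"
    and \<Lambda>_symmetric: "AE x in M. transpose (\<Lambda> x) = \<Lambda> x"
begin

definition a :: "(real^'n \<Rightarrow> real) \<Rightarrow> (real^'n \<Rightarrow> real) \<Rightarrow> real" where
  "a v w = (LINT x|M. (\<Lambda> x *v D v x) \<bullet> D w x)"

lemma \<Lambda>_mult_measurable:
  assumes "G \<in> borel_measurable M"
  shows "(\<lambda>x. \<Lambda> x *v G x) \<in> borel_measurable M"
proof (rule borel_measurable_continuous_Pair[OF \<Lambda>_measurable assms])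
  show "continuous_on UNIV (\<lambda>x. fst x *v (snd x :: real^'n) :: real^'n)"
    unfolding matrix_vector_mult_def by (intro continuous_intros)
qed

lemma a_integrable:
  assumes v: "v \<in> W1 2 \<Omega>" and w: "w \<in> W1 2 \<Omega>"
  shows "integrable M (\<lambda>x. (\<Lambda> x *v D v x) \<bullet> D w x)"
proof (rule Bochner_Integration.integrable_bound[where f = "\<lambda>x. \<mu> * (norm (D v x) * norm (D w x))"])
  note V = W1_weak_grad(2)[OF v] and W = W1_weak_grad(2)[OF w]
  show "integrable M (\<lambda>x. \<mu> * (norm (D v x) * norm (D w x)))"
    by (intro integrable_mult_right Lp_2_norm_mult_integrable V W)
  show "(\<lambda>x. (\<Lambda> x *v D v x) \<bullet> D w x) \<in> borel_measurable M"
    using V W by (intro borel_measurable_inner \<Lambda>_mult_measurable) (auto simp: Lp_2_iff)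
  show "AE x in M. norm ((\<Lambda> x *v D v x) \<bullet> D w x) \<le> norm (\<mu> * (norm (D v x) * norm (D w x)))"
    using \<Lambda>_bounded
  proof eventually_elim
    case (elim x)
    have "\<bar>(\<Lambda> x *v D v x) \<bullet> D w x\<bar> \<le> norm (\<Lambda> x *v D v x) * norm (D w x)"
      by (rule Cauchy_Schwarz_ineq2)
    also have "\<dots> \<le> (\<mu> * norm (D v x)) * norm (D w x)"
      using elim by (intro mult_right_mono) auto
    finally show ?case using \<mu> by (simp add: abs_mult mult.assoc)
  qed
qed

lemma a_le:
  assumes v: "v \<in> W1 2 \<Omega>" and w: "w \<in> W1 2 \<Omega>"
  shows "\<bar>a v w\<bar> \<le> \<mu> * N v * N w"
proof -
  note V = W1_weak_grad(2)[OF v] and W = W1_weak_grad(2)[OF w]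
  have "\<bar>a v w\<bar> \<le> (LINT x|M. \<bar>(\<Lambda> x *v D v x) \<bullet> D w x\<bar>)"
    unfolding a_def by (rule integral_abs_bound)
  also have "\<dots> \<le> (LINT x|M. \<mu> * (norm (D v x) * norm (D w x)))"
  proof (rule integral_mono_AE)
    show "integrable M (\<lambda>x. \<bar>(\<Lambda> x *v D v x) \<bullet> D w x\<bar>)"
      by (rule integrable_abs[OF a_integrable[OF v w]])
    show "integrable M (\<lambda>x. \<mu> * (norm (D v x) * norm (D w x)))"
      by (intro integrable_mult_right Lp_2_norm_mult_integrable V W)
    show "AE x in M. \<bar>(\<Lambda> x *v D v x) \<bullet> D w x\<bar> \<le> \<mu> * (norm (D v x) * norm (D w x))"
      using \<Lambda>_bounded
    proof eventually_elim
      case (elim x)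
      have "\<bar>(\<Lambda> x *v D v x) \<bullet> D w x\<bar> \<le> norm (\<Lambda> x *v D v x) * norm (D w x)"
        by (rule Cauchy_Schwarz_ineq2)
      also have "\<dots> \<le> (\<mu> * norm (D v x)) * norm (D w x)"
        using elim by (intro mult_right_mono) auto
      finally show ?case by (simp add: mult.assoc)
    qed
  qed
  also have "\<dots> = \<mu> * (LINT x|M. norm (D v x) * norm (D w x))" by simp
  also have "\<dots> \<le> \<mu> * (N v * N w)"
  proof (rule mult_left_mono[OF _ \<mu>])
    have "(LINT x|M. norm (D v x) * norm (D w x)) \<le>
        sqrt (LINT x|M. (norm (D v x))\<^sup>2) * sqrt (LINT x|M. (norm (D w x))\<^sup>2)"
      by (rule Lp_2_Cauchy_Schwarz[OF V W])
    also have "\<dots> \<le> N v * N w"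
      by (intro mult_mono L2_le_N N_nonneg) (simp add: integral_nonneg_AE)
    finally show "(LINT x|M. norm (D v x) * norm (D w x)) \<le> N v * N w" .
  qed
  finally show ?thesis by (simp add: mult.assoc)
qed

lemma a_commute:
  assumes "v \<in> W1 2 \<Omega>" "w \<in> W1 2 \<Omega>"
  shows "a v w = a w v"
  unfolding a_def
proof (rule integral_cong_AE_lebesgue_on)
  show "AE x in M. (\<Lambda> x *v D v x) \<bullet> D w x = (\<Lambda> x *v D w x) \<bullet> D v x"
    using \<Lambda>_symmetric
  proof eventually_elim
    case (elim x)
    have "(\<Lambda> x *v D v x) \<bullet> D w x = D v x \<bullet> (transpose (\<Lambda> x) *v D w x)"
      by (metis dot_lmul_matrix vector_transpose_matrix transpose_matrix_vector inner_commute transpose_transpose)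
    then show ?case using elim by (simp add: inner_commute)
  qed
qed simp

lemma a_lincomb:
  assumes v: "v \<in> W1 2 \<Omega>" and w: "w \<in> W1 2 \<Omega>" and u: "u \<in> W1 2 \<Omega>"
  shows "a (\<lambda>x. c * v x + d * w x) u = c * a v u + d * a w u"
proof -
  have "a (\<lambda>x. c * v x + d * w x) u =
      (LINT x|M. c * ((\<Lambda> x *v D v x) \<bullet> D u x) + d * ((\<Lambda> x *v D w x) \<bullet> D u x))"
    unfolding a_def
    by (rule integral_cong_AE_lebesgue_on[OF sets_domain])
       (use W1_lincomb(2)[OF v w, of c d] in eventually_elim,
        simp add: matrix_vector_right_distrib scaleR_matrix_vector_assoc[symmetric] matrix_vector_mult_scaleR inner_add_left)
  then show ?thesis using a_integrable[OF v u] a_integrable[OF w u] by (simp add: a_def)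
qed

lemma a_lincomb_right:
  assumes v: "v \<in> W1 2 \<Omega>" and w: "w \<in> W1 2 \<Omega>" and u: "u \<in> W1 2 \<Omega>"
  shows "a u (\<lambda>x. c * v x + d * w x) = c * a u v + d * a u w"
  using a_lincomb[OF assms, of c d] a_commute[OF u] v w W1_lincomb(1)[OF v w] by simp

lemma a_diff:
  assumes "v \<in> W1 2 \<Omega>" "w \<in> W1 2 \<Omega>" "u \<in> W1 2 \<Omega>"
  shows "a (v - w) u = a v u - a w u" "a u (v - w) = a u v - a u w"
  using a_lincomb[OF assms, of 1 "-1"] a_lincomb_right[OF assms, of 1 "-1"]
  by (simp_all add: fun_diff_def)

text \<open>Coercivity makes the integrand of \<open>a v v\<close> a nonnegative function that dominates
  \<open>\<alpha> \<bar>\<nabla>v\<bar>\<^sup>2\<close>.\<close>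

lemma a_self_zero_imp_gradient_zero:
  assumes v: "v \<in> W1 2 \<Omega>" and "a v v = 0"
  shows "AE x in M. D v x = 0"
proof -
  have nonneg: "AE x in M. 0 \<le> (\<Lambda> x *v D v x) \<bullet> D v x"
    using \<Lambda>_coercive
  proof eventually_elim
    case (elim x)
    have "0 \<le> \<alpha> * (norm (D v x))\<^sup>2" using \<alpha> by simp
    also have "\<dots> \<le> (\<Lambda> x *v D v x) \<bullet> D v x" using elim by blast
    finally show ?case .
  qed
  have "AE x in M. (\<Lambda> x *v D v x) \<bullet> D v x = 0"
    using integral_nonneg_eq_0_iff_AE[OF a_integrable[OF v v] nonneg] assms(2) by (simp add: a_def)
  then show ?thesis using \<Lambda>_coercive
  proof eventually_elim
    case (elim x)
    have "\<alpha> * (norm (D v x))\<^sup>2 \<le> 0" using elim by metis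
    then have "(norm (D v x))\<^sup>2 \<le> 0" using \<alpha> by (simp add: mult_le_0_iff)
    then show ?case by simp
  qed
qed

lemma a_psd:
  assumes F: "finite F" "F \<subseteq> W1 2 \<Omega>"
  shows "0 \<le> (\<Sum>v\<in>F. \<Sum>w\<in>F. c v * c w * a v w)"
proof -
  have i: "integrable M (\<lambda>x. (\<Lambda> x *v D v x) \<bullet> D w x)" if "v \<in> F" "w \<in> F" for v w
    using a_integrable that F by blast
  have "0 \<le> (LINT x|M. (\<Sum>v\<in>F. \<Sum>w\<in>F. c v * c w * ((\<Lambda> x *v D v x) \<bullet> D w x)))"
  proof (rule integral_nonneg_AE)
    show "AE x in M. 0 \<le> (\<Sum>v\<in>F. \<Sum>w\<in>F. c v * c w * ((\<Lambda> x *v D v x) \<bullet> D w x))"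
      using \<Lambda>_coercive
    proof eventually_elim
      case (elim x)
      define y where "y = (\<Sum>v\<in>F. c v *\<^sub>R D v x)"
      have "\<Lambda> x *v y = (\<Sum>v\<in>F. c v *\<^sub>R (\<Lambda> x *v D v x))"
        unfolding y_def using F(1)
        by (induction F rule: finite_induct) (simp_all add: matrix_vector_right_distrib matrix_vector_mult_scaleR)
      then have "(\<Lambda> x *v y) \<bullet> y = (\<Sum>w\<in>F. \<Sum>v\<in>F. c v * c w * ((\<Lambda> x *v D v x) \<bullet> D w x))"
        by (simp add: y_def inner_sum_left inner_sum_right sum_distrib_left mult_ac)
      also have "\<dots> = (\<Sum>v\<in>F. \<Sum>w\<in>F. c v * c w * ((\<Lambda> x *v D v x) \<bullet> D w x))"
        by (rule sum.swap)
      finally have "(\<Lambda> x *v y) \<bullet> y = (\<Sum>v\<in>F. \<Sum>w\<in>F. c v * c w * ((\<Lambda> x *v D v x) \<bullet> D w x))" .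
      moreover have "0 \<le> (\<Lambda> x *v y) \<bullet> y"
        using elim \<alpha> by (meson mult_nonneg_nonneg less_imp_le zero_le_power2 order_trans)
      ultimately show ?case by simp
    qed
  qed
  also have "\<dots> = (\<Sum>v\<in>F. \<Sum>w\<in>F. c v * c w * a v w)"
    using i by (simp add: a_def Bochner_Integration.integral_sum)
  finally show ?thesis .
qed

text \<open>Convergence is required at every time rather than almost everywhere, because the product of
  Lebesgue measure with itself is not complete: measurability of \<open>a (z t) (z r)\<close> in \<open>(t, r)\<close> is
  obtained from a limit that exists everywhere.\<close>

definition path :: "real \<Rightarrow> (real \<Rightarrow> real^'n \<Rightarrow> real) \<Rightarrow> (nat \<Rightarrow> real \<Rightarrow> real^'n \<Rightarrow> real) \<Rightarrow> bool" where
  "path T z s \<longleftrightarrow> (\<forall>t. z t \<in> W10 2 \<Omega>) \<and> (\<forall>k t. s k t \<in> W10 2 \<Omega>) \<and>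
     (\<forall>k. simple_function (lebesgue_on {0<..<T}) (s k)) \<and>
     (\<forall>t\<in>{0<..<T}. (\<lambda>k. N (s k t - z t)) \<longlonglongrightarrow> 0) \<and>
     integrable (lebesgue_on {0<..<T}) (\<lambda>t. (N (z t))\<^sup>2)"

lemma N_triangle_diff:
  assumes v: "v \<in> W1 2 \<Omega>" and w: "w \<in> W1 2 \<Omega>"
  shows "\<bar>N v - N w\<bar> \<le> N (v - w)"
proof -
  have d: "v - w \<in> W1 2 \<Omega>" using W1_lincomb(1)[OF v w, of 1 "-1"] by (simp add: fun_diff_def)
  have "N (\<lambda>x. 1 * w x + 1 * (v - w) x) \<le> N w + N (v - w)"
    using N_lincomb_le[OF w d, of 1 1] by simp
  moreover have "N (\<lambda>x. 1 * v x + (-1) * (v - w) x) \<le> N v + N (v - w)"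
    using N_lincomb_le[OF v d, of 1 "-1"] by simp
  ultimately show ?thesis by simp
qed

lemma N_tendsto:
  assumes "\<And>k. s k \<in> W1 2 \<Omega>" "z \<in> W1 2 \<Omega>" "(\<lambda>k. N (s k - z)) \<longlonglongrightarrow> 0"
  shows "(\<lambda>k. N (s k)) \<longlonglongrightarrow> N z"
proof (rule LIM_zero_cancel, rule Lim_null_comparison[OF _ assms(3)])
  show "\<forall>\<^sub>F k in sequentially. norm (N (s k) - N z) \<le> N (s k - z)"
    using N_triangle_diff[OF assms(1,2)] by simp
qed

lemma path_N_tendsto:
  assumes "path T z s" "t \<in> {0<..<T}"
  shows "(\<lambda>k. N (s k t)) \<longlonglongrightarrow> N (z t)"
  by (rule N_tendsto) (use assms in \<open>auto simp: path_def intro: W10_W1\<close>)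

lemma simple_limit_N_measurable:
  assumes "\<And>k. simple_function L (s k)" "\<And>t. t \<in> space L \<Longrightarrow> (\<lambda>k. N (s k t)) \<longlonglongrightarrow> N (z t)"
  shows "(\<lambda>t. N (z t)) \<in> borel_measurable L"
  by (rule borel_measurable_LIMSEQ_real[OF assms(2)])
     (auto intro!: borel_measurable_simple_function simple_function_compose1[OF assms(1)])

text \<open>Resetting both the function and its approximations to zero on the exceptional null set of
  times leaves a representative that is a limit of simple functions at every time.\<close>

lemma bochner_path:
  assumes z: "z \<in> LpW10 2 T \<Omega>"
  obtains z' s where "path T z' s" "AE t in lebesgue_on {0<..<T}. z' t = z t"
proof -
  let ?J = "{0<..<T}" and ?L = "lebesgue_on {0<..<T}"
  from z obtain s where sm: "AE t in ?L. z t \<in> W10 2 \<Omega>"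
    "\<And>k::nat. finite (s k ` ?J)" "\<And>k. s k ` ?J \<subseteq> W10 2 \<Omega>"
    "\<And>k y. {t \<in> ?J. s k t = y} \<in> sets lebesgue"
    "AE t in ?L. (\<lambda>k. N (s k t - z t)) \<longlonglongrightarrow> 0"
    and int: "integrable ?L (\<lambda>t. N (z t) powr 2)"
    unfolding bochner_Lp_def strongly_measurable_def by blast
  have "AE t in ?L. z t \<in> W10 2 \<Omega> \<and> (\<lambda>k. N (s k t - z t)) \<longlonglongrightarrow> 0"
    using sm(1,5) by eventually_elim simp
  then obtain E where E: "{t \<in> space ?L. \<not> (z t \<in> W10 2 \<Omega> \<and> (\<lambda>k. N (s k t - z t)) \<longlonglongrightarrow> 0)} \<subseteq> E"
    "emeasure ?L E = 0" "E \<in> sets ?L"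
    by (rule AE_E)
  define z' where "z' t = (if t \<in> ?J - E then z t else (\<lambda>x. 0))" for t
  define s' where "s' k t = (if t \<in> ?J - E then s k t else (\<lambda>x. 0))" for k t
  have simple: "simple_function ?L (s k)" for k
    unfolding simple_function_def
  proof (intro conjI ballI)
    fix y
    have "s k -` {y} \<inter> ?J = {t \<in> ?J. s k t = y}" by auto
    then show "s k -` {y} \<inter> space ?L \<in> sets ?L"
      using sm(4)[of k y] by (auto simp: sets_restrict_space_iff)
  qed (use sm(2) in simp)
  have simple': "simple_function ?L (s' k)" for k
    unfolding s'_def
    by (rule simple_function_If_set[OF simple simple_function_const]) (use E(3) in auto)
  have zW: "z' t \<in> W10 2 \<Omega>" for t using E(1) zero_W10 by (auto simp: z'_def)
  have sW: "s' k t \<in> W10 2 \<Omega>" for k t using sm(3)[of k] zero_W10 by (auto simp: s'_def)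
  have conv: "(\<lambda>k. N (s' k t - z' t)) \<longlonglongrightarrow> 0" for t
  proof (cases "t \<in> ?J - E")
    case True
    then show ?thesis using E(1) by (auto simp: s'_def z'_def)
  next
    case False
    then have "s' k t - z' t = (\<lambda>x. 0)" for k unfolding s'_def z'_def by (simp only: if_False fun_diff_def diff_self)
    then show ?thesis using zero_W10(2) by simp
  qed
  have ae: "AE t in ?L. z' t = z t"
  proof (rule AE_I)
    show "{t \<in> space ?L. z' t \<noteq> z t} \<subseteq> E" by (auto simp: z'_def)
  qed (use E in auto)
  have "N (z t) powr 2 = (N (z t))\<^sup>2" for t
    using powr_2_norm[of "N (z t)"] N_nonneg[of "z t"] by simp
  then have "integrable ?L (\<lambda>t. (N (z t))\<^sup>2)" using int by simp
  then have "integrable ?L (\<lambda>t. (N (z' t))\<^sup>2)"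
    by (rule integrable_cong_AE_lebesgue_on[rotated]) (use ae in \<open>auto elim: eventually_mono\<close>)
  with simple' zW sW conv have "path T z' s'" unfolding path_def by blast
  from this ae show ?thesis by (rule that)
qed

lemma path_diff:
  assumes 1: "path T z1 s1" and 2: "path T z2 s2"
  shows "path T (\<lambda>t. z1 t - z2 t) (\<lambda>k t. s1 k t - s2 k t)"
proof -
  let ?L = "lebesgue_on {0<..<T}"
  let ?z = "\<lambda>t. z1 t - z2 t" and ?s = "\<lambda>k t. s1 k t - s2 k t"
  have z: "z1 t \<in> W10 2 \<Omega>" "z2 t \<in> W10 2 \<Omega>" and s: "s1 k t \<in> W10 2 \<Omega>" "s2 k t \<in> W10 2 \<Omega>" for t k
    using 1 2 by (auto simp: path_def)
  have simple: "simple_function ?L (?s k)" for k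
    by (rule simple_function_compose2[where h = "\<lambda>v w. v - w"]) (use 1 2 in \<open>auto simp: path_def\<close>)
  have conv: "(\<lambda>k. N (?s k t - ?z t)) \<longlonglongrightarrow> 0" if "t \<in> {0<..<T}" for t
  proof (rule Lim_null_comparison)
    have "N (?s k t - ?z t) \<le> N (s1 k t - z1 t) + N (s2 k t - z2 t)" for k
    proof -
      have "?s k t - ?z t = (s1 k t - z1 t) - (s2 k t - z2 t)" by (simp add: fun_eq_iff)
      then show ?thesis using N_diff_le[OF W10_W1[OF W10_diff[OF s(1) z(1)]] W10_W1[OF W10_diff[OF s(2) z(2)]]] by simp
    qed
    then show "\<forall>\<^sub>F k in sequentially. norm (N (?s k t - ?z t)) \<le> N (s1 k t - z1 t) + N (s2 k t - z2 t)"
      using N_nonneg by simp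
    show "(\<lambda>k. N (s1 k t - z1 t) + N (s2 k t - z2 t)) \<longlonglongrightarrow> 0"
      using tendsto_add[of "\<lambda>k. N (s1 k t - z1 t)" 0 _ "\<lambda>k. N (s2 k t - z2 t)" 0] 1 2 that by (auto simp: path_def)
  qed
  have "integrable ?L (\<lambda>t. (N (?z t))\<^sup>2)"
  proof (rule Bochner_Integration.integrable_bound[where f = "\<lambda>t. 2 * (N (z1 t))\<^sup>2 + 2 * (N (z2 t))\<^sup>2"])
    have "(\<lambda>t. N (?z t)) \<in> borel_measurable ?L"
    proof (rule simple_limit_N_measurable[OF simple])
      fix t assume "t \<in> space ?L"
      then show "(\<lambda>k. N (?s k t)) \<longlonglongrightarrow> N (?z t)"
        by (intro N_tendsto conv) (auto intro!: W10_W1 W10_diff z s)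
    qed
    then show "(\<lambda>t. (N (?z t))\<^sup>2) \<in> borel_measurable ?L" by measurable
    have "(N (?z t))\<^sup>2 \<le> 2 * (N (z1 t))\<^sup>2 + 2 * (N (z2 t))\<^sup>2" for t
    proof -
      have "(N (?z t))\<^sup>2 \<le> (N (z1 t) + N (z2 t))\<^sup>2"
        by (intro power_mono N_diff_le W10_W1 z N_nonneg)
      also have "\<dots> \<le> 2 * (N (z1 t))\<^sup>2 + 2 * (N (z2 t))\<^sup>2"
        using sum_squares_bound[of "N (z1 t)" "N (z2 t)"] by (simp add: power2_sum)
      finally show ?thesis .
    qed
    then show "AE t in ?L. norm ((N (?z t))\<^sup>2) \<le> norm (2 * (N (z1 t))\<^sup>2 + 2 * (N (z2 t))\<^sup>2)"
      by (intro AE_I2) simp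
  qed (use 1 2 in \<open>auto simp: path_def\<close>)
  then show ?thesis unfolding path_def using simple conv W10_diff[OF z] W10_diff[OF s] by blast
qed

lemma path_restrict:
  assumes p: "path T z s" and \<tau>: "\<tau> \<le> T"
  shows "path \<tau> z s"
proof -
  have id: "(\<lambda>x. x) \<in> measurable (lebesgue_on {0<..<\<tau>}) (lebesgue_on {0<..<T})"
    by (rule measurable_restrict_space3) (use \<tau> in auto)
  have "simple_function (lebesgue_on {0<..<\<tau>}) (s k)" for k
    using simple_function_comp[OF id, of "s k"] p by (simp add: path_def)
  moreover have "integrable (lebesgue_on {0<..<\<tau>}) (\<lambda>t. (N (z t))\<^sup>2)"
    by (rule integrable_subset_lebesgue_on[of "{0<..<T}"]) (use p \<tau> in \<open>auto simp: path_def\<close>)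
  ultimately show ?thesis using p \<tau> by (auto simp: path_def)
qed

lemma a_tendsto:
  assumes s: "\<And>k. s k \<in> W1 2 \<Omega>" and z: "z \<in> W1 2 \<Omega>" and sz: "(\<lambda>k. N (s k - z)) \<longlonglongrightarrow> 0"
    and r: "\<And>k. r k \<in> W1 2 \<Omega>" and y: "y \<in> W1 2 \<Omega>" and ry: "(\<lambda>k. N (r k - y)) \<longlonglongrightarrow> 0"
  shows "(\<lambda>k. a (s k) (r k)) \<longlonglongrightarrow> a z y"
proof (rule LIM_zero_cancel, rule Lim_null_comparison)
  have W1_diff: "v - w \<in> W1 2 \<Omega>" if "v \<in> W1 2 \<Omega>" "w \<in> W1 2 \<Omega>" for v w
    using W1_lincomb(1)[OF that, of 1 "-1"] by (simp add: fun_diff_def)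
  show "\<forall>\<^sub>F k in sequentially. norm (a (s k) (r k) - a z y) \<le> \<mu> * N (s k - z) * N (r k) + \<mu> * N z * N (r k - y)"
  proof (rule always_eventually, rule allI)
    fix k
    have "a (s k) (r k) - a z y = a (s k - z) (r k) + a z (r k - y)"
      by (simp add: a_diff s z r y)
    then show "norm (a (s k) (r k) - a z y) \<le> \<mu> * N (s k - z) * N (r k) + \<mu> * N z * N (r k - y)"
      using a_le[OF W1_diff[OF s z] r, of k k] a_le[OF z W1_diff[OF r y], of k]
      unfolding real_norm_def by linarith
  qed
  have "(\<lambda>k. \<mu> * N (s k - z) * N (r k) + \<mu> * N z * N (r k - y)) \<longlonglongrightarrow> \<mu> * 0 * N y + \<mu> * N z * 0"
    by (intro tendsto_add tendsto_mult tendsto_const sz ry N_tendsto[OF r y ry])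
  then show "(\<lambda>k. \<mu> * N (s k - z) * N (r k) + \<mu> * N z * N (r k - y)) \<longlonglongrightarrow> 0" by simp
qed

lemma path_semidefinite:
  assumes p: "path T z s"
  shows "semidefinite_path (lebesgue_on {0<..<T}) (W10 2 \<Omega>) a N \<mu> (\<lambda>x. 0) z s"
proof -
  interpret T: finite_measure "lebesgue_on {0<..<T}" by (rule finite_measure_lebesgue_on) auto
  have z: "z t \<in> W10 2 \<Omega>" and s: "s k t \<in> W10 2 \<Omega>" for t k using p by (auto simp: path_def)
  have conv: "(\<lambda>k. N (s k t - z t)) \<longlonglongrightarrow> 0" if "t \<in> {0<..<T}" for t using p that by (auto simp: path_def)
  show ?thesis
  proof unfold_locales
    fix F c assume "finite F" "F \<subseteq> W10 2 \<Omega>"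
    then show "0 \<le> (\<Sum>v\<in>F. \<Sum>w\<in>F. c v * c w * a v w)"
      using W10_W1 by (intro a_psd) auto
  next
    fix t \<phi> assume "t \<in> space (lebesgue_on {0<..<T})" "\<phi> \<in> W10 2 \<Omega>"
    moreover have "N (\<phi> - \<phi>) = 0" using zero_W10(2) by (simp add: fun_diff_def)
    ultimately show "(\<lambda>k. a (s k t) \<phi>) \<longlonglongrightarrow> a (z t) \<phi>"
      by (intro a_tendsto conv) (auto intro: W10_W1 z s)
  next
    fix t r assume "t \<in> space (lebesgue_on {0<..<T})" "r \<in> space (lebesgue_on {0<..<T})"
    then show "(\<lambda>k. a (s k t) (s k r)) \<longlonglongrightarrow> a (z t) (z r)"
      by (intro a_tendsto conv) (auto intro: W10_W1 z s)
  next
    fix t assume "t \<in> space (lebesgue_on {0<..<T})"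
    then show "(\<lambda>k. N (s k t)) \<longlonglongrightarrow> N (z t)"
      using path_N_tendsto[OF p] by simp
  qed (use p in \<open>auto simp: path_def zero_W10 N_nonneg \<mu> intro: W10_W1 a_commute a_le\<close>)
qed

text \<open>Simple functions approximating \<open>\<psi>\<close>, multiplied by \<open>\<phi>\<close>, give strong measurability.\<close>

lemma product_test_function_bochner:
  assumes \<psi>: "\<psi> \<in> test_functions {0<..<T}" and \<phi>: "\<phi> \<in> W10 2 \<Omega>"
  shows "(\<lambda>t x. \<psi> t * \<phi> x) \<in> LpW10 2 T \<Omega>"
proof -
  let ?J = "{0<..<T}" and ?L = "lebesgue_on {0<..<T}"
  interpret T: finite_measure ?L by (rule finite_measure_lebesgue_on) auto
  have m: "\<psi> \<in> borel_measurable ?L" by (rule test_function_measurable[OF \<psi>])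
  obtain F where F: "\<And>i. simple_function ?L (F i)" "\<And>t. t \<in> ?J \<Longrightarrow> (\<lambda>i. F i t) \<longlonglongrightarrow> \<psi> t"
    using borel_measurable_implies_sequence_metric[OF m, of 0] by (metis space_lebesgue_on)
  let ?s = "\<lambda>k t x. F k t * \<phi> x"
  have s: "simple_function ?L (?s k)" for k
    by (rule simple_function_compose1[OF F(1), of "\<lambda>c x. c * \<phi> x"])
  have "strongly_measurable T (W10 2 \<Omega>) N (\<lambda>t x. \<psi> t * \<phi> x)"
    unfolding strongly_measurable_def
  proof (intro conjI exI[of _ ?s] allI)
    show "AE t in ?L. (\<lambda>x. \<psi> t * \<phi> x) \<in> W10 2 \<Omega>" using W10_cmult[OF \<phi>] by simp
    fix k
    show "finite (?s k ` ?J)" using simple_functionD(1)[OF s] by simp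
    show "?s k ` ?J \<subseteq> W10 2 \<Omega>" using W10_cmult[OF \<phi>] by auto
    fix y
    have "?s k -` {y} \<inter> ?J = {t \<in> ?J. ?s k t = y}" by auto
    then show "{t \<in> ?J. ?s k t = y} \<in> sets lebesgue"
      using simple_functionD(2)[OF s, of k "{y}"] by (auto simp: sets_restrict_space_iff)
  next
    show "AE t in ?L. (\<lambda>k. N (?s k t - (\<lambda>x. \<psi> t * \<phi> x))) \<longlonglongrightarrow> 0"
    proof (rule AE_I2)
      fix t assume "t \<in> space ?L"
      then have "(\<lambda>k. F k t - \<psi> t) \<longlonglongrightarrow> 0" using LIM_zero[OF F(2)[of t]] by simp
      then have "(\<lambda>k. \<bar>F k t - \<psi> t\<bar> * N \<phi>) \<longlonglongrightarrow> 0"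
        by (intro tendsto_mult_left_zero tendsto_rabs_zero)
      moreover have "?s k t - (\<lambda>x. \<psi> t * \<phi> x) = (\<lambda>x. (F k t - \<psi> t) * \<phi> x)" for k
        by (simp add: fun_eq_iff algebra_simps)
      ultimately show "(\<lambda>k. N (?s k t - (\<lambda>x. \<psi> t * \<phi> x))) \<longlonglongrightarrow> 0"
        by (simp add: N_cmult[OF W10_W1[OF \<phi>]])
    qed
  qed
  moreover have "integrable ?L (\<lambda>t. N (\<lambda>x. \<psi> t * \<phi> x) powr 2)"
  proof -
    obtain C where C: "\<And>t. \<bar>\<psi> t\<bar> \<le> C" using test_function_bounded[OF \<psi>] by blast
    have "N (\<lambda>x. \<psi> t * \<phi> x) powr 2 = (\<psi> t)\<^sup>2 * (N \<phi>)\<^sup>2" for t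
      using powr_2_norm[of "\<psi> t * N \<phi>"]
      by (simp add: N_cmult[OF W10_W1[OF \<phi>]] abs_mult N_nonneg power_mult_distrib)
    moreover have "integrable ?L (\<lambda>t. (\<psi> t)\<^sup>2)"
    proof (rule T.integrable_const_bound[where B = "C\<^sup>2"])
      have "(\<psi> t)\<^sup>2 \<le> C\<^sup>2" for t
        using C[of t] by (intro power2_le_iff_abs_le[THEN iffD2]) auto
      then show "AE t in ?L. norm ((\<psi> t)\<^sup>2) \<le> C\<^sup>2" by (intro AE_I2) simp
    qed (use m in measurable)
    ultimately show ?thesis by simp
  qed
  ultimately show ?thesis by (simp add: bochner_Lp_def)
qed

end

section \<open>Uniqueness\<close>

text \<open>The exceptional set is Lebesgue measurable in the product, hence a Borel set up to a null set.
  Tonelli's theorem is applied to that Borel set, whose slices lie in the null slices of the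
  exceptional set.\<close>

lemma AE_slices_imp_AE:
  fixes f g :: "(real^'n) \<times> real \<Rightarrow> real"
  assumes \<Omega>: "open \<Omega>"
    and f: "f \<in> borel_measurable (lebesgue_on (\<Omega> \<times> {0<..<T}))"
    and g: "g \<in> borel_measurable (lebesgue_on (\<Omega> \<times> {0<..<T}))"
    and ae: "AE t in lebesgue_on {0<..<T}. AE x in lebesgue_on \<Omega>. f (x, t) = g (x, t)"
  shows "AE z in lebesgue_on (\<Omega> \<times> {0<..<T}). f z = g z"
proof -
  let ?Q = "\<Omega> \<times> {0<..<T}"
  have Q: "?Q \<in> sets lebesgue"
    using open_Times[OF \<Omega> open_greaterThanLessThan, of 0 T] by auto
  define E where "E = {z \<in> ?Q. f z \<noteq> g z}"
  have "{z \<in> space (lebesgue_on ?Q). f z \<noteq> g z} \<in> sets (lebesgue_on ?Q)"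
    using f g by measurable
  then have "E \<in> sets lebesgue"
    using Q by (auto simp: E_def sets_restrict_space_iff)
  then obtain B C where BC: "B \<in> sets borel" "negligible C" "B \<union> C = E"
    by (rule sets_lebesgue_almost_borel)
  have B: "B \<in> sets (lborel \<Otimes>\<^sub>M lborel)"
    unfolding lborel_prod using BC(1) by simp
  have slice: "emeasure lborel ((\<lambda>x. (x, t)) -` B) = 0"
    if t: "t \<in> {0<..<T} \<longrightarrow> (AE x in lebesgue_on \<Omega>. f (x, t) = g (x, t))" for t
  proof (cases "t \<in> {0<..<T}")
    case True
    have "(\<lambda>x. (x, t)) -` B \<in> sets lborel"
      using sets_Pair2[OF B] by simp
    moreover have "AE x in lebesgue. x \<notin> (\<lambda>x. (x, t)) -` B"
    proof -
      have "AE x in lebesgue. x \<in> \<Omega> \<longrightarrow> f (x, t) = g (x, t)"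
        using t True \<Omega> by (simp add: AE_restrict_space_iff)
      then show ?thesis
        by eventually_elim (use BC(3) in \<open>auto simp: E_def\<close>)
    qed
    ultimately show ?thesis
      using AE_iff_measurable[of "(\<lambda>x. (x, t)) -` B" lborel "\<lambda>x. x \<notin> (\<lambda>x. (x, t)) -` B"]
      by (auto simp: AE_completion_iff)
  next
    case False
    moreover have "B \<subseteq> ?Q" using BC(3) by (auto simp: E_def)
    ultimately have "(\<lambda>x. (x, t)) -` B = {}" by auto
    then show ?thesis by simp
  qed
  have "AE t in lebesgue. t \<in> {0<..<T} \<longrightarrow> (AE x in lebesgue_on \<Omega>. f (x, t) = g (x, t))"
    using ae by (simp add: AE_restrict_space_iff)
  then have "AE t in lborel. emeasure lborel ((\<lambda>x. (x, t)) -` B) = 0"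
    unfolding AE_completion_iff by eventually_elim (rule slice)
  then have "(\<integral>\<^sup>+t. emeasure lborel ((\<lambda>x. (x, t)) -` B) \<partial>lborel) = 0"
    by (subst nn_integral_cong_AE) auto
  then have "emeasure lborel B = 0"
    using lborel_pair.emeasure_pair_measure_alt2[OF B] by (simp add: lborel_prod)
  then have "negligible B"
    using BC(1) by (simp add: negligible_iff_emeasure0)
  then have "negligible E" using BC(2,3) negligible_Un by blast
  then have "AE z in lebesgue. z \<notin> E"
    using AE_not_in by (auto simp: negligible_iff_null_sets)
  then show ?thesis
    using Q by (simp add: AE_restrict_space_iff) (auto simp: E_def elim: eventually_mono)
qed

context diffusion
begin

text \<open>The bound makes \<open>F\<close> continuous for \<open>N\<close>, and test functions are dense in \<open>W10 2 \<Omega>\<close>.\<close>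

lemma W10_density:
  assumes lin: "\<And>v w. v \<in> W10 2 \<Omega> \<Longrightarrow> w \<in> W10 2 \<Omega> \<Longrightarrow> F v - F w = F (v - w)"
    and bound: "\<And>v. v \<in> W10 2 \<Omega> \<Longrightarrow> \<bar>F v\<bar> \<le> C * N v"
    and zero: "\<And>\<phi>. \<phi> \<in> test_functions \<Omega> \<Longrightarrow> F \<phi> = 0"
    and v: "v \<in> W10 2 \<Omega>"
  shows "(F v :: real) = 0"
proof -
  obtain \<phi> where \<phi>: "\<And>k::nat. \<phi> k \<in> test_functions \<Omega>" "(\<lambda>k. N (\<phi> k - v)) \<longlonglongrightarrow> 0"
    using v by (auto simp: W10_def)
  have est: "\<bar>F v\<bar> \<le> C * N (\<phi> k - v)" for k
  proof -
    have "F (\<phi> k - v) = - F v"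
      using lin[OF test_function_W10[OF \<phi>(1)] v] zero[OF \<phi>(1)] by simp
    then show ?thesis using bound[OF W10_diff[OF test_function_W10[OF \<phi>(1)] v], of k] by simp
  qed
  have "\<bar>F v\<bar> \<le> C * 0"
    by (rule LIMSEQ_le_const[OF tendsto_mult_left[OF \<phi>(2)]]) (use est in blast)
  then show ?thesis by simp
qed

text \<open>The core of the proof, for any pair \<open>b\<close>, \<open>z\<close> linked by the equation and with \<open>\<integral> b(t) z(t) \<ge> 0\<close>.
  The equation is integrated in time for smooth \<open>\<phi>\<close> (\<open>test\<close>), extended to \<open>W10 2 \<Omega>\<close> by density (\<open>W10\<close>)
  because \<open>z(t)\<close> is not smooth, and used with \<open>\<phi> = z(t)\<close> to make the energy nonpositive (\<open>zero\<close>).\<close>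

lemma energy_argument:
  assumes T: "0 < T" and z: "path T z s"
    and b: "\<And>t. t \<in> {0..T} \<Longrightarrow> b t \<in> Lp 2 \<Omega>"
    and b_cont: "\<And>\<phi>. \<phi> \<in> Lp 2 \<Omega> \<Longrightarrow> continuous_on {0..T} (\<lambda>t. LINT x|M. b t x * \<phi> x)"
    and b_0: "AE x in M. b 0 x = 0"
    and eq: "\<And>\<psi> \<phi>. \<psi> \<in> test_functions {0<..<T} \<Longrightarrow> \<phi> \<in> test_functions \<Omega> \<Longrightarrow>
      (LINT t|lebesgue_on {0<..<T}. deriv \<psi> t * (LINT x|M. b t x * \<phi> x)) =
      (LINT t|lebesgue_on {0<..<T}. \<psi> t * a (z t) \<phi>)"
    and sign: "AE t in lebesgue_on {0<..<T}. 0 \<le> (LINT x|M. b t x * z t x)"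
  shows "\<And>t. t \<in> {0..T} \<Longrightarrow> AE x in M. b t x = 0"
    and "AE t in lebesgue_on {0<..<T}. AE x in M. z t x = 0"
proof -
  let ?J = "{0<..<T}" and ?L = "lebesgue_on {0<..<T}"
  have zW: "z t \<in> W10 2 \<Omega>" and sW: "s k t \<in> W10 2 \<Omega>" for t k using z by (auto simp: path_def)
  have semi: "semidefinite_path (lebesgue_on {0<..<\<tau>}) (W10 2 \<Omega>) a N \<mu> (\<lambda>x. 0) z s" if "\<tau> \<le> T" for \<tau>
    by (rule path_semidefinite[OF path_restrict[OF z that]])
  have a_int: "integrable (lebesgue_on {0<..<\<tau>}) (\<lambda>t. a (z t) \<phi>)" if "\<tau> \<le> T" "\<phi> \<in> W10 2 \<Omega>" for \<tau> \<phi>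
    by (rule semidefinite_path.a_integrable[OF semi[OF that(1)] that(2)])
  have test: "(LINT x|M. b t x * \<phi> x) = - (LINT r|lebesgue_on {0<..<t}. a (z r) \<phi>)"
    if t: "t \<in> {0..T}" and \<phi>: "\<phi> \<in> test_functions \<Omega>" for t \<phi>
  proof -
    have "(LINT x|M. b t x * \<phi> x) = (LINT x|M. b 0 x * \<phi> x) - (LINT r|lebesgue_on {0<..<t}. a (z r) \<phi>)"
      by (rule du_Bois_Reymond[OF T b_cont[OF test_function_Lp_2[OF \<phi>]]
            a_int[OF order_refl test_function_W10[OF \<phi>]] eq[OF _ \<phi>] t])
    moreover have "(LINT x|M. b 0 x * \<phi> x) = 0"
      by (rule integral_eq_zero_AE) (use b_0 in eventually_elim, simp)
    ultimately show ?thesis by simp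
  qed
  have W10: "(LINT x|M. b t x * \<phi> x) = - (LINT r|lebesgue_on {0<..<t}. a (z r) \<phi>)"
    if t: "t \<in> {0..T}" and \<phi>: "\<phi> \<in> W10 2 \<Omega>" for t \<phi>
  proof -
    have tT: "t \<le> T" using t by simp
    interpret P: semidefinite_path "lebesgue_on {0<..<t}" "W10 2 \<Omega>" a N \<mu> "\<lambda>x. 0" z s
      by (rule semi[OF tT])
    define F where "F v = (LINT x|M. b t x * v x) + (LINT r|lebesgue_on {0<..<t}. a (z r) v)" for v
    let ?B = "sqrt (LINT x|M. (norm (b t x))\<^sup>2)" and ?Z = "LINT r|lebesgue_on {0<..<t}. \<mu> * N (z r)"
    have "F \<phi> = 0"
    proof (rule W10_density[OF _ _ _ \<phi>])
      fix v w assume v: "v \<in> W10 2 \<Omega>" and w: "w \<in> W10 2 \<Omega>"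
      note bv = Lp_2_mult_integrable[OF b[OF t] W1_weak_grad(3)[OF W10_W1]]
      have "(LINT x|M. b t x * (v - w) x) = (LINT x|M. b t x * v x - b t x * w x)"
        by (simp add: fun_diff_def right_diff_distrib)
      also have "\<dots> = (LINT x|M. b t x * v x) - (LINT x|M. b t x * w x)"
        by (rule Bochner_Integration.integral_diff[OF bv[OF v] bv[OF w]])
      finally have 1: "(LINT x|M. b t x * (v - w) x) = (LINT x|M. b t x * v x) - (LINT x|M. b t x * w x)" .
      have "(LINT r|lebesgue_on {0<..<t}. a (z r) (v - w)) = (LINT r|lebesgue_on {0<..<t}. a (z r) v - a (z r) w)"
        by (simp add: a_diff W10_W1 zW v w)
      also have "\<dots> = (LINT r|lebesgue_on {0<..<t}. a (z r) v) - (LINT r|lebesgue_on {0<..<t}. a (z r) w)"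
        by (rule Bochner_Integration.integral_diff[OF a_int[OF tT v] a_int[OF tT w]])
      finally show "F v - F w = F (v - w)" using 1 by (simp add: F_def)
    next
      fix v assume v: "v \<in> W10 2 \<Omega>"
      note v2 = W1_weak_grad(3)[OF W10_W1[OF v]]
      have "\<bar>LINT x|M. b t x * v x\<bar> \<le> (LINT x|M. \<bar>b t x * v x\<bar>)" by (rule integral_abs_bound)
      also have "\<dots> = (LINT x|M. norm (b t x) * norm (v x))" by (simp add: abs_mult)
      also have "\<dots> \<le> ?B * sqrt (LINT x|M. (norm (v x))\<^sup>2)" by (rule Lp_2_Cauchy_Schwarz[OF b[OF t] v2])
      also have "\<dots> \<le> ?B * N v" by (rule mult_left_mono[OF L2_le_N(1)]) (simp add: integral_nonneg_AE)
      finally have 1: "\<bar>LINT x|M. b t x * v x\<bar> \<le> ?B * N v" .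
      have "\<bar>LINT r|lebesgue_on {0<..<t}. a (z r) v\<bar> \<le> (LINT r|lebesgue_on {0<..<t}. \<bar>a (z r) v\<bar>)"
        by (rule integral_abs_bound)
      also have "\<dots> \<le> (LINT r|lebesgue_on {0<..<t}. \<mu> * N (z r) * N v)"
      proof (rule integral_mono_AE)
        show "AE r in lebesgue_on {0<..<t}. \<bar>a (z r) v\<bar> \<le> \<mu> * N (z r) * N v"
          by (intro AE_I2 a_le W10_W1 zW v)
      qed (use a_int[OF tT v] P.n_integrable in auto)
      also have "\<dots> = ?Z * N v" by simp
      finally show "\<bar>F v\<bar> \<le> (?B + ?Z) * N v"
        using 1 unfolding F_def distrib_right by linarith
    next
      fix v assume "v \<in> test_functions \<Omega>"
      then show "F v = 0" using test[OF t] by (simp add: F_def)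
    qed
    then show ?thesis by (simp add: F_def)
  qed
  have neg: "AE t in ?L. (LINT r|lebesgue_on {0<..<t}. a (z r) (z t)) \<le> 0"
    using sign AE_space
  proof eventually_elim
    case (elim t)
    then show ?case using W10[OF _ zW, of t t] by simp
  qed
  have zero: "(LINT r|lebesgue_on {0<..<\<tau>}. a (z r) \<phi>) = 0" if \<tau>: "\<tau> \<in> {0..T}" and \<phi>: "\<phi> \<in> W10 2 \<Omega>" for \<tau> \<phi>
  proof -
    have \<tau>T: "\<tau> \<le> T" using \<tau> by simp
    let ?M = "lebesgue_on {0<..<\<tau>}"
    interpret P: semidefinite_path ?M "W10 2 \<Omega>" a N \<mu> "\<lambda>x. 0" z s
      by (rule semi[OF \<tau>T])
    have inner: "(LINT r|?M. (if r < t then a (z r) (z t) else 0)) = (LINT r|lebesgue_on {0<..<t}. a (z r) (z t))"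
      if "t \<in> {0<..<\<tau>}" for t
    proof -
      have "(LINT r|?M. (if r < t then a (z r) (z t) else 0)) = (LINT r|?M. (if r \<in> {0<..<t} then a (z r) (z t) else 0))"
        by (rule Bochner_Integration.integral_cong[OF refl]) auto
      also have "\<dots> = (LINT r|lebesgue_on {0<..<t}. a (z r) (z t))"
        by (rule Lebesgue_Measure.integral_restrict) (use that in auto)
      finally show ?thesis .
    qed
    have "AE t in lebesgue. t \<in> ?J \<longrightarrow> (LINT r|lebesgue_on {0<..<t}. a (z r) (z t)) \<le> 0"
      using neg by (simp add: AE_restrict_space_iff)
    then have "AE t in lebesgue. t \<in> {0<..<\<tau>} \<longrightarrow> (LINT r|?M. (if r < t then a (z r) (z t) else 0)) \<le> 0"
      by eventually_elim (use inner \<tau>T in auto)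
    then have "AE t in ?M. 0 \<le> - (LINT r|?M. (if r < t then a (z r) (z t) else 0))"
      by (simp add: AE_restrict_space_iff)
    then have "0 \<le> (LINT t|?M. - (LINT r|?M. (if r < t then a (z r) (z t) else 0)))"
      by (rule integral_nonneg_AE)
    moreover have "P.energy = 2 * (LINT t|?M. LINT r|?M. (if r < t then a (z r) (z t) else 0))"
      unfolding P.energy_def
      by (rule symmetric_kernel_half[OF P.aa_integrable]) (rule a_commute[OF W10_W1[OF zW] W10_W1[OF zW]])
    ultimately have "P.energy = 0" using P.energy_nonneg by simp
    then show ?thesis using P.energy_Cauchy_Schwarz[OF \<phi>] by simp
  qed
  show b_zero: "AE x in M. b t x = 0" if t: "t \<in> {0..T}" for t
  proof (rule fundamental_lemma_variations[OF open_domain])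
    show "loc_integrable \<Omega> (b t)"
      by (rule integrable_imp_loc_integrable[OF Lp_2_integrable[OF b[OF t]]])
    show "(LINT x|M. b t x * \<phi> x) = 0" if "\<phi> \<in> test_functions \<Omega>" for \<phi>
      using test[OF t that] zero[OF t test_function_W10[OF that]] by simp
  qed
  have slice: "AE t in ?L. a (z t) \<phi> = 0" if \<phi>: "\<phi> \<in> test_functions \<Omega>" for \<phi>
  proof (rule fundamental_lemma_variations)
    show "loc_integrable ?J (\<lambda>t. a (z t) \<phi>)"
      unfolding loc_integrable_def
      using integrable_subset_lebesgue_on[OF a_int[OF order_refl test_function_W10[OF \<phi>]]]
        fmeasurableD[OF lmeasurable_compact] by auto
    fix \<psi> :: "real \<Rightarrow> real" assume \<psi>: "\<psi> \<in> test_functions ?J"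
    have "(LINT t|?L. deriv \<psi> t * (LINT x|M. b t x * \<phi> x)) = 0"
    proof (rule integral_eq_zero_AE, rule AE_I2)
      fix t assume "t \<in> space ?L"
      then have "t \<in> {0..T}" by simp
      then show "deriv \<psi> t * (LINT x|M. b t x * \<phi> x) = 0"
        using test[OF _ \<phi>] zero[OF _ test_function_W10[OF \<phi>]] by simp
    qed
    then show "(LINT t|?L. a (z t) \<phi> * \<psi> t) = 0"
      using eq[OF \<psi> \<phi>] by (simp add: mult.commute)
  qed simp
  \<comment> \<open>the exceptional null set depends on \<open>\<phi>\<close>; a countable family near the values of \<open>s\<close> suffices\<close>
  define Y where "Y = (\<Union>k. s k ` ?J)"
  have "countable (s k ` ?J)" for k
    using z by (intro countable_finite) (auto simp: path_def simple_function_def)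
  then have Y: "countable Y" by (simp add: Y_def)
  have "\<forall>y\<in>Y. \<exists>\<phi>. (\<forall>k::nat. \<phi> k \<in> test_functions \<Omega>) \<and> (\<lambda>k. N (\<phi> k - y)) \<longlonglongrightarrow> 0"
    using sW by (auto simp: Y_def W10_def)
  then obtain \<Phi> where \<Phi>: "\<And>y k. y \<in> Y \<Longrightarrow> \<Phi> y (k::nat) \<in> test_functions \<Omega>"
    "\<And>y. y \<in> Y \<Longrightarrow> (\<lambda>k. N (\<Phi> y k - y)) \<longlonglongrightarrow> 0"
    by metis
  have "AE t in ?L. \<forall>y\<in>Y. \<forall>k. a (z t) (\<Phi> y k) = 0"
    unfolding AE_ball_countable[OF Y] AE_all_countable using slice \<Phi>(1) by blast
  then show "AE t in ?L. AE x in M. z t x = 0"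
    using AE_space
  proof eventually_elim
    case (elim t)
    have N0: "(\<lambda>k. N (z t - z t)) \<longlonglongrightarrow> 0" using zero_W10(2) by (simp add: fun_diff_def)
    have "a (z t) (s k t) = 0" for k
    proof -
      have y: "s k t \<in> Y" using elim(2) unfolding Y_def by (intro UN_I[of k] imageI) auto
      have "(\<lambda>j. a (z t) (\<Phi> (s k t) j)) \<longlonglongrightarrow> a (z t) (s k t)"
        by (rule a_tendsto[OF _ _ N0 _ _ \<Phi>(2)[OF y]])
           (auto intro: W10_W1 zW sW test_function_W1 \<Phi>(1)[OF y])
      then show ?thesis using elim y by (simp add: LIMSEQ_const_iff)
    qed
    moreover have "(\<lambda>k. a (z t) (s k t)) \<longlonglongrightarrow> a (z t) (z t)"
      by (rule a_tendsto[OF _ _ N0]) (use elim z in \<open>auto simp: path_def intro: W10_W1\<close>)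
    ultimately have "a (z t) (z t) = 0" by (simp add: LIMSEQ_const_iff)
    then show ?case
      by (intro W10_gradient_zero_imp_zero[OF zW] a_self_zero_imp_gradient_zero[OF W10_W1[OF zW]])
  qed
qed

text \<open>The product \<open>\<psi>(t) \<phi>(x)\<close> is at once admissible in the weak formulation and of the form for which
  the distributional time derivative is defined: linearity of \<open>db t\<close> moves \<open>\<psi> t\<close> out.\<close>

lemma weak_form_product:
  assumes z: "path T z s" "AE t in lebesgue_on {0<..<T}. z t = w t"
    and db: "AE t in lebesgue_on {0<..<T}. db t \<in> W10_dual 2 \<Omega>"
    and time: "has_time_derivative T \<Omega> g db"
    and gb: "AE t in lebesgue_on {0<..<T}. AE x in M. g t x = b t x"
    and \<psi>: "\<psi> \<in> test_functions {0<..<T}" and \<phi>: "\<phi> \<in> test_functions \<Omega>"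
  shows "(LINT t|lebesgue_on {0<..<T}. db t (\<lambda>x. \<psi> t * \<phi> x)) +
      (LINT t|lebesgue_on {0<..<T}. LINT x|M. (\<Lambda> x *v D (w t) x) \<bullet> D (\<lambda>x. \<psi> t * \<phi> x) x) =
      - (LINT t|lebesgue_on {0<..<T}. deriv \<psi> t * (LINT x|M. b t x * \<phi> x)) +
      (LINT t|lebesgue_on {0<..<T}. \<psi> t * a (z t) \<phi>)"
proof -
  let ?L = "lebesgue_on {0<..<T}"
  note \<phi>W = test_function_W10[OF \<phi>]
  have J: "{0<..<T} \<in> sets lebesgue" by simp
  have "(LINT t|?L. db t (\<lambda>x. \<psi> t * \<phi> x)) = (LINT t|?L. \<psi> t * db t \<phi>)"
  proof (rule integral_cong_AE_lebesgue_on[OF J])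
    show "AE t in ?L. db t (\<lambda>x. \<psi> t * \<phi> x) = \<psi> t * db t \<phi>"
      using db by eventually_elim (use \<phi>W in \<open>simp add: W10_dual_def\<close>)
  qed
  also have "\<dots> = - (LINT t|?L. deriv \<psi> t * (LINT x|M. g t x * \<phi> x))"
    using time \<psi> \<phi> by (simp add: has_time_derivative_def)
  also have "(LINT t|?L. deriv \<psi> t * (LINT x|M. g t x * \<phi> x)) = (LINT t|?L. deriv \<psi> t * (LINT x|M. b t x * \<phi> x))"
  proof (rule integral_cong_AE_lebesgue_on[OF J])
    show "AE t in ?L. deriv \<psi> t * (LINT x|M. g t x * \<phi> x) = deriv \<psi> t * (LINT x|M. b t x * \<phi> x)"
      using gb
    proof eventually_elim
      case (elim t)
      have "(LINT x|M. g t x * \<phi> x) = (LINT x|M. b t x * \<phi> x)"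
        by (rule integral_cong_AE_lebesgue_on[OF sets_domain]) (use elim in eventually_elim, simp)
      then show ?case by simp
    qed
  qed
  finally have 1: "(LINT t|?L. db t (\<lambda>x. \<psi> t * \<phi> x)) = - (LINT t|?L. deriv \<psi> t * (LINT x|M. b t x * \<phi> x))" .
  have "(LINT t|?L. LINT x|M. (\<Lambda> x *v D (w t) x) \<bullet> D (\<lambda>x. \<psi> t * \<phi> x) x) = (LINT t|?L. \<psi> t * a (z t) \<phi>)"
  proof (rule integral_cong_AE_lebesgue_on[OF J])
    show "AE t in ?L. (LINT x|M. (\<Lambda> x *v D (w t) x) \<bullet> D (\<lambda>x. \<psi> t * \<phi> x) x) = \<psi> t * a (z t) \<phi>"
      using z(2)
    proof eventually_elim
      case (elim t)
      have zt: "z t \<in> W1 2 \<Omega>" using z(1) W10_W1 by (auto simp: path_def)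
      have "a (z t) (\<lambda>x. \<psi> t * \<phi> x + 0 * \<phi> x) = \<psi> t * a (z t) \<phi> + 0 * a (z t) \<phi>"
        by (rule a_lincomb_right[OF W10_W1[OF \<phi>W] W10_W1[OF \<phi>W] zt])
      then show ?case using elim by (simp add: a_def)
    qed
  qed
  with 1 show ?thesis by simp
qed

end

text \<open>The ellipticity constants are read off from the coercivity and the growth of \<open>a\<close>; since
  \<open>\<Lambda> x\<close> is homogeneous, the additive term in the growth bound drops out.\<close>

lemma admissible_imp_diffusion:
  assumes "open \<Omega>" "bounded \<Omega>"
    and adm: "admissible 2 T \<Omega> \<beta> \<zeta> \<nu> a f uini"
    and a: "\<And>x s \<xi>. x \<in> \<Omega> \<Longrightarrow> a x s \<xi> = \<Lambda> x *v \<xi>"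
    and \<Lambda>: "\<Lambda> \<in> borel_measurable (lebesgue_on \<Omega>)"
    and sym: "AE x in lebesgue_on \<Omega>. transpose (\<Lambda> x) = \<Lambda> x"
  obtains \<alpha> \<mu> where "diffusion \<Omega> \<Lambda> \<alpha> \<mu>"
proof -
  obtain \<alpha> \<mu> aup where \<alpha>: "0 < \<alpha>" and \<mu>: "0 < \<mu>"
    and ae: "AE x in lebesgue_on \<Omega>. \<forall>s \<xi> \<eta>.
           a x s \<xi> \<bullet> \<xi> \<ge> \<alpha> * norm \<xi> powr 2 \<and>
           norm (a x s \<xi>) \<le> aup x + \<mu> * norm \<xi> powr (2 - 1) \<and>
           (a x s \<xi> - a x s \<eta>) \<bullet> (\<xi> - \<eta>) \<ge> 0"
    using adm unfolding admissible_def by blast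
  have "diffusion \<Omega> \<Lambda> \<alpha> \<mu>"
  proof unfold_locales
    show "AE x in lebesgue_on \<Omega>. \<forall>\<xi>. \<alpha> * (norm \<xi>)\<^sup>2 \<le> (\<Lambda> x *v \<xi>) \<bullet> \<xi>"
      using ae AE_space
    proof eventually_elim
      case (elim x)
      show ?case
      proof
        fix \<xi> :: "real^'a"
        have "\<alpha> * norm \<xi> powr 2 \<le> a x 0 \<xi> \<bullet> \<xi>" using elim(1) by blast
        then show "\<alpha> * (norm \<xi>)\<^sup>2 \<le> (\<Lambda> x *v \<xi>) \<bullet> \<xi>" using elim(2) by (simp add: a powr_2_norm)
      qed
    qed
    show "AE x in lebesgue_on \<Omega>. \<forall>\<xi>. norm (\<Lambda> x *v \<xi>) \<le> \<mu> * norm \<xi>"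
      using ae AE_space
    proof eventually_elim
      case (elim x)
      show ?case
      proof (rule allI, rule ccontr)
        fix \<xi> :: "real^'a"
        \<comment> \<open>the growth bound applied to \<open>k \<xi>\<close> for large \<open>k\<close>\<close>
        assume "\<not> norm (\<Lambda> x *v \<xi>) \<le> \<mu> * norm \<xi>"
        then have "0 < norm (\<Lambda> x *v \<xi>) - \<mu> * norm \<xi>" by simp
        then obtain k :: nat where k: "aup x < of_nat k * (norm (\<Lambda> x *v \<xi>) - \<mu> * norm \<xi>)"
          using ex_less_of_nat_mult by blast
        have "norm (a x 0 (of_nat k *\<^sub>R \<xi>)) \<le> aup x + \<mu> * norm (of_nat k *\<^sub>R \<xi>) powr (2 - 1)"
          using elim(1) by blast
        then have "of_nat k * norm (\<Lambda> x *v \<xi>) \<le> aup x + \<mu> * (of_nat k * norm \<xi>)"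
          using elim(2) by (simp add: a matrix_vector_mult_scaleR)
        with k show False by (simp add: algebra_simps)
      qed
    qed
  qed (use assms \<alpha> \<mu> in auto)
  then show ?thesis by (rule that)
qed

theorem theoremC1:
  fixes T :: real
    and \<Omega> :: "(real^'n) set"
    and \<beta> \<zeta> \<nu> :: "real \<Rightarrow> real"
    and a :: "real^'n \<Rightarrow> real \<Rightarrow> real^'n \<Rightarrow> real^'n"
    and f :: "real \<Rightarrow> (real^'n \<Rightarrow> real) \<Rightarrow> real"
    and uini :: "real^'n \<Rightarrow> real"
    and \<Lambda> :: "real^'n \<Rightarrow> real^'n^'n"
    and u1 u2 :: "(real^'n) \<times> real \<Rightarrow> real"
  assumes "T > 0"
    and "open \<Omega>" and "bounded \<Omega>"
    and "admissible 2 T \<Omega> \<beta> \<zeta> \<nu> a f uini"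
    and "\<And>x s \<xi>. x \<in> \<Omega> \<Longrightarrow> a x s \<xi> = \<Lambda> x *v \<xi>"
    and "\<Lambda> \<in> borel_measurable (lebesgue_on \<Omega>)"
    and "\<exists>l_min>0. \<exists>l_max>0. AE x in lebesgue_on \<Omega>.
           transpose (\<Lambda> x) = \<Lambda> x \<and> (\<forall>e. eigenvalue (\<Lambda> x) e \<longrightarrow> e \<in> {l_min..l_max})"
    and "solution 2 T \<Omega> \<beta> \<zeta> \<nu> a f uini u1"
    and "solution 2 T \<Omega> \<beta> \<zeta> \<nu> a f uini u2"
  shows "(AE z in lebesgue_on (\<Omega> \<times> {0<..<T}). \<beta> (u1 z) = \<beta> (u2 z)) \<and>
         (AE z in lebesgue_on (\<Omega> \<times> {0<..<T}). \<zeta> (u1 z) = \<zeta> (u2 z))"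
proof -
  let ?J = "{0<..<T}" and ?L = "lebesgue_on {0<..<T}" and ?Q = "\<Omega> \<times> {0<..<T}"
  have sym: "AE x in lebesgue_on \<Omega>. transpose (\<Lambda> x) = \<Lambda> x"
    using assms(7) by (auto elim: eventually_mono)
  obtain \<alpha> \<mu> where "diffusion \<Omega> \<Lambda> \<alpha> \<mu>"
    by (rule admissible_imp_diffusion[OF assms(2-4) assms(5) assms(6) sym])
  then interpret diffusion \<Omega> \<Lambda> \<alpha> \<mu> .
  have mono: "mono \<beta>" "mono \<zeta>" using assms(4) by (auto simp: admissible_def)

  define w1 where "w1 t x = \<zeta> (u1 (x, t))" for t x
  define w2 where "w2 t x = \<zeta> (u2 (x, t))" for t x
  have w_eq: "(\<lambda>x. \<zeta> (u1 (x, t))) = w1 t" "(\<lambda>x. \<zeta> (u2 (x, t))) = w2 t" for t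
    by (simp_all add: w1_def w2_def fun_eq_iff)

  obtain b1 db1 where u1: "u1 \<in> borel_measurable (lebesgue_on ?Q)" "w1 \<in> LpW10 2 T \<Omega>"
    and b1: "weakly_continuous_L2 T \<Omega> b1"
      "AE t in ?L. AE x in M. \<beta> (u1 (x, t)) = b1 t x" "AE x in M. b1 0 x = \<beta> (uini x)"
    and db1: "db1 \<in> LpW10_dual 2 T \<Omega>" "has_time_derivative T \<Omega> (\<lambda>t x. \<beta> (u1 (x, t))) db1"
    and eq1: "\<And>v. v \<in> LpW10 2 T \<Omega> \<Longrightarrow> (LINT t|?L. db1 t (v t)) +
        (LINT t|?L. LINT x|M. a x (\<nu> (u1 (x, t))) (D (w1 t) x) \<bullet> D (v t) x) = (LINT t|?L. f t (v t))"
    using assms(8) unfolding solution_def w_eq w1_def[abs_def, symmetric] by blast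
  obtain b2 db2 where u2: "u2 \<in> borel_measurable (lebesgue_on ?Q)" "w2 \<in> LpW10 2 T \<Omega>"
    and b2: "weakly_continuous_L2 T \<Omega> b2"
      "AE t in ?L. AE x in M. \<beta> (u2 (x, t)) = b2 t x" "AE x in M. b2 0 x = \<beta> (uini x)"
    and db2: "db2 \<in> LpW10_dual 2 T \<Omega>" "has_time_derivative T \<Omega> (\<lambda>t x. \<beta> (u2 (x, t))) db2"
    and eq2: "\<And>v. v \<in> LpW10 2 T \<Omega> \<Longrightarrow> (LINT t|?L. db2 t (v t)) +
        (LINT t|?L. LINT x|M. a x (\<nu> (u2 (x, t))) (D (w2 t) x) \<bullet> D (v t) x) = (LINT t|?L. f t (v t))"
    using assms(9) unfolding solution_def w_eq w2_def[abs_def, symmetric] by blast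
  have dual: "AE t in ?L. db1 t \<in> W10_dual 2 \<Omega>" "AE t in ?L. db2 t \<in> W10_dual 2 \<Omega>"
    using db1(1) db2(1) by (simp_all add: bochner_Lp_def strongly_measurable_def)
  obtain z1 s1 where z1: "path T z1 s1" "AE t in ?L. z1 t = w1 t" by (rule bochner_path[OF u1(2)])
  obtain z2 s2 where z2: "path T z2 s2" "AE t in ?L. z2 t = w2 t" by (rule bochner_path[OF u2(2)])

  let ?b = "\<lambda>t x. b1 t x - b2 t x" and ?z = "\<lambda>t. z1 t - z2 t"
  have zW: "z1 t \<in> W10 2 \<Omega>" "z2 t \<in> W10 2 \<Omega>" for t using z1 z2 by (auto simp: path_def)
  have bL: "b1 t \<in> Lp 2 \<Omega>" "b2 t \<in> Lp 2 \<Omega>" if "t \<in> {0..T}" for t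
    using b1(1) b2(1) that by (auto simp: weakly_continuous_L2_def)
  have bcont: "continuous_on {0..T} (\<lambda>t. LINT x|M. b1 t x * \<phi> x)"
      "continuous_on {0..T} (\<lambda>t. LINT x|M. b2 t x * \<phi> x)" if "\<phi> \<in> Lp 2 \<Omega>" for \<phi>
    using b1(1) b2(1) that by (auto simp: weakly_continuous_L2_def)
  have bdiff: "(LINT x|M. ?b t x * \<phi> x) = (LINT x|M. b1 t x * \<phi> x) - (LINT x|M. b2 t x * \<phi> x)"
    if "t \<in> {0..T}" "\<phi> \<in> Lp 2 \<Omega>" for t \<phi>
    using Bochner_Integration.integral_diff[OF Lp_2_mult_integrable[OF bL(1)[OF that(1)] that(2)]
        Lp_2_mult_integrable[OF bL(2)[OF that(1)] that(2)]]
    by (simp add: left_diff_distrib)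

  have weak: "(LINT t|?L. deriv \<psi> t * (LINT x|M. ?b t x * \<phi> x)) = (LINT t|?L. \<psi> t * local.a (?z t) \<phi>)"
    if \<psi>: "\<psi> \<in> test_functions ?J" and \<phi>: "\<phi> \<in> test_functions \<Omega>" for \<psi> \<phi>
  proof -
    note v = product_test_function_bochner[OF \<psi> test_function_W10[OF \<phi>]]
    have flux: "(LINT t|?L. LINT x|M. a x (\<nu> (u (x, t))) (D (w t) x) \<bullet> D (\<lambda>x. \<psi> t * \<phi> x) x) =
        (LINT t|?L. LINT x|M. (\<Lambda> x *v D (w t) x) \<bullet> D (\<lambda>x. \<psi> t * \<phi> x) x)" for u w
      by (intro Bochner_Integration.integral_cong refl) (simp add: assms(5))
    note \<phi>2 = test_function_Lp_2[OF \<phi>]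
    have \<psi>': "continuous_on {0..T} (deriv \<psi>)"
      using test_function_continuous[OF test_functions_deriv[OF \<psi>]] continuous_on_subset by blast
    have int_c: "integrable ?L h" if "continuous_on {0..T} h" for h :: "real \<Rightarrow> real"
      using continuous_imp_integrable_real[OF that] by (rule integrable_subset_lebesgue_on) auto
    have int_b: "integrable ?L (\<lambda>t. deriv \<psi> t * (LINT x|M. b1 t x * \<phi> x))"
        "integrable ?L (\<lambda>t. deriv \<psi> t * (LINT x|M. b2 t x * \<phi> x))"
      by (rule int_c[OF continuous_on_mult[OF \<psi>' bcont(1)[OF \<phi>2]]])
         (rule int_c[OF continuous_on_mult[OF \<psi>' bcont(2)[OF \<phi>2]]])
    have int_a: "integrable ?L (\<lambda>t. \<psi> t * local.a (z t) \<phi>)" if "path T z s" for z s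
    proof -
      obtain C where C: "\<And>t. \<bar>\<psi> t\<bar> \<le> C" using test_function_bounded[OF \<psi>] by blast
      have i: "integrable ?L (\<lambda>t. local.a (z t) \<phi>)"
        by (rule semidefinite_path.a_integrable[OF path_semidefinite[OF that] test_function_W10[OF \<phi>]])
      show ?thesis
      proof (rule Bochner_Integration.integrable_bound[OF integrable_mult_right[OF i, of C]])
        show "AE t in ?L. norm (\<psi> t * local.a (z t) \<phi>) \<le> norm (C * local.a (z t) \<phi>)"
          using C by (intro AE_I2) (auto simp: abs_mult intro!: mult_right_mono order_trans[OF C abs_ge_self])
      qed (use i test_function_measurable[OF \<psi>] in auto)
    qed
    have "- (LINT t|?L. deriv \<psi> t * (LINT x|M. b1 t x * \<phi> x)) + (LINT t|?L. \<psi> t * local.a (z1 t) \<phi>) =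
        - (LINT t|?L. deriv \<psi> t * (LINT x|M. b2 t x * \<phi> x)) + (LINT t|?L. \<psi> t * local.a (z2 t) \<phi>)"
      using weak_form_product[OF z1 dual(1) db1(2) b1(2) \<psi> \<phi>] eq1[OF v]
        weak_form_product[OF z2 dual(2) db2(2) b2(2) \<psi> \<phi>] eq2[OF v]
      unfolding flux by simp
    moreover have "(LINT t|?L. deriv \<psi> t * (LINT x|M. ?b t x * \<phi> x)) =
        (LINT t|?L. deriv \<psi> t * (LINT x|M. b1 t x * \<phi> x)) - (LINT t|?L. deriv \<psi> t * (LINT x|M. b2 t x * \<phi> x))"
    proof -
      have "(LINT t|?L. deriv \<psi> t * (LINT x|M. ?b t x * \<phi> x)) =
          (LINT t|?L. deriv \<psi> t * (LINT x|M. b1 t x * \<phi> x) - deriv \<psi> t * (LINT x|M. b2 t x * \<phi> x))"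
        by (rule Bochner_Integration.integral_cong[OF refl]) (simp add: bdiff[OF _ \<phi>2] right_diff_distrib)
      then show ?thesis using Bochner_Integration.integral_diff[OF int_b] by simp
    qed
    moreover have "(LINT t|?L. \<psi> t * local.a (?z t) \<phi>) =
        (LINT t|?L. \<psi> t * local.a (z1 t) \<phi>) - (LINT t|?L. \<psi> t * local.a (z2 t) \<phi>)"
      using Bochner_Integration.integral_diff[OF int_a[OF z1(1)] int_a[OF z2(1)]]
      by (simp add: a_diff W10_W1 zW test_function_W1[OF \<phi>] right_diff_distrib)
    ultimately show ?thesis by simp
  qed

  have sign: "AE t in ?L. 0 \<le> (LINT x|M. ?b t x * ?z t x)"
    using b1(2) b2(2) z1(2) z2(2)
  proof eventually_elim
    case (elim t)
    have "AE x in M. 0 \<le> ?b t x * ?z t x"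
      using elim(1,2)
    proof eventually_elim
      case (elim x)
      have "0 \<le> (\<beta> p - \<beta> q) * (\<zeta> p - \<zeta> q)" for p q
        using monoD[OF mono(1), of p q] monoD[OF mono(1), of q p] monoD[OF mono(2), of p q] monoD[OF mono(2), of q p]
        by (cases "p \<le> q") (auto simp: zero_le_mult_iff)
      from this[of "u1 (x, t)" "u2 (x, t)"] show ?case
        using elim \<open>z1 t = w1 t\<close> \<open>z2 t = w2 t\<close> by (simp add: w1_def w2_def)
    qed
    then show ?case by (rule integral_nonneg_AE)
  qed

  note energy = energy_argument[OF assms(1) path_diff[OF z1(1) z2(1)] _ _ _ weak sign]
  have b: "?b t \<in> Lp 2 \<Omega>" if "t \<in> {0..T}" for t
    using Lp_2_lincomb[OF bL[OF that], of 1 "-1"] by simp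
  have bc: "continuous_on {0..T} (\<lambda>t. LINT x|M. ?b t x * \<phi> x)" if "\<phi> \<in> Lp 2 \<Omega>" for \<phi>
    using continuous_on_diff[OF bcont[OF that]]
    by (rule continuous_on_eq) (simp add: bdiff[OF _ that])
  have b0: "AE x in M. ?b 0 x = 0"
    using b1(3) b2(3) by eventually_elim simp
  have \<beta>_slices: "AE t in ?L. AE x in M. \<beta> (u1 (x, t)) = \<beta> (u2 (x, t))"
    using b1(2) b2(2) AE_space
  proof eventually_elim
    case (elim t)
    then have "AE x in M. ?b t x = 0" by (intro energy(1)[OF b bc b0]) auto
    with elim(1,2) show ?case by eventually_elim simp
  qed
  have z0: "AE t in ?L. AE x in M. ?z t x = 0"
    by (rule energy(2)[OF b bc b0])
  have \<zeta>_slices: "AE t in ?L. AE x in M. \<zeta> (u1 (x, t)) = \<zeta> (u2 (x, t))"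
    using z0 z1(2) z2(2)
  proof eventually_elim
    case (elim t)
    from elim(1) show ?case
      by eventually_elim (use elim(2,3) in \<open>simp add: w1_def w2_def\<close>)
  qed
  have m: "(\<lambda>z. g (u z)) \<in> borel_measurable (lebesgue_on ?Q)"
    if "mono g" "u \<in> borel_measurable (lebesgue_on ?Q)" for g :: "real \<Rightarrow> real" and u
    using measurable_compose[OF that(2) borel_measurable_mono[OF that(1)]] .
  show ?thesis
    using AE_slices_imp_AE[OF assms(2) m[OF mono(1) u1(1)] m[OF mono(1) u2(1)] \<beta>_slices]
      AE_slices_imp_AE[OF assms(2) m[OF mono(2) u1(1)] m[OF mono(2) u2(1)] \<zeta>_slices] by blast
qed

end
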